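(* Let $m\ge n\ge 1$, let $A=(\mathbf{a}_1,\dots,\mathbf{a}_n)\in\mathbb{R}^{m\times n}$ have rank $n$, and let $A_k\in\mathbb{R}^{m\times k}$ consist of the first $k$ columns of $A$. Let $R_k\in\mathbb{R}^{k\times k}$ (upper triangular) and $Q_k\in\mathbb{R}^{m\times k}$, $k=1,\dots,n$, be the matrices computed in floating point arithmetic with machine unit $\varepsilon_M$ by the Cholesky-like classical Gram--Schmidt algorithm (CGS--P) applied to $A$. Define $$c_1(m,k)=\begin{cases}1,&k=1\\ 2\sqrt2\,mk+2\sqrt k,&k=2,\dots,n,\end{cases}\qquad c_2(m,k)=\begin{cases}m+2,&k=1\\ 3.5\,mk^2-1.5\,mk+16k,&k=2,\dots,n,\end{cases}$$ $$c_3(m,k)=0.5\,c_2(m,k),\qquad c_4(m,k)=c_2(m,k)+2c_1(m,k),$$ and $\kappa_2(R_k)=\|R_k\|_2\,\|R_k^{-1}\|_2$. Assume that for each $k=1,\dots,n$ $$c_4(m,k)\,\varepsilon_M\,\kappa_2(R_k)^2<1 .$$ Then for $k=1,\dots,n$, to within terms of $O(\varepsilon_M^2)$, the computed matrices $R_k$ and $Q_k$ satisfy $$Q_kR_k-A_k=\Delta A_k,\qquad \|\Delta A_k\|_2\le c_1(m,k)\,\|A_k\|_2\,\varepsilon_M,$$ $$R_k^TR_k-A_k^TA_k=E_k,\qquad \|E_k\|_2\le c_2(m,k)\,\|A_k\|_2^2\,\varepsilon_M,$$ $$\|R_k\|_2=\|A_k\|_2(1+\mu_k),\qquad |\mu_k|\le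 c_3(m,k)\,\varepsilon_M,$$ $$\|I-Q_k^TQ_k\|_2\le c_4(m,k)\,\kappa_2(R_k)^2\,\varepsilon_M,$$ $$\|Q_k\|_2\le\sqrt2 .$$
   Context: Algorithm CGS--P (Cholesky-like classical Gram--Schmidt). Input: $A=(\mathbf{a}_1,\dots,\mathbf{a}_n)\in\mathbb{R}^{m\times n}$. Set $r_{11}=\|\mathbf{a}_1\|_2$, $\mathbf{q}_1=\mathbf{a}_1/r_{11}$, $R_1=(r_{11})$, $Q_1=(\mathbf{q}_1)$. For $k=2,\dots,n$, perform in order: $\mathbf{s}_k=Q_{k-1}^T\mathbf{a}_k$; $\mathbf{v}_k=\mathbf{a}_k-Q_{k-1}\mathbf{s}_k$; $\psi_k=\|\mathbf{a}_k\|_2$, $\phi_k=\|\mathbf{s}_k\|_2$; $r_{kk}=(\psi_k-\phi_k)^{1/2}(\psi_k+\phi_k)^{1/2}$; $\mathbf{q}_k=\mathbf{v}_k/r_{kk}$; $R_k=\begin{pmatrix}R_{k-1}&\mathbf{s}_k\\0&r_{kk}\end{pmatrix}$, $Q_k=(Q_{k-1}\ \ \mathbf{q}_k)$. All quantities in the claim ($R_k$, $Q_k$) are the ones actually computed, i.e. with every arithmetic operation of the algorithm rounded. Inner products, matrix-vector products and 2-norms are evaluated by the usual formulas from elementary operations (the 2-norm as the square root of the sum of squares). Floating point model: the arithmetic satisfies the IEEE floating point standard with machine unit $\varepsilon_M$, results being in the normalized range, so that each operation $x\circ y$ with $\circ\in\{+,-,\times,/\}$ is computed as $f\ell(x\circ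 y)=(x\circ y)(1+\delta)$ with $|\delta|\le\varepsilon_M$, and likewise $f\ell(\sqrt x)=\sqrt x\,(1+\delta)$ with $|\delta|\le\varepsilon_M$. First-order convention: "to within terms of $O(\varepsilon_M^2)$" means that each of the stated upper bounds holds after adding a term that is $O(\varepsilon_M^2)$ to its right-hand side, where $O(\varepsilon_M^2)$ is understood as $\varepsilon_M\to0$ with implied constant allowed to depend on $m$, $n$ and $A$ but not on $\varepsilon_M$ or on the individual rounding errors. (In this convention $(1+\varepsilon_M)^{p}=1+p\,\varepsilon_M+O(\varepsilon_M^2)$.) $\|\cdot\|_2$ denotes the Euclidean norm of a vector and the spectral norm of a matrix. The assumption on $\kappa_2(R_k)$ includes that the algorithm runs to completion and that each computed $R_k$ is nonsingular. *)

theory Defs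
  imports
    "HOL-Library.Landau_Symbols"
    "Jordan_Normal_Form.DL_Rank"
    "Jordan_Normal_Form.Gauss_Jordan_Elimination"
begin

section \<open>Norms and condition number\<close>

definition norm2 :: "real vec \<Rightarrow> real" where
  "norm2 v = sqrt (v \<bullet> v)"

text \<open>The operator norm induced by the Euclidean norm; meaningful when there is at least one column
  (otherwise the supremum is over the empty set).\<close>

definition spectral_norm :: "real mat \<Rightarrow> real" where
  "spectral_norm M = Sup {norm2 (M *\<^sub>v x) | x. x \<in> carrier_vec (dim_col M) \<and> norm2 x = 1}"

text \<open>Meaningful for invertible matrices only: \<^const>\<open>mat_inverse\<close> is \<^const>\<open>None\<close> otherwise.\<close>

definition kappa2 :: "real mat \<Rightarrow> real" where
  "kappa2 M = spectral_norm M * spectral_norm (the (mat_inverse M))"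

definition leading_cols :: "nat \<Rightarrow> 'a mat \<Rightarrow> 'a mat" where
  "leading_cols k A = mat (dim_row A) k (\<lambda>(i, j). A $$ (i, j))"


section \<open>Rounded arithmetic\<close>

text \<open>\<^term>\<open>e\<close> is the machine unit. The predicates below relate operands to every result
  that the rounding model admits; the last argument is the computed result. A square root of a
  negative number and a division by zero have no admissible result.\<close>

definition rounded :: "real \<Rightarrow> real \<Rightarrow> real \<Rightarrow> bool" where
  "rounded e x y \<longleftrightarrow> (\<exists>\<delta>. \<bar>\<delta>\<bar> \<le> e \<and> y = x * (1 + \<delta>))"

definition fl_div :: "real \<Rightarrow> real \<Rightarrow> real \<Rightarrow> real \<Rightarrow> bool" where
  "fl_div e x y z \<longleftrightarrow> y \<noteq> 0 \<and> rounded e (x / y) z"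

definition fl_sqrt :: "real \<Rightarrow> real \<Rightarrow> real \<Rightarrow> bool" where
  "fl_sqrt e x z \<longleftrightarrow> 0 \<le> x \<and> rounded e (sqrt x) z"

text \<open>Summation of the numbers \<^term>\<open>f i\<close> over a nonempty finite index set, in an arbitrary
  order and bracketing. \<^term>\<open>N\<close> numbers take \<^term>\<open>N - 1\<close> rounded additions.\<close>

inductive fl_sum :: "real \<Rightarrow> (nat \<Rightarrow> real) \<Rightarrow> nat set \<Rightarrow> real \<Rightarrow> bool" for e f where
  fl_sum_single: "fl_sum e f {i} (f i)"
| fl_sum_add: "\<lbrakk>fl_sum e f S x; fl_sum e f T y; S \<inter> T = {}; rounded e (x + y) z\<rbrakk>
    \<Longrightarrow> fl_sum e f (S \<union> T) z"

definition fl_dot :: "real \<Rightarrow> real vec \<Rightarrow> real vec \<Rightarrow> real \<Rightarrow> bool" where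
  "fl_dot e x y z \<longleftrightarrow> dim_vec x = dim_vec y \<and>
     (\<exists>p. (\<forall>i<dim_vec x. rounded e (x $ i * y $ i) (p i)) \<and> fl_sum e p {..<dim_vec x} z)"

definition fl_norm2 :: "real \<Rightarrow> real vec \<Rightarrow> real \<Rightarrow> bool" where
  "fl_norm2 e x z \<longleftrightarrow> (\<exists>t. fl_dot e x x t \<and> fl_sqrt e t z)"

definition fl_mult_mat_vec :: "real \<Rightarrow> real mat \<Rightarrow> real vec \<Rightarrow> real vec \<Rightarrow> bool" where
  "fl_mult_mat_vec e M x y \<longleftrightarrow> dim_vec y = dim_row M \<and> (\<forall>i<dim_row M. fl_dot e (row M i) x (y $ i))"

definition fl_minus_vec :: "real \<Rightarrow> real vec \<Rightarrow> real vec \<Rightarrow> real vec \<Rightarrow> bool" where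
  "fl_minus_vec e x y z \<longleftrightarrow> dim_vec x = dim_vec y \<and> dim_vec z = dim_vec x \<and>
     (\<forall>i<dim_vec x. rounded e (x $ i - y $ i) (z $ i))"

definition fl_div_vec :: "real \<Rightarrow> real vec \<Rightarrow> real \<Rightarrow> real vec \<Rightarrow> bool" where
  "fl_div_vec e x r z \<longleftrightarrow> dim_vec z = dim_vec x \<and> (\<forall>i<dim_vec x. fl_div e (x $ i) r (z $ i))"


section \<open>Cholesky-like classical Gram--Schmidt\<close>

definition cgsp_init :: "real \<Rightarrow> real vec \<Rightarrow> real mat \<Rightarrow> real mat \<Rightarrow> bool" where
  "cgsp_init e a R Q \<longleftrightarrow> (\<exists>r q.
     fl_norm2 e a r \<and> fl_div_vec e a r q \<and>
     R = mat 1 1 (\<lambda>_. r) \<and> Q = mat_of_cols (dim_vec a) [q])"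

definition cgsp_step ::
  "real \<Rightarrow> real vec \<Rightarrow> real mat \<Rightarrow> real mat \<Rightarrow> real mat \<Rightarrow> real mat \<Rightarrow> bool" where
  "cgsp_step e a R Q R' Q' \<longleftrightarrow> (\<exists>s p v \<psi> \<phi> d d' g g' r q.
     fl_mult_mat_vec e Q\<^sup>T a s \<and>
     fl_mult_mat_vec e Q s p \<and> fl_minus_vec e a p v \<and>
     fl_norm2 e a \<psi> \<and> fl_norm2 e s \<phi> \<and>
     rounded e (\<psi> - \<phi>) d \<and> fl_sqrt e d d' \<and>
     rounded e (\<psi> + \<phi>) g \<and> fl_sqrt e g g' \<and>
     rounded e (d' * g') r \<and>
     fl_div_vec e v r q \<and>
     R' = four_block_mat R (mat_of_cols (dim_row R) [s]) (0\<^sub>m 1 (dim_col R)) (mat 1 1 (\<lambda>_. r)) \<and>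
     Q' = mat_of_cols (dim_row Q) (cols Q @ [q]))"

text \<open>\<^term>\<open>R k\<close> and \<^term>\<open>Q k\<close>, for \<^term>\<open>k\<close> from 1 to the number of columns, are the matrices
  of a single run that completes; \<^term>\<open>col A (k - 1)\<close> is the \<^term>\<open>k\<close>-th column, as library
  indices start at 0.\<close>

definition cgsp_run :: "real \<Rightarrow> real mat \<Rightarrow> (nat \<Rightarrow> real mat) \<Rightarrow> (nat \<Rightarrow> real mat) \<Rightarrow> bool" where
  "cgsp_run e A R Q \<longleftrightarrow>
     cgsp_init e (col A 0) (R 1) (Q 1) \<and>
     (\<forall>k\<in>{2..dim_col A}. cgsp_step e (col A (k - 1)) (R (k - 1)) (Q (k - 1)) (R k) (Q k))"


section \<open>Constants\<close>

definition c1 :: "nat \<Rightarrow> nat \<Rightarrow> real" where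
  "c1 m k = (if k = 1 then 1 else 2 * sqrt 2 * real m * real k + 2 * sqrt (real k))"

definition c2 :: "nat \<Rightarrow> nat \<Rightarrow> real" where
  "c2 m k = (if k = 1 then real m + 2
     else 3.5 * real m * (real k)\<^sup>2 - 1.5 * real m * real k + 16 * real k)"

definition c3 :: "nat \<Rightarrow> nat \<Rightarrow> real" where
  "c3 m k = 0.5 * c2 m k"

definition c4 :: "nat \<Rightarrow> nat \<Rightarrow> real" where
  "c4 m k = c2 m k + 2 * c1 m k"

end

(* As the machine unit e tends to 0, the computed entries converge, uniformly over all admissible
   rounding errors, to those of the exact Gram-Schmidt factorization. Dividing the elementary rounding
   error bounds by e and passing to the limit, the residuals QR - A and R^T R - A^T A are bounded
   to first order by constants that for k >= 2 lie strictly below c1 ||A|| and c2 ||A||^2, so the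
   claimed bounds hold without any second-order term once e is small; k = 1 is computed directly.
   The remaining bounds follow from | ||R||^2 - ||A||^2 | <= ||E|| and from
   R^T (I - Q^T Q) R = E - (QR - A)^T QR - A^T (QR - A), since R^-1 stays bounded.
   For e >= e0 > 0, the hypothesis on the condition number bounds all computed quantities by a
   constant D, and D <= (D / e0^2) e^2 is absorbed into the second-order term. *)
theory Submission
  imports Defs "HOL-Analysis.L2_Norm"
begin

text \<open>A direct rounding analysis of column k needs a bound for \<open>Q (k - 1)\<close>, which
  is itself among the claims, so all estimates would have to pass through one induction. Taking
  limits breaks this circle: the limiting columns are exactly orthonormal, so first-order constants
  are evaluated with unit columns and Pythagoras instead of a bound for the computed
  \<open>Q\<close>. The price is that limits must be uniform in the rounding errors, so they run
  along a filter whose points are whole runs. For k >= 2 the limiting constant of QR - A is k^2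
  ||A||, against a \<open>c1\<close> above m k. For k = 1 the constants equal the first-order
  coefficients, so nothing absorbs the remainder and an explicit e^2 term is kept. The remainder
  must be a number for every e > 0, however large, which forces the separate argument away from 0.
  The condition number hypothesis is used there and for the bound \<open>sqrt 2\<close>; for small e
  the inverse of \<open>R k\<close> is controlled by the rank of A.\<close>

section \<open>Euclidean and spectral norms\<close>

lemma norm2_L2_set: "norm2 v = L2_set (\<lambda>i. v $ i) {..<dim_vec v}"
  unfolding norm2_def L2_set_def scalar_prod_def
  by (simp add: power2_eq_square atLeast0LessThan)

lemma norm2_nonneg [simp]: "0 \<le> norm2 v"
  by (simp add: norm2_L2_set L2_set_nonneg)

lemma norm2_square: "(norm2 v)\<^sup>2 = v \<bullet> v"
  by (simp add: norm2_def scalar_prod_def sum_nonneg)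

lemma norm2_smult: "norm2 (a \<cdot>\<^sub>v v) = \<bar>a\<bar> * norm2 v"
proof -
  have "norm2 (a \<cdot>\<^sub>v v) = L2_set (\<lambda>i. a * v $ i) {..<dim_vec v}"
    unfolding norm2_L2_set by (rule L2_set_cong) auto
  then show ?thesis
    by (simp add: norm2_def L2_set_def power_mult_distrib sum_distrib_left[symmetric]
      real_sqrt_mult scalar_prod_def power2_eq_square[symmetric] atLeast0LessThan)
qed

lemma norm2_zero_iff: "v \<in> carrier_vec n \<Longrightarrow> norm2 v = 0 \<longleftrightarrow> v = 0\<^sub>v n"
  by (auto simp: norm2_L2_set L2_set_eq_0_iff)

lemma norm2_add_le: "dim_vec v = dim_vec w \<Longrightarrow> norm2 (v + w) \<le> norm2 v + norm2 w"
proof -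
  assume d: "dim_vec v = dim_vec w"
  have "norm2 (v + w) = L2_set (\<lambda>i. v $ i + w $ i) {..<dim_vec w}"
    unfolding norm2_L2_set by (rule L2_set_cong) auto
  then show ?thesis using d L2_set_triangle_ineq[of "\<lambda>i. v $ i" "\<lambda>i. w $ i" "{..<dim_vec w}"]
    by (simp add: norm2_L2_set)
qed

lemma abs_scalar_prod_le: "dim_vec v = dim_vec w \<Longrightarrow> \<bar>v \<bullet> w\<bar> \<le> norm2 v * norm2 w"
proof -
  assume d: "dim_vec v = dim_vec w"
  have "\<bar>v \<bullet> w\<bar> \<le> (\<Sum>i<dim_vec w. \<bar>v $ i\<bar> * \<bar>w $ i\<bar>)"
    unfolding scalar_prod_def atLeast0LessThan
    by (rule order_trans[OF sum_abs]) (simp add: abs_mult)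
  also have "\<dots> \<le> norm2 v * norm2 w"
    unfolding norm2_L2_set d by (rule L2_set_mult_ineq)
  finally show ?thesis .
qed

definition frobenius :: "real mat \<Rightarrow> real" where
  "frobenius M = sqrt (\<Sum>i<dim_row M. \<Sum>j<dim_col M. (M $$ (i, j))\<^sup>2)"

text \<open>Cauchy-Schwarz in each row. This makes the supremum in \<open>spectral_norm\<close>
  finite, and later turns entrywise errors into spectral ones.\<close>

lemma norm2_mult_mat_vec_frobenius:
  assumes "M \<in> carrier_mat nr nc" "x \<in> carrier_vec nc"
  shows "norm2 (M *\<^sub>v x) \<le> frobenius M * norm2 x"
proof -
  have "((M *\<^sub>v x) $ i)\<^sup>2 \<le> (\<Sum>j<nc. (M $$ (i, j))\<^sup>2) * (norm2 x)\<^sup>2" if i: "i < nr" for i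
  proof -
    have "\<bar>row M i \<bullet> x\<bar> \<le> norm2 (row M i) * norm2 x"
      using assms by (intro abs_scalar_prod_le) auto
    then have "((M *\<^sub>v x) $ i)\<^sup>2 \<le> (norm2 (row M i))\<^sup>2 * (norm2 x)\<^sup>2"
      using assms i by (simp flip: power_mult_distrib abs_le_square_iff)
    also have "(norm2 (row M i))\<^sup>2 = (\<Sum>j<nc. (M $$ (i, j))\<^sup>2)"
      using assms i unfolding norm2_square
      by (simp add: scalar_prod_def power2_eq_square atLeast0LessThan)
    finally show ?thesis .
  qed
  then have "(\<Sum>i<nr. ((M *\<^sub>v x) $ i)\<^sup>2) \<le> (\<Sum>i<nr. \<Sum>j<nc. (M $$ (i, j))\<^sup>2) * (norm2 x)\<^sup>2"
    unfolding sum_distrib_right[of _ "{..<nr}"] by (intro sum_mono) auto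
  then have "norm2 (M *\<^sub>v x) \<le> sqrt ((\<Sum>i<nr. \<Sum>j<nc. (M $$ (i, j))\<^sup>2) * (norm2 x)\<^sup>2)"
    using assms by (simp add: norm2_L2_set L2_set_def)
  then show ?thesis
    using assms by (simp add: frobenius_def real_sqrt_mult)
qed

lemma norm2_normalize:
  assumes "norm2 x \<noteq> 0" shows "norm2 ((1 / norm2 x) \<cdot>\<^sub>v x) = 1"
  using assms by (simp add: norm2_smult)

lemma spectral_norm_set_bdd:
  "bdd_above {norm2 (M *\<^sub>v x) | x. x \<in> carrier_vec (dim_col M) \<and> norm2 x = 1}"
proof (rule bdd_aboveI[where M = "frobenius M"])
  fix y assume "y \<in> {norm2 (M *\<^sub>v x) | x. x \<in> carrier_vec (dim_col M) \<and> norm2 x = 1}"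
  then show "y \<le> frobenius M"
    using norm2_mult_mat_vec_frobenius[of M "dim_row M" "dim_col M"] by fastforce
qed

lemma spectral_norm_set_nonempty:
  assumes "0 < dim_col M"
  shows "{norm2 (M *\<^sub>v x) | x. x \<in> carrier_vec (dim_col M) \<and> norm2 x = 1} \<noteq> {}"
proof -
  have "norm2 (unit_vec (dim_col M) 0) = 1"
    using assms by (simp add: norm2_def)
  then show ?thesis
    using unit_vec_carrier by blast
qed

lemma norm2_mult_mat_vec_le:
  assumes "M \<in> carrier_mat nr nc" "x \<in> carrier_vec nc"
  shows "norm2 (M *\<^sub>v x) \<le> spectral_norm M * norm2 x"
proof (cases "norm2 x = 0")
  case True
  then show ?thesis
    using norm2_mult_mat_vec_frobenius[OF assms] by simp
next
  case False
  let ?u = "(1 / norm2 x) \<cdot>\<^sub>v x"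
  have "norm2 (M *\<^sub>v ?u) \<le> spectral_norm M"
    unfolding spectral_norm_def using assms norm2_normalize[OF False]
    by (intro cSup_upper spectral_norm_set_bdd) auto
  moreover have "norm2 (M *\<^sub>v ?u) = norm2 (M *\<^sub>v x) / norm2 x"
    using assms by (subst mult_mat_vec[OF assms]) (simp add: norm2_smult)
  ultimately show ?thesis
    using False norm2_nonneg[of x] by (simp add: divide_simps split: if_splits)
qed

lemma spectral_norm_le:
  assumes "M \<in> carrier_mat nr nc" "0 < nc"
    and "\<And>x. x \<in> carrier_vec nc \<Longrightarrow> norm2 (M *\<^sub>v x) \<le> c * norm2 x"
  shows "spectral_norm M \<le> c"
  unfolding spectral_norm_def
  using assms spectral_norm_set_nonempty[of M] by (intro cSup_least) fastforce+

lemma spectral_norm_le_frobenius: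
  "\<lbrakk>M \<in> carrier_mat nr nc; 0 < nc\<rbrakk> \<Longrightarrow> spectral_norm M \<le> frobenius M"
  by (rule spectral_norm_le) (auto intro: norm2_mult_mat_vec_frobenius)

lemma norm2_col_le:
  assumes "M \<in> carrier_mat nr nc" "j < nc"
  shows "norm2 (col M j) \<le> spectral_norm M"
proof -
  have "norm2 (M *\<^sub>v unit_vec nc j) \<le> spectral_norm M * norm2 (unit_vec nc j :: real vec)"
    using assms by (intro norm2_mult_mat_vec_le) auto
  moreover have "M *\<^sub>v unit_vec nc j = col M j"
    using assms by (auto intro!: eq_vecI)
  ultimately show ?thesis
    using assms by (simp add: norm2_def)
qed

lemma abs_index_le_norm2: "i < dim_vec v \<Longrightarrow> \<bar>v $ i\<bar> \<le> norm2 v"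
  unfolding norm2_L2_set L2_set_def
  by (rule real_le_rsqrt) (auto intro: member_le_sum)

lemma abs_index_mat_le_spectral_norm:
  assumes "M \<in> carrier_mat nr nc" "i < nr" "j < nc"
  shows "\<bar>M $$ (i, j)\<bar> \<le> spectral_norm M"
  using abs_index_le_norm2[of i "col M j"] norm2_col_le[OF assms(1,3)] assms by simp

lemma spectral_norm_nonneg:
  assumes "M \<in> carrier_mat nr nc" "0 < nc"
  shows "0 \<le> spectral_norm M"
  using norm2_col_le[OF assms(1), of 0] assms norm2_nonneg[of "col M 0"] by linarith

lemma spectral_norm_mult_le:
  assumes "M \<in> carrier_mat nr n" "N \<in> carrier_mat n nc" "0 < n" "0 < nc"
  shows "spectral_norm (M * N) \<le> spectral_norm M * spectral_norm N"
proof (rule spectral_norm_le[of _ nr nc])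
  fix x :: "real vec" assume x: "x \<in> carrier_vec nc"
  have "norm2 (M * N *\<^sub>v x) = norm2 (M *\<^sub>v (N *\<^sub>v x))"
    using assms x by simp
  also have "\<dots> \<le> spectral_norm M * norm2 (N *\<^sub>v x)"
    using assms x by (intro norm2_mult_mat_vec_le) auto
  also have "\<dots> \<le> spectral_norm M * (spectral_norm N * norm2 x)"
    using assms x by (intro mult_left_mono norm2_mult_mat_vec_le spectral_norm_nonneg) auto
  finally show "norm2 (M * N *\<^sub>v x) \<le> spectral_norm M * spectral_norm N * norm2 x"
    by simp
qed (use assms in auto)

lemma spectral_norm_add_le:
  assumes "M \<in> carrier_mat nr nc" "N \<in> carrier_mat nr nc" "0 < nc"
  shows "spectral_norm (M + N) \<le> spectral_norm M + spectral_norm N"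
proof (rule spectral_norm_le[of _ nr nc])
  fix x :: "real vec" assume x: "x \<in> carrier_vec nc"
  have "norm2 ((M + N) *\<^sub>v x) = norm2 (M *\<^sub>v x + N *\<^sub>v x)"
    using assms x by (simp add: add_mult_distrib_mat_vec)
  also have "\<dots> \<le> norm2 (M *\<^sub>v x) + norm2 (N *\<^sub>v x)"
    using assms x by (intro norm2_add_le) auto
  also have "\<dots> \<le> spectral_norm M * norm2 x + spectral_norm N * norm2 x"
    using assms x by (intro add_mono norm2_mult_mat_vec_le) auto
  finally show "norm2 ((M + N) *\<^sub>v x) \<le> (spectral_norm M + spectral_norm N) * norm2 x"
    by (simp add: distrib_right)
qed (use assms in auto)

lemma spectral_norm_smult_le:
  assumes "M \<in> carrier_mat nr nc" "0 < nc"
  shows "spectral_norm (a \<cdot>\<^sub>m M) \<le> \<bar>a\<bar> * spectral_norm M"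
proof (rule spectral_norm_le[of _ nr nc])
  fix x :: "real vec" assume x: "x \<in> carrier_vec nc"
  have "(a \<cdot>\<^sub>m M) *\<^sub>v x = a \<cdot>\<^sub>v (M *\<^sub>v x)"
    using assms x by (auto intro!: eq_vecI)
  then show "norm2 ((a \<cdot>\<^sub>m M) *\<^sub>v x) \<le> \<bar>a\<bar> * spectral_norm M * norm2 x"
    using norm2_mult_mat_vec_le[OF assms(1) x] by (simp add: norm2_smult mult_left_mono mult.assoc)
qed (use assms in auto)

lemma spectral_norm_diff_le:
  assumes "M \<in> carrier_mat nr nc" "N \<in> carrier_mat nr nc" "0 < nc"
  shows "spectral_norm (M - N) \<le> spectral_norm M + spectral_norm N"
proof -
  have "M - N = M + (-1) \<cdot>\<^sub>m N"
    using assms by (intro eq_matI) auto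
  then show ?thesis
    using spectral_norm_add_le[of M nr nc "(-1) \<cdot>\<^sub>m N"] spectral_norm_smult_le[of N nr nc "-1"] assms
    by fastforce
qed

lemma norm2_mult_mat_vec_square:
  assumes "M \<in> carrier_mat nr nc" "x \<in> carrier_vec nc"
  shows "(norm2 (M *\<^sub>v x))\<^sup>2 = x \<bullet> (M\<^sup>T * M *\<^sub>v x)"
proof -
  have "(M *\<^sub>v x) \<bullet> (M *\<^sub>v x) = x \<bullet> (M\<^sup>T *\<^sub>v (M *\<^sub>v x))"
    using transpose_vec_mult_scalar[of M nr nc x "M *\<^sub>v x"] assms
    by (metis comm_scalar_prod mult_mat_vec_carrier transpose_carrier_mat)
  then show ?thesis
    using assms by (simp add: norm2_square)
qed

text \<open>||Mx||^2 is the inner product of x with M^T M x, to which Cauchy-Schwarz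
  applies.\<close>

lemma spectral_norm_square_le:
  assumes "M \<in> carrier_mat nr nc" "0 < nc"
  shows "(spectral_norm M)\<^sup>2 \<le> spectral_norm (M\<^sup>T * M)"
proof -
  have N: "M\<^sup>T * M \<in> carrier_mat nc nc" using assms by auto
  have nn: "0 \<le> spectral_norm (M\<^sup>T * M)" by (rule spectral_norm_nonneg[OF N assms(2)])
  have "spectral_norm M \<le> sqrt (spectral_norm (M\<^sup>T * M))"
  proof (rule spectral_norm_le[OF assms])
    fix x :: "real vec" assume x: "x \<in> carrier_vec nc"
    have "(norm2 (M *\<^sub>v x))\<^sup>2 \<le> norm2 x * norm2 (M\<^sup>T * M *\<^sub>v x)"
      unfolding norm2_mult_mat_vec_square[OF assms(1) x]
      using assms x abs_scalar_prod_le[of x "M\<^sup>T * M *\<^sub>v x"] by auto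
    also have "\<dots> \<le> norm2 x * (spectral_norm (M\<^sup>T * M) * norm2 x)"
      by (intro mult_left_mono norm2_mult_mat_vec_le[OF N x]) auto
    also have "\<dots> = (sqrt (spectral_norm (M\<^sup>T * M)) * norm2 x)\<^sup>2"
      using nn by (simp add: power_mult_distrib power2_eq_square[of "norm2 x"])
    finally show "norm2 (M *\<^sub>v x) \<le> sqrt (spectral_norm (M\<^sup>T * M)) * norm2 x"
      by (rule power2_le_imp_le) (simp add: nn)
  qed
  then have "(spectral_norm M)\<^sup>2 \<le> (sqrt (spectral_norm (M\<^sup>T * M)))\<^sup>2"
    by (intro power_mono spectral_norm_nonneg[OF assms])
  then show ?thesis by (simp add: nn)
qed

text \<open>With z = M^T y, ||z||^2 is the inner product of y with Mz, hence at most ||y|| ||M||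
  ||z||; then ||z|| cancels.\<close>

lemma spectral_norm_transpose_le:
  assumes "M \<in> carrier_mat nr nc" "0 < nr" "0 < nc"
  shows "spectral_norm M\<^sup>T \<le> spectral_norm M"
proof (rule spectral_norm_le[of _ nc nr])
  fix y :: "real vec" assume y: "y \<in> carrier_vec nr"
  let ?z = "M\<^sup>T *\<^sub>v y"
  have z: "?z \<in> carrier_vec nc" using assms y by auto
  have "(norm2 ?z)\<^sup>2 = y \<bullet> (M *\<^sub>v ?z)"
    using norm2_mult_mat_vec_square[of "M\<^sup>T" nc nr y] assms y by simp
  also have "\<dots> \<le> norm2 y * norm2 (M *\<^sub>v ?z)"
    using assms y abs_scalar_prod_le[of y "M *\<^sub>v ?z"] by auto
  also have "\<dots> \<le> norm2 y * (spectral_norm M * norm2 ?z)"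
    by (intro mult_left_mono norm2_mult_mat_vec_le[OF assms(1) z]) auto
  finally have "norm2 ?z * norm2 ?z \<le> (spectral_norm M * norm2 y) * norm2 ?z"
    by (simp add: power2_eq_square mult_ac)
  then show "norm2 ?z \<le> spectral_norm M * norm2 y"
    using norm2_nonneg[of ?z] spectral_norm_nonneg[OF assms(1,3)]
    by (cases "norm2 ?z = 0") (auto simp: mult_le_cancel_right)
qed (use assms in auto)

text \<open>The C*-identity. Through it the Gram residual controls the difference between ||R||^2
  and ||A||^2.\<close>

lemma spectral_norm_transpose_mult_self:
  assumes "M \<in> carrier_mat nr nc" "0 < nr" "0 < nc"
  shows "spectral_norm (M\<^sup>T * M) = (spectral_norm M)\<^sup>2"
proof (rule antisym)
  have "spectral_norm (M\<^sup>T * M) \<le> spectral_norm M\<^sup>T * spectral_norm M"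
    using assms by (intro spectral_norm_mult_le[of _ nc nr _ nc]) auto
  also have "\<dots> \<le> spectral_norm M * spectral_norm M"
    using assms by (intro mult_right_mono spectral_norm_transpose_le spectral_norm_nonneg)
  finally show "spectral_norm (M\<^sup>T * M) \<le> (spectral_norm M)\<^sup>2"
    by (simp add: power2_eq_square)
qed (rule spectral_norm_square_le[OF assms(1,3)])

lemma spectral_norm_one: "0 < n \<Longrightarrow> spectral_norm (1\<^sub>m n) = 1"
proof (rule antisym)
  assume n: "0 < n"
  show "spectral_norm (1\<^sub>m n) \<le> 1"
    by (rule spectral_norm_le[of _ n n]) (use n in auto)
  show "1 \<le> spectral_norm (1\<^sub>m n :: real mat)"
    using abs_index_mat_le_spectral_norm[of "1\<^sub>m n" n n 0 0] n by simp
qed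

text \<open>For a k by k matrix the factor is k, which is why Gram entries are later compared with
  \<open>c2 m k / real k\<close>.\<close>

lemma frobenius_le_max:
  assumes M: "M \<in> carrier_mat nr nc" and "0 \<le> c"
    and "\<And>i j. \<lbrakk>i < nr; j < nc\<rbrakk> \<Longrightarrow> \<bar>M $$ (i, j)\<bar> \<le> c"
  shows "frobenius M \<le> sqrt (real nr * real nc) * c"
proof -
  have "(\<Sum>i<nr. \<Sum>j<nc. (M $$ (i, j))\<^sup>2) \<le> (\<Sum>i<nr. \<Sum>j<nc. c\<^sup>2)"
    using assms by (intro sum_mono) (auto simp: abs_le_square_iff[symmetric])
  then have "frobenius M \<le> sqrt (real nr * real nc * c\<^sup>2)"
    using M by (simp add: frobenius_def mult.assoc)
  then show ?thesis using assms by (simp add: real_sqrt_mult)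
qed

section \<open>Accumulated rounding errors\<close>

text \<open>A product of N rounding factors lies in this band. An interval, unlike an explicit
  product, is convex, so a weighted mean of such factors is again one of them; that is needed for
  computed norms.\<close>

definition rel_pert :: "real \<Rightarrow> nat \<Rightarrow> real \<Rightarrow> bool" where
  "rel_pert e N w \<longleftrightarrow> (1 - e) ^ N \<le> w \<and> w \<le> (1 + e) ^ N"

lemma rel_pert_pos: "\<lbrakk>0 \<le> e; e < 1; rel_pert e N w\<rbrakk> \<Longrightarrow> 0 < w"
  unfolding rel_pert_def by (meson diff_gt_0_iff_gt less_le_trans zero_less_power)

lemma rel_pert_mult:
  assumes "0 \<le> e" "e < 1" "rel_pert e N v" "rel_pert e M w"
  shows "rel_pert e (N + M) (v * w)"
proof -
  have "0 \<le> (1 - e) ^ N" "0 \<le> (1 - e) ^ M" "0 \<le> v" "0 \<le> w"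
    using assms by (auto intro: less_imp_le rel_pert_pos)
  with assms show ?thesis
    unfolding rel_pert_def power_add by (auto intro!: mult_mono)
qed

lemma rel_pert_mono:
  assumes "0 \<le> e" "e < 1" "N \<le> M" "rel_pert e N w"
  shows "rel_pert e M w"
proof -
  have "(1 - e) ^ M \<le> (1 - e) ^ N" "(1 + e) ^ N \<le> (1 + e) ^ M"
    using assms by (auto intro: power_decreasing power_increasing)
  with assms show ?thesis by (auto simp: rel_pert_def)
qed

text \<open>The upper end of the band is at least as far from 1 as the lower end, so (1 + e)^N - 1
  bounds deviations on both sides.\<close>

lemma two_le_power_add: "0 \<le> (e::real) \<Longrightarrow> e < 1 \<Longrightarrow> 2 \<le> (1 + e) ^ N + (1 - e) ^ N"
proof (induction N)
  case (Suc N)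
  have "(1 - e) ^ N \<le> (1 + e) ^ N" using Suc.prems by (intro power_mono) auto
  then have "0 \<le> e * ((1 + e) ^ N - (1 - e) ^ N)" using Suc.prems by simp
  with Suc show ?case by (simp add: algebra_simps)
qed simp

lemma rel_pert_error:
  assumes "0 \<le> e" "e < 1" "rel_pert e N w"
  shows "\<bar>w - 1\<bar> \<le> (1 + e) ^ N - 1"
  using assms(3) two_le_power_add[OF assms(1,2), of N] by (auto simp: rel_pert_def)

lemma roundedE:
  assumes "rounded e x y" "0 \<le> e" "e < 1"
  obtains w where "rel_pert e 1 w" "y = x * w"
proof -
  obtain d where "\<bar>d\<bar> \<le> e" "y = x * (1 + d)"
    using assms by (auto simp: rounded_def)
  then show ?thesis using that[of "1 + d"] by (simp add: rel_pert_def abs_le_iff)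
qed

text \<open>A binary tree with N leaves has N - 1 inner nodes, so no summand passes through more
  than N - 1 additions, whatever the bracketing.\<close>

lemma fl_sum_rel_pert:
  assumes "fl_sum e f S z" "0 \<le> e" "e < 1"
  shows "finite S \<and> S \<noteq> {} \<and> (\<exists>w. (\<forall>i\<in>S. rel_pert e (card S - 1) (w i)) \<and> z = (\<Sum>i\<in>S. f i * w i))"
  using assms
proof (induction rule: fl_sum.induct)
  case (fl_sum_single i)
  then show ?case by (auto simp: rel_pert_def intro!: exI[of _ "\<lambda>_. 1"])
next
  case (fl_sum_add S x T y z)
  then obtain u v where u: "\<forall>i\<in>S. rel_pert e (card S - 1) (u i)" "x = (\<Sum>i\<in>S. f i * u i)"
    and v: "\<forall>i\<in>T. rel_pert e (card T - 1) (v i)" "y = (\<Sum>i\<in>T. f i * v i)"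
    and fin: "finite S" "finite T" "S \<noteq> {}" "T \<noteq> {}" by auto
  obtain d where d: "rel_pert e 1 d" "z = (x + y) * d"
    using fl_sum_add.hyps fl_sum_add.prems by (elim roundedE)
  define w where "w i = (if i \<in> S then u i else v i) * d" for i
  \<comment> \<open>Both parts are nonempty, so the one additional factor still fits:
    \<open>card S - 1 + 1\<close> is at most \<open>card S + card T - 1\<close>, and likewise for
    \<open>T\<close>.\<close>
  have pos: "0 < card S" "0 < card T" using fin by (auto simp: card_gt_0_iff)
  have card: "card (S \<union> T) = card S + card T"
    using fin fl_sum_add.hyps by (intro card_Un_disjoint) auto
  have "rel_pert e (card (S \<union> T) - 1) (w i)" if i: "i \<in> S \<union> T" for i
  proof (cases "i \<in> S")
    case True
    then have "rel_pert e (card S - 1 + 1) (u i * d)"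
      using u d fl_sum_add.prems by (intro rel_pert_mult) auto
    then show ?thesis
      using True pos fl_sum_add.prems unfolding w_def card by (auto elim: rel_pert_mono[rotated -1])
  next
    case False
    then have "rel_pert e (card T - 1 + 1) (v i * d)"
      using v d i fl_sum_add.prems by (intro rel_pert_mult) auto
    then show ?thesis
      using False pos fl_sum_add.prems unfolding w_def card by (auto elim: rel_pert_mono[rotated -1])
  qed
  moreover have "z = (\<Sum>i\<in>S \<union> T. f i * w i)"
  proof -
    have "(\<Sum>i\<in>S \<union> T. f i * w i) = (\<Sum>i\<in>S. f i * w i) + (\<Sum>i\<in>T. f i * w i)"
      using fin fl_sum_add.hyps by (intro sum.union_disjoint) auto
    also have "(\<Sum>i\<in>S. f i * w i) = x * d"
      unfolding u sum_distrib_right by (intro sum.cong) (auto simp: w_def)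
    also have "(\<Sum>i\<in>T. f i * w i) = y * d"
      unfolding v sum_distrib_right using fl_sum_add.hyps by (intro sum.cong) (auto simp: w_def)
    finally show ?thesis by (simp add: d distrib_right)
  qed
  ultimately show ?case using fin by auto
qed

text \<open>One rounding for each product and at most N - 1 for the additions make N. Here N is
  nonzero, because a sum over the empty set has no computed value.\<close>

lemma fl_dot_rel_pert:
  assumes "fl_dot e x y z" "0 \<le> e" "e < 1"
  obtains w where "\<forall>i<dim_vec x. rel_pert e (dim_vec x) (w i)"
    "z = (\<Sum>i<dim_vec x. x $ i * y $ i * w i)"
proof -
  obtain p where p: "\<forall>i<dim_vec x. rounded e (x $ i * y $ i) (p i)"
    and s: "fl_sum e p {..<dim_vec x} z"
    using assms by (auto simp: fl_dot_def)
  from p have "\<forall>i<dim_vec x. \<exists>d. rel_pert e 1 d \<and> p i = x $ i * y $ i * d"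
    using assms by (metis roundedE)
  then obtain d where d: "\<And>i. i < dim_vec x \<Longrightarrow> rel_pert e 1 (d i) \<and> p i = x $ i * y $ i * d i"
    by metis
  obtain w where w: "\<forall>i<dim_vec x. rel_pert e (dim_vec x - 1) (w i)"
    and z: "z = (\<Sum>i<dim_vec x. p i * w i)" and ne: "dim_vec x \<noteq> 0"
    using fl_sum_rel_pert[OF s assms(2,3)] by (auto simp: lessThan_empty_iff)
  have "rel_pert e (1 + (dim_vec x - 1)) (d i * w i)" if "i < dim_vec x" for i
    using d w that assms by (intro rel_pert_mult) auto
  moreover have "z = (\<Sum>i<dim_vec x. x $ i * y $ i * (d i * w i))"
    unfolding z by (intro sum.cong) (auto simp: d)
  ultimately show ?thesis using that[of "\<lambda>i. d i * w i"] ne by simp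
qed

lemma fl_dot_error:
  assumes "fl_dot e x y z" "0 \<le> e" "e < 1"
  shows "\<bar>z - (\<Sum>i<dim_vec x. x $ i * y $ i)\<bar>
    \<le> ((1 + e) ^ dim_vec x - 1) * (\<Sum>i<dim_vec x. \<bar>x $ i * y $ i\<bar>)"
proof -
  obtain w where w: "\<forall>i<dim_vec x. rel_pert e (dim_vec x) (w i)"
    and z: "z = (\<Sum>i<dim_vec x. x $ i * y $ i * w i)"
    by (rule fl_dot_rel_pert[OF assms])
  have "z - (\<Sum>i<dim_vec x. x $ i * y $ i) = (\<Sum>i<dim_vec x. x $ i * y $ i * (w i - 1))"
    by (simp add: z right_diff_distrib sum_subtractf)
  also have "\<bar>\<dots>\<bar> \<le> (\<Sum>i<dim_vec x. \<bar>x $ i * y $ i\<bar> * \<bar>w i - 1\<bar>)"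
    by (rule order_trans[OF sum_abs]) (simp add: abs_mult)
  also have "\<dots> \<le> (\<Sum>i<dim_vec x. \<bar>x $ i * y $ i\<bar> * ((1 + e) ^ dim_vec x - 1))"
    using rel_pert_error[OF assms(2,3)] w by (intro sum_mono mult_left_mono) auto
  finally show ?thesis by (simp add: sum_distrib_left mult.commute)
qed

text \<open>The summands are nonnegative, so their separate factors average to a single one from the
  same band. The rounding of the square root enters squared, which adds the 2.\<close>

lemma fl_norm2_rel_pert:
  assumes "fl_norm2 e x z" "0 \<le> e" "e < 1"
  obtains w where "rel_pert e (dim_vec x + 2) w" "z\<^sup>2 = (\<Sum>i<dim_vec x. (x $ i)\<^sup>2) * w" "0 \<le> z"
proof -
  obtain t where t: "fl_dot e x x t" and s: "fl_sqrt e t z" using assms by (auto simp: fl_norm2_def)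
  obtain w where w: "\<forall>i<dim_vec x. rel_pert e (dim_vec x) (w i)"
    and tw: "t = (\<Sum>i<dim_vec x. x $ i * x $ i * w i)"
    by (rule fl_dot_rel_pert[OF t assms(2,3)])
  obtain d where d: "rel_pert e 1 d" "z = sqrt t * d" and t0: "0 \<le> t"
    using s assms by (auto simp: fl_sqrt_def elim!: roundedE)
  define S where "S = (\<Sum>i<dim_vec x. (x $ i)\<^sup>2)"
  have S: "S * (1 - e) ^ dim_vec x \<le> t" "t \<le> S * (1 + e) ^ dim_vec x"
    unfolding tw S_def sum_distrib_right power2_eq_square
    using w by (auto intro!: sum_mono mult_left_mono simp: rel_pert_def)
  have S0: "0 \<le> S" by (simp add: S_def sum_nonneg)
  \<comment> \<open>The mean factor is \<open>t / S\<close>; for the zero vector any member of the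
    band will do.\<close>
  obtain v where v: "rel_pert e (dim_vec x) v" "t = S * v"
  proof (cases "S = 0")
    case True
    moreover have "(1 - e) ^ dim_vec x \<le> (1 + e) ^ dim_vec x"
      using assms by (intro power_mono) auto
    ultimately show ?thesis using S that[of "(1 + e) ^ dim_vec x"]
      by (auto simp: rel_pert_def)
  next
    case False
    then have "rel_pert e (dim_vec x) (t / S)" using S S0 by (auto simp: rel_pert_def field_simps)
    then show ?thesis using that[of "t / S"] False by simp
  qed
  have "rel_pert e (dim_vec x + (1 + 1)) (v * (d * d))"
    using assms v d by (intro rel_pert_mult) auto
  moreover have "z\<^sup>2 = S * (v * (d * d))"
    using t0 d v by (simp add: power_mult_distrib power2_eq_square[of d])
  moreover have "0 \<le> z" using d t0 rel_pert_pos[OF assms(2,3) d(1)] by simp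
  ultimately show ?thesis using that unfolding S_def by simp
qed

section \<open>Scalar error bounds for one computed column\<close>

text \<open>\<open>r j j\<close> is the product of two square roots of rounded numbers, so its square carries eight rounding
  factors; a computed norm of a vector of length \<open>N\<close> carries \<open>N + 2\<close> of them after squaring. The last
  conjunct keeps the sharper constants of the first column, which are those of \<open>c1\<close> and \<open>c2\<close> at \<open>k = 1\<close>.\<close>

definition gs_column ::
  "real \<Rightarrow> nat \<Rightarrow> (nat \<Rightarrow> nat \<Rightarrow> real) \<Rightarrow> (nat \<Rightarrow> nat \<Rightarrow> real) \<Rightarrow> (nat \<Rightarrow> nat \<Rightarrow> real) \<Rightarrow> nat \<Rightarrow> bool" where
  "gs_column e m a q r j \<longleftrightarrow> 0 < r j j \<and>
    (\<forall>i<j. \<bar>r i j - (\<Sum>l<m. q l i * a l j)\<bar> \<le> ((1 + e) ^ m - 1) * (\<Sum>l<m. \<bar>q l i * a l j\<bar>)) \<and>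
    (\<forall>l<m. \<bar>q l j * r j j - (a l j - (\<Sum>i<j. q l i * r i j))\<bar>
      \<le> (1 + e)\<^sup>2 * ((1 + e) ^ j - 1) * (\<Sum>i<j. \<bar>q l i * r i j\<bar>)
        + ((1 + e)\<^sup>2 - 1) * \<bar>a l j - (\<Sum>i<j. q l i * r i j)\<bar>) \<and>
    \<bar>(r j j)\<^sup>2 - ((\<Sum>l<m. (a l j)\<^sup>2) - (\<Sum>i<j. (r i j)\<^sup>2))\<bar>
      \<le> ((1 + e) ^ 8 - 1) * \<bar>(\<Sum>l<m. (a l j)\<^sup>2) - (\<Sum>i<j. (r i j)\<^sup>2)\<bar>
        + (1 + e) ^ 8 * (((1 + e) ^ (m + 2) - 1) * (\<Sum>l<m. (a l j)\<^sup>2)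
          + ((1 + e) ^ (j + 2) - 1) * (\<Sum>i<j. (r i j)\<^sup>2)) \<and>
    (j = 0 \<longrightarrow> (1 - e) ^ (m + 2) * (\<Sum>l<m. (a l 0)\<^sup>2) \<le> (r 0 0)\<^sup>2 \<and>
      \<bar>(r 0 0)\<^sup>2 - (\<Sum>l<m. (a l 0)\<^sup>2)\<bar> \<le> ((1 + e) ^ (m + 2) - 1) * (\<Sum>l<m. (a l 0)\<^sup>2) \<and>
      (\<forall>l<m. \<bar>q l 0 * r 0 0 - a l 0\<bar> \<le> e * \<bar>a l 0\<bar>))"

text \<open>The predicate reads column \<open>j\<close> of \<open>a\<close> and \<open>r\<close> and
  the columns of \<open>q\<close> up to \<open>j\<close>. It therefore survives when later steps
  append columns.\<close>

lemma gs_column_cong: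
  assumes "\<And>i. i \<le> j \<Longrightarrow> r i j = r' i j" "\<And>l i. l < m \<Longrightarrow> i \<le> j \<Longrightarrow> q l i = q' l i"
    "\<And>l. l < m \<Longrightarrow> a l j = a' l j"
  shows "gs_column e m a q r j \<longleftrightarrow> gs_column e m a' q' r' j"
proof -
  have "(\<Sum>i<j. q l i * r i j) = (\<Sum>i<j. q' l i * r' i j)"
    "(\<Sum>i<j. \<bar>q l i * r i j\<bar>) = (\<Sum>i<j. \<bar>q' l i * r' i j\<bar>)" if "l < m" for l
    using assms that by (auto intro!: sum.cong)
  moreover have "(\<Sum>l<m. q l i * a l j) = (\<Sum>l<m. q' l i * a' l j)"
    "(\<Sum>l<m. \<bar>q l i * a l j\<bar>) = (\<Sum>l<m. \<bar>q' l i * a' l j\<bar>)" if "i < j" for i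
    using assms that by (auto intro!: sum.cong)
  moreover have "(\<Sum>l<m. (a l j)\<^sup>2) = (\<Sum>l<m. (a' l j)\<^sup>2)"
    "(\<Sum>i<j. (r i j)\<^sup>2) = (\<Sum>i<j. (r' i j)\<^sup>2)"
    using assms by (auto intro!: sum.cong)
  moreover have "r i j = r' i j" if "i \<le> j" for i using assms that by simp
  moreover have "q l j = q' l j" "a l j = a' l j" if "l < m" for l using assms that by simp_all
  ultimately show ?thesis unfolding gs_column_def by (auto simp del: abs_mult)
qed

lemma cgsp_init_column:
  assumes "cgsp_init e a R Q" "0 < e" "e < 1"
  shows "R \<in> carrier_mat 1 1" "Q \<in> carrier_mat (dim_vec a) 1"
    "gs_column e (dim_vec a) (\<lambda>l _. a $ l) (\<lambda>l j. Q $$ (l, j)) (\<lambda>i j. R $$ (i, j)) 0"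
proof -
  obtain r q where n: "fl_norm2 e a r" and q: "fl_div_vec e a r q"
    and RQ: "R = mat 1 1 (\<lambda>_. r)" "Q = mat_of_cols (dim_vec a) [q]"
    using assms by (auto simp: cgsp_init_def)
  let ?m = "dim_vec a"
  show "R \<in> carrier_mat 1 1" "Q \<in> carrier_mat (dim_vec a) 1" by (auto simp: RQ)
  obtain w where w: "rel_pert e (?m + 2) w" "r\<^sup>2 = (\<Sum>i<?m. (a $ i)\<^sup>2) * w" "0 \<le> r"
    using fl_norm2_rel_pert[OF n] assms by (metis less_imp_le)
  define S where "S = (\<Sum>i<?m. (a $ i)\<^sup>2)"
  have S0: "0 \<le> S" by (simp add: S_def sum_nonneg)
  \<comment> \<open>A computed norm exists only for a nonempty vector, so some entry really is
    divided by \<open>r\<close>, and this forces \<open>r\<close> to be nonzero.\<close>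
  have m0: "0 < ?m"
    using n assms fl_sum_rel_pert[of e _ "{..<?m}"] by (fastforce simp: fl_norm2_def fl_dot_def)
  have r0: "r \<noteq> 0" using q m0 by (auto simp: fl_div_vec_def fl_div_def)
  have Q: "\<bar>Q $$ (l, 0) * r - a $ l\<bar> \<le> e * \<bar>a $ l\<bar>" if l: "l < ?m" for l
  proof -
    obtain d where d: "\<bar>d\<bar> \<le> e" "q $ l = a $ l / r * (1 + d)"
      using q l by (auto simp: fl_div_vec_def fl_div_def rounded_def)
    have "q $ l * r - a $ l = a $ l * d" using r0 d by (simp add: field_simps)
    moreover have "Q $$ (l, 0) = q $ l" using l by (simp add: RQ mat_of_cols_index)
    moreover have "\<bar>a $ l * d\<bar> \<le> e * \<bar>a $ l\<bar>"
      using d(1) by (simp add: abs_mult mult.commute[of e] mult_left_mono)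
    ultimately show ?thesis by simp
  qed
  have w1: "\<bar>w - 1\<bar> \<le> (1 + e) ^ (?m + 2) - 1"
    using rel_pert_error[OF _ _ w(1)] assms by simp
  have "\<bar>r\<^sup>2 - S\<bar> = S * \<bar>w - 1\<bar>"
    using S0 w(2) unfolding S_def[symmetric]
    by (metis abs_mult abs_of_nonneg mult.right_neutral right_diff_distrib)
  also have "\<dots> \<le> S * ((1 + e) ^ (?m + 2) - 1)" using w1 S0 by (intro mult_left_mono)
  finally have rS: "\<bar>r\<^sup>2 - S\<bar> \<le> ((1 + e) ^ (?m + 2) - 1) * S" by (simp add: mult.commute)
  have p8: "1 \<le> (1 + e) ^ 8" "1 \<le> (1+e)^(?m+2)" "e \<le> (1 + e)\<^sup>2 - 1"
    using assms one_le_power[of "1 + e" 8] one_le_power[of "1 + e" "?m + 2"]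
    by (auto simp: power2_eq_square distrib_left distrib_right simp del: power_Suc one_le_power power_add)
  \<comment> \<open>For the first column the sums over earlier columns are empty; the sharp bound is
    weakened here to the general diagonal conjunct of \<open>gs_column\<close>.\<close>
  have "((1 + e) ^ (?m + 2) - 1) * S \<le> ((1 + e) ^ 8 - 1) * S + (1 + e) ^ 8 * (((1 + e) ^ (?m + 2) - 1) * S)"
  proof -
    have "1 * (((1 + e) ^ (?m + 2) - 1) * S) \<le> (1 + e) ^ 8 * (((1 + e) ^ (?m + 2) - 1) * S)"
      using p8 S0 by (intro mult_right_mono) auto
    moreover have "0 \<le> ((1 + e) ^ 8 - 1) * S" using p8 S0 by simp
    ultimately show ?thesis by linarith
  qed
  moreover have "e * \<bar>a $ l\<bar> \<le> ((1 + e)\<^sup>2 - 1) * \<bar>a $ l\<bar>" for l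
    using p8 by (intro mult_right_mono) auto
  moreover have "(1 - e) ^ (?m + 2) * S \<le> r\<^sup>2"
    using w S0 unfolding S_def[symmetric] by (auto simp: rel_pert_def mult.commute mult_left_mono)
  moreover have "R $$ (0, 0) = r" by (simp add: RQ)
  ultimately show "gs_column e ?m (\<lambda>l _. a $ l) (\<lambda>l j. Q $$ (l, j)) (\<lambda>i j. R $$ (i, j)) 0"
    unfolding gs_column_def using S0 rS r0 w(3) Q
    by (auto simp: S_def[symmetric] intro: order_trans)
qed

lemma cgsp_step_column:
  assumes "cgsp_step e a R Q R' Q'" "0 < e" "e < 1"
    and R: "R \<in> carrier_mat k k" and Q: "Q \<in> carrier_mat (dim_vec a) k" and k: "0 < k"
  shows "R' \<in> carrier_mat (Suc k) (Suc k)" "Q' \<in> carrier_mat (dim_vec a) (Suc k)"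
    "\<And>l j. l < dim_vec a \<Longrightarrow> j < k \<Longrightarrow> Q' $$ (l, j) = Q $$ (l, j)"
    "\<And>i j. i < k \<Longrightarrow> j < k \<Longrightarrow> R' $$ (i, j) = R $$ (i, j)"
    "\<And>j. j < k \<Longrightarrow> R' $$ (k, j) = 0"
    "gs_column e (dim_vec a) (\<lambda>l _. a $ l) (\<lambda>l j. Q' $$ (l, j)) (\<lambda>i j. R' $$ (i, j)) k"
proof -
  let ?m = "dim_vec a"
  have e: "0 \<le> e" "e < 1" using assms by auto
  obtain s p v \<psi> \<phi> d d' g g' r q where
    s: "fl_mult_mat_vec e Q\<^sup>T a s" and p: "fl_mult_mat_vec e Q s p" and v: "fl_minus_vec e a p v" and
    \<psi>: "fl_norm2 e a \<psi>" and \<phi>: "fl_norm2 e s \<phi>" and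
    d: "rounded e (\<psi> - \<phi>) d" "fl_sqrt e d d'" and g: "rounded e (\<psi> + \<phi>) g" "fl_sqrt e g g'" and
    r: "rounded e (d' * g') r" and q: "fl_div_vec e v r q" and
    R': "R' = four_block_mat R (mat_of_cols (dim_row R) [s]) (0\<^sub>m 1 (dim_col R)) (mat 1 1 (\<lambda>_. r))" and
    Q': "Q' = mat_of_cols (dim_row Q) (cols Q @ [q])"
    using assms(1) unfolding cgsp_step_def by blast
  have dims: "dim_vec s = k" "dim_vec p = ?m" "dim_vec v = ?m" "dim_vec q = ?m"
    using s p v q Q by (auto simp: fl_mult_mat_vec_def fl_minus_vec_def fl_div_vec_def)
  show "R' \<in> carrier_mat (Suc k) (Suc k)" using R by (auto simp: R')
  show "Q' \<in> carrier_mat ?m (Suc k)" using Q by (auto simp: Q')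
  have Qold: "Q' $$ (l, j) = Q $$ (l, j)" if "l < ?m" "j < k" for l j
    using Q that by (simp add: Q' mat_of_cols_index nth_append)
  have Qnew: "Q' $$ (l, k) = q $ l" if "l < ?m" for l
    using Q that by (simp add: Q' mat_of_cols_index nth_append)
  show "Q' $$ (l, j) = Q $$ (l, j)" if "l < ?m" "j < k" for l j by (rule Qold[OF that])
  show "R' $$ (i, j) = R $$ (i, j)" if "i < k" "j < k" for i j
    using R that by (simp add: R')
  show "R' $$ (k, j) = 0" if "j < k" for j
    using R that by (simp add: R')
  have Rs: "R' $$ (i, k) = s $ i" if "i < k" for i
    using R that by (simp add: R' mat_of_cols_index)
  have Rr: "R' $$ (k, k) = r" using R by (simp add: R')
  have m0: "0 < ?m"
    using \<psi> assms fl_sum_rel_pert[of e _ "{..<?m}"] by (fastforce simp: fl_norm2_def fl_dot_def)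
  have r0: "r \<noteq> 0" using q m0 dims by (auto simp: fl_div_vec_def fl_div_def)
  define A2 where "A2 = (\<Sum>l<?m. (a $ l)\<^sup>2)"
  define S2 where "S2 = (\<Sum>i<k. (s $ i)\<^sup>2)"
  have AS0: "0 \<le> A2" "0 \<le> S2" by (auto simp: A2_def S2_def sum_nonneg)
  have S: "\<bar>s $ i - (\<Sum>l<?m. Q $$ (l, i) * a $ l)\<bar>
    \<le> ((1 + e) ^ ?m - 1) * (\<Sum>l<?m. \<bar>Q $$ (l, i) * a $ l\<bar>)" if i: "i < k" for i
  proof -
    have "fl_dot e (row Q\<^sup>T i) a (s $ i)" using s i Q by (auto simp: fl_mult_mat_vec_def)
    from fl_dot_error[OF this e] show ?thesis using i Q by simp
  qed
  have P: "\<bar>p $ l - (\<Sum>i<k. Q $$ (l, i) * s $ i)\<bar>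
    \<le> ((1 + e) ^ k - 1) * (\<Sum>i<k. \<bar>Q $$ (l, i) * s $ i\<bar>)" if l: "l < ?m" for l
  proof -
    have "fl_dot e (row Q l) s (p $ l)" using p l Q by (auto simp: fl_mult_mat_vec_def)
    from fl_dot_error[OF this e] show ?thesis using l Q by simp
  qed
  have V: "\<bar>q $ l * r - (a $ l - (\<Sum>i<k. Q $$ (l, i) * s $ i))\<bar>
    \<le> (1 + e)\<^sup>2 * ((1 + e) ^ k - 1) * (\<Sum>i<k. \<bar>Q $$ (l, i) * s $ i\<bar>)
      + ((1 + e)\<^sup>2 - 1) * \<bar>a $ l - (\<Sum>i<k. Q $$ (l, i) * s $ i)\<bar>" if l: "l < ?m" for l
  proof -
    let ?S = "\<Sum>i<k. Q $$ (l, i) * s $ i" and ?T = "\<Sum>i<k. \<bar>Q $$ (l, i) * s $ i\<bar>"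
    obtain w1 where w1: "rel_pert e 1 w1" "v $ l = (a $ l - p $ l) * w1"
      using v l e roundedE[of e "a $ l - p $ l" "v $ l"] by (auto simp: fl_minus_vec_def)
    obtain w2 where w2: "rel_pert e 1 w2" "q $ l = v $ l / r * w2"
      using q l e dims roundedE[of e "v $ l / r" "q $ l"] by (auto simp: fl_div_vec_def fl_div_def)
    define w where "w = w1 * w2"
    have w: "rel_pert e 2 w"
      using rel_pert_mult[OF e w1(1) w2(1)] by (simp add: w_def numeral_2_eq_2)
    \<comment> \<open>Multiplying by \<open>r\<close> undoes the division exactly, leaving two
      rounding factors \<open>w\<close> on a - p. The error of \<open>p\<close> is thus scaled by
      \<open>w\<close>, and the exact residual only by w - 1.\<close>
    have "q $ l * r - (a $ l - ?S) = (?S - p $ l) * w + (a $ l - ?S) * (w - 1)"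
    proof -
      have "q $ l * r = (a $ l - p $ l) * w" using r0 by (simp add: w1(2) w2(2) w_def)
      then show ?thesis by (simp add: algebra_simps)
    qed
    also have "\<bar>\<dots>\<bar> \<le> \<bar>p $ l - ?S\<bar> * \<bar>w\<bar> + \<bar>a $ l - ?S\<bar> * \<bar>w - 1\<bar>"
      by (rule order_trans[OF abs_triangle_ineq]) (simp add: abs_mult abs_minus_commute)
    also have "\<dots> \<le> (((1 + e) ^ k - 1) * ?T) * (1 + e)\<^sup>2 + \<bar>a $ l - ?S\<bar> * ((1 + e)\<^sup>2 - 1)"
      using P[OF l] w rel_pert_pos[OF e w] rel_pert_error[OF e w]
      by (intro add_mono mult_mono mult_nonneg_nonneg sum_nonneg)
        (use e in \<open>auto simp: rel_pert_def\<close>)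
    finally show ?thesis by (simp add: mult_ac)
  qed
  obtain u1 where u1: "rel_pert e (?m + 2) u1" "\<psi>\<^sup>2 = A2 * u1" "0 \<le> \<psi>"
    using fl_norm2_rel_pert[OF \<psi> e] unfolding A2_def by metis
  obtain u2 where u2: "rel_pert e (k + 2) u2" "\<phi>\<^sup>2 = S2 * u2" "0 \<le> \<phi>"
    using fl_norm2_rel_pert[OF \<phi> e] unfolding S2_def dims by metis
  obtain x1 where x1: "rel_pert e 1 x1" "d = (\<psi> - \<phi>) * x1" using d e by (elim roundedE)
  obtain x2 where x2: "rel_pert e 1 x2" "d' = sqrt d * x2" and d0: "0 \<le> d"
    using d e by (auto simp: fl_sqrt_def elim: roundedE)
  obtain y1 where y1: "rel_pert e 1 y1" "g = (\<psi> + \<phi>) * y1" using g e by (elim roundedE)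
  obtain y2 where y2: "rel_pert e 1 y2" "g' = sqrt g * y2" and g0: "0 \<le> g"
    using g e by (auto simp: fl_sqrt_def elim: roundedE)
  obtain z where z: "rel_pert e 1 z" "r = d' * g' * z" using r e by (elim roundedE)
  have "0 \<le> r" using z x2 y2 d0 g0 rel_pert_pos[OF e] by (simp add: less_imp_le)
  with r0 have rpos: "0 < r" by simp
  \<comment> \<open>The purpose of the factored form: (psi - phi)(psi + phi) is exactly psi^2 -
    phi^2, so the roundings after the two norms give just one relative factor \<open>w\<close>. The
    factors of the two square roots and of the last product occur twice because \<open>r\<close> is
    squared.\<close>
  define w where "w = x1 * (x2 * (x2 * (y1 * (y2 * (y2 * (z * z))))))"
  have "rel_pert e (1 + (1 + (1 + (1 + (1 + (1 + (1 + 1))))))) w"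
    unfolding w_def using x1 x2 y1 y2 z e by (intro rel_pert_mult) auto
  then have w: "rel_pert e 8 w" by (simp add: numeral_eq_Suc)
  have "r\<^sup>2 = (\<psi>\<^sup>2 - \<phi>\<^sup>2) * w"
  proof -
    have "r\<^sup>2 = (sqrt d)\<^sup>2 * (sqrt g)\<^sup>2 * (x2 * x2 * y2 * y2 * (z * z))"
      by (simp add: z x2 y2 power2_eq_square algebra_simps)
    also have "\<dots> = d * g * (x2 * x2 * y2 * y2 * (z * z))" using d0 g0 by simp
    also have "\<dots> = (\<psi>\<^sup>2 - \<phi>\<^sup>2) * w" by (simp add: x1 y1 w_def power2_eq_square algebra_simps)
    finally show ?thesis .
  qed
  then have "r\<^sup>2 - (A2 - S2) = (A2 - S2) * (w - 1) + w * (A2 * (u1 - 1) - S2 * (u2 - 1))"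
    unfolding u1 u2 by (simp add: algebra_simps)
  also have "\<bar>\<dots>\<bar> \<le> \<bar>A2 - S2\<bar> * \<bar>w - 1\<bar> + \<bar>w\<bar> * (A2 * \<bar>u1 - 1\<bar> + S2 * \<bar>u2 - 1\<bar>)"
  proof -
    have "\<bar>A2 * (u1 - 1) - S2 * (u2 - 1)\<bar> \<le> A2 * \<bar>u1 - 1\<bar> + S2 * \<bar>u2 - 1\<bar>"
      using AS0 by (intro order_trans[OF abs_triangle_ineq4]) (simp add: abs_mult)
    then have "\<bar>w\<bar> * \<bar>A2 * (u1 - 1) - S2 * (u2 - 1)\<bar> \<le> \<bar>w\<bar> * (A2 * \<bar>u1 - 1\<bar> + S2 * \<bar>u2 - 1\<bar>)"
      by (intro mult_left_mono) auto
    then show ?thesis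
      by (intro order_trans[OF abs_triangle_ineq]) (simp add: abs_mult)
  qed
  also have "\<dots> \<le> \<bar>A2 - S2\<bar> * ((1 + e) ^ 8 - 1)
      + (1 + e) ^ 8 * (A2 * ((1 + e) ^ (?m + 2) - 1) + S2 * ((1 + e) ^ (k + 2) - 1))"
    using w rel_pert_pos[OF e w] rel_pert_error[OF e w] rel_pert_error[OF e u1(1)] rel_pert_error[OF e u2(1)] AS0
    by (intro add_mono mult_mono mult_nonneg_nonneg add_nonneg_nonneg)
      (use e in \<open>auto simp: rel_pert_def\<close>)
  finally have r2: "\<bar>r\<^sup>2 - (A2 - S2)\<bar> \<le> ((1 + e) ^ 8 - 1) * \<bar>A2 - S2\<bar>
      + (1 + e) ^ 8 * (((1 + e) ^ (?m + 2) - 1) * A2 + ((1 + e) ^ (k + 2) - 1) * S2)"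
    by (simp add: mult_ac)
  have sums: "(\<Sum>l<?m. Q' $$ (l, i) * a $ l) = (\<Sum>l<?m. Q $$ (l, i) * a $ l)"
    "(\<Sum>l<?m. \<bar>Q' $$ (l, i) * a $ l\<bar>) = (\<Sum>l<?m. \<bar>Q $$ (l, i) * a $ l\<bar>)" if "i < k" for i
    using that by (auto intro!: sum.cong simp: Qold)
  have sums2: "(\<Sum>i<k. Q' $$ (l, i) * s $ i) = (\<Sum>i<k. Q $$ (l, i) * s $ i)"
    "(\<Sum>i<k. \<bar>Q' $$ (l, i) * s $ i\<bar>) = (\<Sum>i<k. \<bar>Q $$ (l, i) * s $ i\<bar>)" if "l < ?m" for l
    using that by (auto intro!: sum.cong simp: Qold)
  show "gs_column e ?m (\<lambda>l _. a $ l) (\<lambda>l j. Q' $$ (l, j)) (\<lambda>i j. R' $$ (i, j)) k"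
    unfolding gs_column_def using k rpos r2 S V
    by (simp add: Rr Rs Qnew A2_def[symmetric] S2_def[symmetric] sums sums2)
qed


section \<open>Invariants along a run\<close>

lemma cgsp_run_columns:
  assumes run: "cgsp_run e A R Q" and A: "A \<in> carrier_mat m n" and e: "0 < e" "e < 1"
    and k: "1 \<le> k" "k \<le> n"
  shows "R k \<in> carrier_mat k k \<and> Q k \<in> carrier_mat m k \<and>
    (\<forall>i<k. \<forall>j<i. R k $$ (i, j) = 0) \<and>
    (\<forall>j<k. gs_column e m (\<lambda>l j. A $$ (l, j)) (\<lambda>l j. Q k $$ (l, j)) (\<lambda>i j. R k $$ (i, j)) j)"
  using k
proof (induction k rule: dec_induct)
  case base
  have "cgsp_init e (col A 0) (R 1) (Q 1)" using run by (simp add: cgsp_run_def)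
  note init = cgsp_init_column[OF this e]
  have "gs_column e m (\<lambda>l j. A $$ (l, j)) (\<lambda>l j. Q 1 $$ (l, j)) (\<lambda>i j. R 1 $$ (i, j)) 0"
    using init(3) A k by (subst gs_column_cong[where a' = "\<lambda>l _. col A 0 $ l"]) auto
  then show ?case using init A by simp
next
  case (step k)
  then have IH: "R k \<in> carrier_mat k k" "Q k \<in> carrier_mat m k" "\<And>i j. i < k \<Longrightarrow> j < i \<Longrightarrow> R k $$ (i, j) = 0"
    "\<And>j. j < k \<Longrightarrow> gs_column e m (\<lambda>l j. A $$ (l, j)) (\<lambda>l j. Q k $$ (l, j)) (\<lambda>i j. R k $$ (i, j)) j"
    by auto
  have "Suc k \<in> {2..dim_col A}" using step A by auto
  then have "cgsp_step e (col A k) (R k) (Q k) (R (Suc k)) (Q (Suc k))"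
    using run unfolding cgsp_run_def by (metis diff_Suc_1)
  note step_k = this
  have m: "dim_vec (col A k) = m" using A by simp
  have "Q k \<in> carrier_mat (dim_vec (col A k)) k" "0 < k" using IH(2) step(1) m by auto
  note st' = cgsp_step_column[OF step_k e IH(1) this, unfolded m]
  have st: "R (Suc k) \<in> carrier_mat (Suc k) (Suc k)" "Q (Suc k) \<in> carrier_mat m (Suc k)"
    "\<And>l j. l < m \<Longrightarrow> j < k \<Longrightarrow> Q (Suc k) $$ (l, j) = Q k $$ (l, j)"
    "\<And>i j. i < k \<Longrightarrow> j < k \<Longrightarrow> R (Suc k) $$ (i, j) = R k $$ (i, j)"
    "\<And>j. j < k \<Longrightarrow> R (Suc k) $$ (k, j) = 0"
    "gs_column e m (\<lambda>l _. col A k $ l) (\<lambda>l j. Q (Suc k) $$ (l, j)) (\<lambda>i j. R (Suc k) $$ (i, j)) k"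
    by (fact st')+
  have "gs_column e m (\<lambda>l j. A $$ (l, j)) (\<lambda>l j. Q (Suc k) $$ (l, j)) (\<lambda>i j. R (Suc k) $$ (i, j)) j"
    if "j < Suc k" for j
  proof (cases "j = k")
    case True
    then show ?thesis
      using st(6) A step by (subst gs_column_cong[where a' = "\<lambda>l _. col A k $ l"]) auto
  next
    case False
    then show ?thesis
      using IH(4)[of j] that st(3,4)
      by (subst gs_column_cong[where q' = "\<lambda>l j. Q k $$ (l, j)" and r' = "\<lambda>i j. R k $$ (i, j)"]) auto
  qed
  moreover have "R (Suc k) $$ (i, j) = 0" if "i < Suc k" "j < i" for i j
    using that st(4,5) IH(3) by (cases "i = k") auto
  ultimately show ?case using st(1,2) by blast
qed

text \<open>Every \<open>R k\<close> and \<open>Q k\<close> can thus be read off from the last pair,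
  and limits are needed only for \<open>R n\<close> and \<open>Q n\<close>.\<close>

lemma cgsp_run_nested:
  assumes run: "cgsp_run e A R Q" and A: "A \<in> carrier_mat m n" and e: "0 < e" "e < 1"
    and k: "1 \<le> k" "k \<le> k'" "k' \<le> n"
  shows "(\<forall>i<k. \<forall>j<k. R k' $$ (i, j) = R k $$ (i, j)) \<and> (\<forall>l<m. \<forall>j<k. Q k' $$ (l, j) = Q k $$ (l, j))"
  using k(2,3)
proof (induction k' rule: dec_induct)
  case (step k')
  then have c: "R k' \<in> carrier_mat k' k'" "Q k' \<in> carrier_mat m k'"
    using cgsp_run_columns[OF run A e, of k'] k by auto
  have "Suc k' \<in> {2..dim_col A}" using step A k by auto
  then have "cgsp_step e (col A k') (R k') (Q k') (R (Suc k')) (Q (Suc k'))"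
    using run unfolding cgsp_run_def by (metis diff_Suc_1)
  moreover have "dim_vec (col A k') = m" using A by simp
  ultimately show ?case
    using cgsp_step_column(3,4)[of e "col A k'" "R k'" "Q k'" "R (Suc k')" "Q (Suc k')" k'] e c step k
    by auto
qed simp

section \<open>Exact Gram--Schmidt orthonormalization\<close>

text \<open>Vectors are functions of the row index here, so that convergence can be stated entry by
  entry over the reals.\<close>

function gs_q :: "nat \<Rightarrow> (nat \<Rightarrow> nat \<Rightarrow> real) \<Rightarrow> nat \<Rightarrow> nat \<Rightarrow> real" where
  "gs_q m a j = (let v = (\<lambda>l. a l j - (\<Sum>i<j. gs_q m a i l * (\<Sum>k<m. gs_q m a i k * a k j)))
     in (\<lambda>l. v l / sqrt (\<Sum>k<m. (v k)\<^sup>2)))"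
  by pat_completeness auto
termination by (relation "measure (\<lambda>(m, a, j). j)") auto

declare gs_q.simps [simp del]

text \<open>Subtracting combinations of earlier vectors stays inside the column span. The
  coefficients are kept explicit because the one of column \<open>j\<close> will turn out to be 1,
  which contradicts a vanishing residual.\<close>

lemma triangular_combination:
  fixes a g c :: "nat \<Rightarrow> nat \<Rightarrow> real"
  assumes "\<And>i. i < j \<Longrightarrow> \<forall>l<m. g i l = (\<Sum>p<n. a l p * c i p)" "j < n"
  shows "\<forall>l<m. a l j - (\<Sum>i<j. g i l * s i)
    = (\<Sum>p<n. a l p * ((if p = j then 1 else 0) - (\<Sum>i<j. c i p * s i)))"
proof (intro allI impI)
  fix l assume l: "l < m"
  have "(\<Sum>i<j. g i l * s i) = (\<Sum>i<j. \<Sum>p<n. a l p * (c i p * s i))"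
  proof (rule sum.cong[OF refl])
    fix i assume "i \<in> {..<j}"
    then have "g i l * s i = (\<Sum>p<n. a l p * c i p) * s i" using assms l by simp
    then show "g i l * s i = (\<Sum>p<n. a l p * (c i p * s i))"
      by (simp only: sum_distrib_right mult.assoc)
  qed
  also have "\<dots> = (\<Sum>p<n. \<Sum>i<j. a l p * (c i p * s i))" by (rule sum.swap)
  also have "\<dots> = (\<Sum>p<n. a l p * (\<Sum>i<j. c i p * s i))" by (simp add: sum_distrib_left)
  finally show "a l j - (\<Sum>i<j. g i l * s i)
    = (\<Sum>p<n. a l p * ((if p = j then 1 else 0) - (\<Sum>i<j. c i p * s i)))"
    using assms(2) by (simp add: right_diff_distrib sum_subtractf if_distrib[of "(*) _"] cong: if_cong)
qed

locale indep_columns =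
  fixes m n :: nat and a :: "nat \<Rightarrow> nat \<Rightarrow> real"
  assumes indep: "\<And>x. (\<forall>l<m. (\<Sum>p<n. a l p * x p) = 0) \<Longrightarrow> \<forall>p<n. x p = 0"
begin

definition "qx l j = gs_q m a j l"
definition "resid l j = a l j - (\<Sum>i<j. qx l i * (\<Sum>k<m. qx k i * a k j))"
definition "rx i j = (if i = j then sqrt (\<Sum>l<m. (resid l j)\<^sup>2) else \<Sum>l<m. qx l i * a l j)"

lemma qx_eq: "qx l j = resid l j / rx j j"
  unfolding qx_def resid_def rx_def by (subst gs_q.simps) (simp add: Let_def)

lemma resid_eq: "resid l j = a l j - (\<Sum>i<j. qx l i * rx i j)"
  by (simp add: resid_def rx_def)

lemma rx_nonneg: "0 \<le> rx j j"
  by (simp add: rx_def sum_nonneg)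

lemma rx_diag: "(rx j j)\<^sup>2 = (\<Sum>l<m. (resid l j)\<^sup>2)"
  by (simp add: rx_def sum_nonneg)

text \<open>No positivity of \<open>rx j j\<close> is needed: if it is 0, then \<open>qx\<close> and all coefficients vanish, as \<open>x / 0 = 0\<close>.\<close>

lemma qx_combination:
  assumes "j < n"
  shows "\<exists>c. (\<forall>p>j. c p = 0) \<and> (\<forall>l<m. qx l j = (\<Sum>p<n. a l p * c p))"
  using assms
proof (induction j rule: less_induct)
  case (less j)
  then have "\<forall>i. \<exists>c. i < j \<longrightarrow> (\<forall>p>i. c p = 0) \<and> (\<forall>l<m. qx l i = (\<Sum>p<n. a l p * c p))"
    by (meson less_trans)
  then obtain c where c: "\<And>i. i < j \<Longrightarrow> (\<forall>p>i. c i p = 0) \<and> (\<forall>l<m. qx l i = (\<Sum>p<n. a l p * c i p))"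
    by metis
  have *: "\<forall>l<m. resid l j = (\<Sum>p<n. a l p * ((if p = j then 1 else 0) - (\<Sum>i<j. c i p * rx i j)))"
    unfolding resid_eq using c less.prems by (intro triangular_combination[where g = "\<lambda>i l. qx l i"]) auto
  show ?case
  proof (intro exI conjI allI impI)
    fix l assume "l < m"
    then show "qx l j = (\<Sum>p<n. a l p * (((if p = j then 1 else 0) - (\<Sum>i<j. c i p * rx i j)) / rx j j))"
      using * by (simp add: qx_eq sum_divide_distrib)
  next
    fix p assume "j < p"
    then show "((if p = j then 1 else 0) - (\<Sum>i<j. c i p * rx i j)) / rx j j = 0"
      using c by simp
  qed
qed

text \<open>A vanishing residual would be a linear relation between the columns in which column
  \<open>j\<close> has coefficient 1.\<close>

lemma rx_pos:
  assumes j: "j < n"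
  shows "0 < rx j j"
proof (rule ccontr)
  assume "\<not> 0 < rx j j"
  then have "rx j j = 0" using rx_nonneg[of j] by linarith
  then have "\<forall>l<m. resid l j = 0"
    using rx_diag[of j] by (simp add: sum_nonneg_eq_0_iff)
  moreover have "\<forall>i. \<exists>c. i < j \<longrightarrow> (\<forall>p>i. c p = 0) \<and> (\<forall>l<m. qx l i = (\<Sum>p<n. a l p * c p))"
    using qx_combination j by (meson less_trans)
  then obtain c where c: "\<And>i. i < j \<Longrightarrow> (\<forall>p>i. c i p = 0) \<and> (\<forall>l<m. qx l i = (\<Sum>p<n. a l p * c i p))"
    by metis
  have "\<forall>l<m. resid l j = (\<Sum>p<n. a l p * ((if p = j then 1 else 0) - (\<Sum>i<j. c i p * rx i j)))"
    unfolding resid_eq using c j by (intro triangular_combination[where g = "\<lambda>i l. qx l i"]) auto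
  ultimately have "\<forall>p<n. (if p = j then 1 else 0) - (\<Sum>i<j. c i p * rx i j) = 0"
    by (intro indep) simp
  \<comment> \<open>For i < j the vector \<open>qx\<close> with index i involves only columns up to
    i, so every \<open>c i j\<close> is 0.\<close>
  then have "1 - (\<Sum>i<j. c i j * rx i j) = 0" using j by auto
  then show False using c by simp
qed

lemma qx_times_rx: "j < n \<Longrightarrow> qx l j * rx j j = resid l j"
  using rx_pos[of j] by (simp add: qx_eq)

lemma qx_unit: "j < n \<Longrightarrow> (\<Sum>l<m. (qx l j)\<^sup>2) = 1"
  using rx_pos[of j]
  by (simp add: qx_eq power_divide rx_diag[symmetric] sum_divide_distrib[symmetric])

text \<open>Strong induction on the larger index: against \<open>qx\<close> with index
  \<open>i\<close>, column \<open>j\<close> contributes \<open>rx i j\<close>, and the subtracted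
  projections collapse to the same number by orthonormality of the earlier vectors.\<close>

lemma qx_orthogonal: "i < j \<Longrightarrow> j < n \<Longrightarrow> (\<Sum>l<m. qx l i * qx l j) = 0"
proof (induction j arbitrary: i rule: less_induct)
  case (less j)
  \<comment> \<open>Both \<open>i\<close> and \<open>p\<close> lie below \<open>j\<close>, so the
    induction hypothesis applies to whichever is larger.\<close>
  have orth: "(\<Sum>l<m. qx l i * qx l p) = (if p = i then 1 else 0)" if "p < j" for p
  proof (cases p i rule: linorder_cases)
    case less
    then have "(\<Sum>l<m. qx l p * qx l i) = 0" using less.IH[of i p] less.prems by auto
    then show ?thesis using less by (simp add: mult.commute)
  next
    case equal
    then show ?thesis using qx_unit[of i] less.prems by (simp add: power2_eq_square)
  next
    case greater
    then show ?thesis using less.IH[of p i] less.prems that by auto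
  qed
  have "(\<Sum>l<m. qx l i * (\<Sum>p<j. qx l p * rx p j)) = (\<Sum>l<m. \<Sum>p<j. qx l i * qx l p * rx p j)"
    by (simp add: sum_distrib_left mult.assoc)
  also have "\<dots> = (\<Sum>p<j. \<Sum>l<m. qx l i * qx l p * rx p j)" by (rule sum.swap)
  also have "\<dots> = (\<Sum>p<j. (if p = i then 1 else 0) * rx p j)"
    by (intro sum.cong) (auto simp: orth sum_distrib_right[symmetric])
  also have "\<dots> = rx i j" using less.prems by (simp add: if_distrib[of "\<lambda>x. x * _"] cong: if_cong)
  finally have "(\<Sum>l<m. qx l i * resid l j) = 0"
    using less.prems by (simp add: resid_eq right_diff_distrib sum_subtractf) (simp add: rx_def)
  then show ?case by (simp add: qx_eq[of _ j] sum_divide_distrib[symmetric])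
qed

lemma qx_gram:
  "\<lbrakk>i < n; j < n\<rbrakk> \<Longrightarrow> (\<Sum>l<m. qx l i * qx l j) = (if i = j then 1 else 0)"
  using qx_orthogonal[of i j] qx_orthogonal[of j i] qx_unit[of i]
  by (cases i j rule: linorder_cases) (auto simp: power2_eq_square mult.commute)

lemma a_eq: "j < n \<Longrightarrow> a l j = (\<Sum>i\<le>j. qx l i * rx i j)"
  using qx_times_rx[of j l] by (simp add: lessThan_Suc_atMost[symmetric] resid_eq)

text \<open>Pythagoras: column \<open>j\<close> of \<open>a\<close> has the coefficients
  \<open>rx i j\<close> in the orthonormal system \<open>qx\<close>.\<close>

lemma rx_column: "j < n \<Longrightarrow> (\<Sum>i\<le>j. (rx i j)\<^sup>2) = (\<Sum>l<m. (a l j)\<^sup>2)"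
proof -
  assume j: "j < n"
  have "(\<Sum>l<m. (a l j)\<^sup>2) = (\<Sum>l<m. \<Sum>i\<le>j. \<Sum>p\<le>j. rx i j * rx p j * (qx l i * qx l p))"
    unfolding a_eq[OF j] power2_eq_square sum_product by (simp add: mult_ac)
  also have "\<dots> = (\<Sum>i\<le>j. \<Sum>p\<le>j. \<Sum>l<m. rx i j * rx p j * (qx l i * qx l p))"
    by (subst sum.swap, rule sum.cong[OF refl], rule sum.swap)
  also have "\<dots> = (\<Sum>i\<le>j. \<Sum>p\<le>j. rx i j * rx p j * (if i = p then 1 else 0))"
    using j by (intro sum.cong refl) (simp add: sum_distrib_left[symmetric] qx_gram)
  also have "\<dots> = (\<Sum>i\<le>j. (rx i j)\<^sup>2)"
    by (simp add: if_distrib[of "(*) _"] power2_eq_square cong: if_cong)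
  finally show ?thesis by simp
qed

end

section \<open>First-order constants\<close>

lemma sum_abs_mult_square_le:
  fixes f g :: "nat \<Rightarrow> real"
  shows "(\<Sum>i\<in>I. \<bar>f i * g i\<bar>)\<^sup>2 \<le> (\<Sum>i\<in>I. (f i)\<^sup>2) * (\<Sum>i\<in>I. (g i)\<^sup>2)"
proof -
  have "(\<Sum>i\<in>I. \<bar>f i * g i\<bar>)\<^sup>2 \<le> (L2_set f I * L2_set g I)\<^sup>2"
    using L2_set_mult_ineq[of f g I] by (intro power_mono) (auto simp: abs_mult sum_nonneg)
  then show ?thesis by (simp add: power_mult_distrib L2_set_def sum_nonneg)
qed

lemma sum_abs_mult_le:
  fixes f g :: "nat \<Rightarrow> real"
  assumes "(\<Sum>i\<in>I. (f i)\<^sup>2) \<le> x\<^sup>2" "(\<Sum>i\<in>I. (g i)\<^sup>2) \<le> y\<^sup>2" "0 \<le> x" "0 \<le> y"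
  shows "(\<Sum>i\<in>I. \<bar>f i * g i\<bar>) \<le> x * y"
proof (rule power2_le_imp_le)
  have "(\<Sum>i\<in>I. \<bar>f i * g i\<bar>)\<^sup>2 \<le> x\<^sup>2 * y\<^sup>2"
    using sum_abs_mult_square_le[of f g I] assms
    by (meson mult_mono order_trans sum_nonneg zero_le_power2)
  then show "(\<Sum>i\<in>I. \<bar>f i * g i\<bar>)\<^sup>2 \<le> (x * y)\<^sup>2" by (simp add: power_mult_distrib)
qed (use assms in simp)

section \<open>First-order coefficients evaluated at the exact factorization\<close>

context indep_columns
begin

text \<open>The exact form of r_kk^2 = psi^2 - phi^2. It identifies the limit of the Cholesky-like
  diagonal with the Gram-Schmidt diagonal.\<close>

lemma rx_diag_eq: "j < n \<Longrightarrow> (rx j j)\<^sup>2 = (\<Sum>l<m. (a l j)\<^sup>2) - (\<Sum>i<j. (rx i j)\<^sup>2)"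
  using rx_column[of j] by (simp add: lessThan_Suc_atMost[symmetric])

text \<open>\<open>dx\<close>, \<open>ex\<close> and \<open>gx\<close> are the coefficients of \<open>e\<close> in the bounds for the entries of
  \<open>QR - A\<close> and for the off-diagonal and diagonal entries of \<open>R\<^sup>TR - A\<^sup>TA\<close>.\<close>

definition "dx l j = real j * (\<Sum>i<j. \<bar>qx l i * rx i j\<bar>) + 2 * \<bar>qx l j * rx j j\<bar>"

definition "ex i j = (\<Sum>p\<le>i. \<bar>rx p i\<bar> * (real m * (\<Sum>l<m. \<bar>qx l p * a l j\<bar>))) + (\<Sum>l<m. \<bar>a l j\<bar> * dx l i)"

definition "gx j = 8 * (rx j j)\<^sup>2 + real (m + 2) * (\<Sum>l<m. (a l j)\<^sup>2) + real (j + 2) * (\<Sum>i<j. (rx i j)\<^sup>2)"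

lemma rx_le:
  assumes "j < n" "i \<le> j" "(\<Sum>l<m. (a l j)\<^sup>2) \<le> B\<^sup>2" "0 \<le> B"
  shows "\<bar>rx i j\<bar> \<le> B"
proof -
  have "(rx i j)\<^sup>2 \<le> (\<Sum>i\<le>j. (rx i j)\<^sup>2)" using assms by (intro member_le_sum) auto
  also have "\<dots> \<le> B\<^sup>2" using rx_column assms by simp
  finally show ?thesis using assms by (simp add: abs_le_square_iff[symmetric])
qed

text \<open>\<open>M\<close> dominates both coefficients j and 2, which merges the two terms of
  \<open>dx\<close>. Cauchy-Schwarz in each row then leaves the sum of squares of the first j + 1
  columns of \<open>qx\<close>, and each of these has norm 1.\<close>

lemma dx_norm:
  assumes j: "j < n" and B: "(\<Sum>l<m. (a l j)\<^sup>2) \<le> B\<^sup>2" and M: "j \<le> M" "2 \<le> M"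
  shows "(\<Sum>l<m. (dx l j)\<^sup>2) \<le> (real M)\<^sup>2 * real (Suc j) * B\<^sup>2"
proof -
  have "(dx l j)\<^sup>2 \<le> (real M)\<^sup>2 * ((\<Sum>i\<le>j. (qx l i)\<^sup>2) * B\<^sup>2)" for l
  proof -
    have "dx l j \<le> real M * (\<Sum>i<j. \<bar>qx l i * rx i j\<bar>) + real M * \<bar>qx l j * rx j j\<bar>"
      unfolding dx_def using M by (intro add_mono mult_right_mono sum_nonneg) auto
    also have "\<dots> = real M * (\<Sum>i\<le>j. \<bar>qx l i * rx i j\<bar>)"
      by (simp add: lessThan_Suc_atMost[symmetric] distrib_left)
    finally have "(dx l j)\<^sup>2 \<le> (real M * (\<Sum>i\<le>j. \<bar>qx l i * rx i j\<bar>))\<^sup>2"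
      by (intro power_mono) (auto simp: dx_def sum_nonneg)
    also have "\<dots> \<le> (real M)\<^sup>2 * ((\<Sum>i\<le>j. (qx l i)\<^sup>2) * (\<Sum>i\<le>j. (rx i j)\<^sup>2))"
      unfolding power_mult_distrib by (intro mult_left_mono sum_abs_mult_square_le) auto
    also have "\<dots> \<le> (real M)\<^sup>2 * ((\<Sum>i\<le>j. (qx l i)\<^sup>2) * B\<^sup>2)"
      using B rx_column[OF j] by (intro mult_left_mono) (auto intro: sum_nonneg)
    finally show ?thesis .
  qed
  then have "(\<Sum>l<m. (dx l j)\<^sup>2) \<le> (\<Sum>l<m. (real M)\<^sup>2 * ((\<Sum>i\<le>j. (qx l i)\<^sup>2) * B\<^sup>2))"
    by (intro sum_mono)
  also have "\<dots> = (real M)\<^sup>2 * ((\<Sum>l<m. \<Sum>i\<le>j. (qx l i)\<^sup>2) * B\<^sup>2)"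
    by (simp add: sum_distrib_left sum_distrib_right)
  also have "(\<Sum>l<m. \<Sum>i\<le>j. (qx l i)\<^sup>2) = (\<Sum>i\<le>j. \<Sum>l<m. (qx l i)\<^sup>2)" by (rule sum.swap)
  also have "\<dots> = real (Suc j)" using j by (simp add: qx_unit)
  finally show ?thesis by (simp add: mult_ac)
qed

lemma ex_le:
  assumes ij: "i < j" "j < n" and B: "\<And>p. p \<le> j \<Longrightarrow> (\<Sum>l<m. (a l p)\<^sup>2) \<le> B\<^sup>2" "0 \<le> B"
    and M: "i \<le> M" "2 \<le> M"
  shows "ex i j \<le> (real m + real M) * real (Suc i) * B\<^sup>2"
proof -
  have "(\<Sum>p\<le>i. \<bar>rx p i\<bar> * (real m * (\<Sum>l<m. \<bar>qx l p * a l j\<bar>))) \<le> (\<Sum>p\<le>i. B * (real m * (1 * B)))"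
    using ij B qx_unit by (intro sum_mono mult_mono rx_le sum_abs_mult_le mult_nonneg_nonneg sum_nonneg) auto
  also have "\<dots> = real m * real (Suc i) * B\<^sup>2" by (simp add: power2_eq_square)
  finally have 1: "(\<Sum>p\<le>i. \<bar>rx p i\<bar> * (real m * (\<Sum>l<m. \<bar>qx l p * a l j\<bar>))) \<le> real m * real (Suc i) * B\<^sup>2" .
  \<comment> \<open>\<open>dx_norm\<close> provides only the square root of \<open>Suc i\<close>; it
    is weakened to \<open>Suc i\<close> so that both halves of \<open>ex\<close> carry the same
    factor.\<close>
  have "real (Suc i) \<le> (real (Suc i))\<^sup>2" by (simp add: power2_eq_square)
  then have "(real M)\<^sup>2 * real (Suc i) * B\<^sup>2 \<le> (real M)\<^sup>2 * (real (Suc i))\<^sup>2 * B\<^sup>2"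
    by (intro mult_right_mono mult_left_mono) auto
  moreover have "(\<Sum>l<m. (dx l i)\<^sup>2) \<le> (real M)\<^sup>2 * real (Suc i) * B\<^sup>2"
    using dx_norm[of i B M] ij B(1)[of i] M by auto
  ultimately have "(\<Sum>l<m. (dx l i)\<^sup>2) \<le> (real M * real (Suc i) * B)\<^sup>2"
    by (simp add: power_mult_distrib)
  then have "(\<Sum>l<m. \<bar>a l j * dx l i\<bar>) \<le> B * (real M * real (Suc i) * B)"
    using B by (intro sum_abs_mult_le) auto
  moreover have "(\<Sum>l<m. \<bar>a l j\<bar> * dx l i) = (\<Sum>l<m. \<bar>a l j * dx l i\<bar>)"
    by (intro sum.cong) (auto simp: abs_mult dx_def sum_nonneg)
  ultimately have "(\<Sum>l<m. \<bar>a l j\<bar> * dx l i) \<le> real M * real (Suc i) * B\<^sup>2"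
    by (simp add: power2_eq_square mult_ac)
  with 1 show ?thesis unfolding ex_def by (simp add: distrib_right)
qed

text \<open>Both 8 and j + 2 are at most j + 8, and Pythagoras merges the two terms so weighted; the
  remaining m + 2 makes m + 10 + j.\<close>

lemma gx_le:
  assumes j: "j < n" and B: "(\<Sum>l<m. (a l j)\<^sup>2) \<le> B\<^sup>2"
  shows "gx j \<le> real (m + 10 + j) * B\<^sup>2"
proof -
  have "8 * (rx j j)\<^sup>2 + real (j + 2) * (\<Sum>i<j. (rx i j)\<^sup>2)
    \<le> real (j + 8) * (rx j j)\<^sup>2 + real (j + 8) * (\<Sum>i<j. (rx i j)\<^sup>2)"
    by (intro add_mono mult_right_mono sum_nonneg) auto
  also have "\<dots> = real (j + 8) * (\<Sum>l<m. (a l j)\<^sup>2)"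
    using rx_column[OF j] by (simp add: lessThan_Suc_atMost[symmetric] distrib_left[symmetric])
  finally have "gx j \<le> real (j + 8) * (\<Sum>l<m. (a l j)\<^sup>2) + real (m + 2) * (\<Sum>l<m. (a l j)\<^sup>2)"
    unfolding gx_def by linarith
  also have "\<dots> = real (m + 10 + j) * (\<Sum>l<m. (a l j)\<^sup>2)" by (simp add: algebra_simps)
  also have "\<dots> \<le> real (m + 10 + j) * B\<^sup>2" using B by (intro mult_left_mono) auto
  finally show ?thesis .
qed

end

text \<open>The k^2 is the limiting Frobenius constant of QR - A from
  \<open>factor_error_eventually\<close>. Strictness is what absorbs all terms of higher
  order.\<close>

lemma c1_gt: "2 \<le> k \<Longrightarrow> k \<le> m \<Longrightarrow> (real k)\<^sup>2 < c1 m k"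
proof -
  assume k: "2 \<le> k" "k \<le> m"
  have s: "1 \<le> sqrt (2::real)" by simp
  have "(real k)\<^sup>2 \<le> 1 * (real m * real k)" using k by (simp add: power2_eq_square mult_right_mono)
  also have "\<dots> \<le> 2 * sqrt 2 * (real m * real k)"
    using s by (intro mult_right_mono) (linarith, simp)
  also have "\<dots> < c1 m k" using k by (simp add: c1_def)
  finally show ?thesis .
qed

section \<open>Limits of the computed quantities\<close>

lemma tendsto_of_error_bound:
  fixes f g :: "'w \<Rightarrow> real"
  assumes "\<forall>\<^sub>F w in F. \<bar>f w - g w\<bar> \<le> b w" "(b \<longlongrightarrow> 0) F" "(g \<longlongrightarrow> L) F"
  shows "(f \<longlongrightarrow> L) F"
proof -
  have "((\<lambda>w. f w - g w) \<longlongrightarrow> 0) F"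
  proof (rule tendsto_sandwich)
    show "((\<lambda>w. - b w) \<longlongrightarrow> 0) F" using tendsto_minus[OF assms(2)] by simp
    show "\<forall>\<^sub>F w in F. - b w \<le> f w - g w" "\<forall>\<^sub>F w in F. f w - g w \<le> b w"
      using assms(1) by (eventually_elim; simp add: abs_le_iff)+
  qed (rule assms(2))
  from tendsto_add[OF this assms(3)] show ?thesis by simp
qed

text \<open>The derivative of x^N at 1, taken along \<open>F\<close>; the geometric sum turns the
  quotient into a polynomial in \<open>e\<close>.\<close>

lemma tendsto_power_quotient:
  fixes e :: "'w \<Rightarrow> real"
  assumes "(e \<longlongrightarrow> 0) F" "\<forall>\<^sub>F w in F. 0 < e w"
  shows "((\<lambda>w. ((1 + e w) ^ N - 1) / e w) \<longlongrightarrow> real N) F"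
proof (rule Lim_transform_eventually)
  have "((\<lambda>w. \<Sum>i<N. (1 + e w) ^ i) \<longlongrightarrow> (\<Sum>i<N. (1 + 0) ^ i)) F"
    by (intro tendsto_intros assms(1))
  then show "((\<lambda>w. \<Sum>i<N. (1 + e w) ^ i) \<longlongrightarrow> real N) F" by simp
  show "\<forall>\<^sub>F w in F. (\<Sum>i<N. (1 + e w) ^ i) = ((1 + e w) ^ N - 1) / e w"
    using assms(2) by eventually_elim (subst power_diff_1_eq, auto)
qed

text \<open>Equivalently, the upper limit of \<open>\<bar>f\<bar> / e\<close> along \<open>F\<close> is at most \<open>h\<close>; limits of \<open>f / e\<close> need not exist.\<close>

definition first_order :: "'w filter \<Rightarrow> ('w \<Rightarrow> real) \<Rightarrow> ('w \<Rightarrow> real) \<Rightarrow> real \<Rightarrow> bool" where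
  "first_order F e f h \<longleftrightarrow> (\<exists>b. (b \<longlongrightarrow> h) F \<and> (\<forall>\<^sub>F w in F. \<bar>f w\<bar> \<le> e w * b w))"

lemma first_orderI:
  assumes "((\<lambda>w. b w / e w) \<longlongrightarrow> h) F" "\<forall>\<^sub>F w in F. 0 < e w" "\<forall>\<^sub>F w in F. \<bar>f w\<bar> \<le> b w"
  shows "first_order F e f h"
  unfolding first_order_def
proof (intro exI conjI)
  show "\<forall>\<^sub>F w in F. \<bar>f w\<bar> \<le> e w * (b w / e w)"
    using assms(2,3) by eventually_elim simp
qed (rule assms(1))

lemma first_order_add:
  assumes "first_order F e f h" "first_order F e g k"
  shows "first_order F e (\<lambda>w. f w + g w) (h + k)"
proof -
  obtain b c where "(b \<longlongrightarrow> h) F" "(c \<longlongrightarrow> k) F"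
    and ev: "\<forall>\<^sub>F w in F. \<bar>f w\<bar> \<le> e w * b w" "\<forall>\<^sub>F w in F. \<bar>g w\<bar> \<le> e w * c w"
    using assms by (auto simp: first_order_def)
  then have "((\<lambda>w. b w + c w) \<longlongrightarrow> h + k) F" by (intro tendsto_add)
  moreover have "\<forall>\<^sub>F w in F. \<bar>f w + g w\<bar> \<le> e w * (b w + c w)"
    using ev by eventually_elim (simp add: distrib_left)
  ultimately show ?thesis unfolding first_order_def by blast
qed

lemma first_order_sum:
  assumes "finite I" "\<And>i. i \<in> I \<Longrightarrow> first_order F e (f i) (h i)"
  shows "first_order F e (\<lambda>w. \<Sum>i\<in>I. f i w) (\<Sum>i\<in>I. h i)"
  using assms
proof (induction I rule: finite_induct)
  case empty
  show ?case unfolding first_order_def by (intro exI[of _ "\<lambda>_. 0"]) simp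
next
  case (insert i I)
  then show ?case using first_order_add[of F e "f i" "h i"] by simp
qed

text \<open>A convergent factor enters only through its limit. This replaces computed entries by
  exact ones in the constants.\<close>

lemma first_order_mult:
  assumes "(g \<longlongrightarrow> L) F" "first_order F e f h"
  shows "first_order F e (\<lambda>w. g w * f w) (\<bar>L\<bar> * h)"
proof -
  obtain b where b: "(b \<longlongrightarrow> h) F" and ev: "\<forall>\<^sub>F w in F. \<bar>f w\<bar> \<le> e w * b w"
    using assms by (auto simp: first_order_def)
  have "((\<lambda>w. \<bar>g w\<bar> * b w) \<longlongrightarrow> \<bar>L\<bar> * h) F"
    using assms b by (intro tendsto_intros)
  moreover have "\<forall>\<^sub>F w in F. \<bar>g w * f w\<bar> \<le> e w * (\<bar>g w\<bar> * b w)"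
    using ev
  proof eventually_elim
    case (elim w)
    then have "\<bar>g w\<bar> * \<bar>f w\<bar> \<le> \<bar>g w\<bar> * (e w * b w)" by (intro mult_left_mono) auto
    then show ?case by (simp add: abs_mult mult_ac)
  qed
  ultimately show ?thesis unfolding first_order_def by blast
qed

text \<open>Here strict inequality between constants is traded for a bound free of any second-order
  term.\<close>

lemma first_order_eventually:
  assumes "first_order F e f h" "h < c" "\<forall>\<^sub>F w in F. 0 < e w"
  shows "\<forall>\<^sub>F w in F. \<bar>f w\<bar> \<le> e w * c"
proof -
  obtain b where b: "(b \<longlongrightarrow> h) F" and ev: "\<forall>\<^sub>F w in F. \<bar>f w\<bar> \<le> e w * b w"
    using assms by (auto simp: first_order_def)
  from order_tendstoD(2)[OF b assms(2)] ev assms(3) show ?thesis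
  proof eventually_elim
    case (elim w)
    then have "e w * b w \<le> e w * c" by simp
    with elim show ?case by linarith
  qed
qed

text \<open>The limits \<open>dx\<close> are controlled through their sum of squares, so the
  comparison with \<open>c\<close> has to follow the summation and cannot be made entry by
  entry.\<close>

lemma first_order_sum_squares:
  assumes "finite I" "\<And>i. i \<in> I \<Longrightarrow> first_order F e (f i) (h i)"
    and "(\<Sum>i\<in>I. (h i)\<^sup>2) < c" "\<forall>\<^sub>F w in F. 0 < e w"
  shows "\<forall>\<^sub>F w in F. (\<Sum>i\<in>I. (f i w)\<^sup>2) \<le> (e w)\<^sup>2 * c"
proof -
  have "\<forall>i\<in>I. \<exists>b. (b \<longlongrightarrow> h i) F \<and> (\<forall>\<^sub>F w in F. \<bar>f i w\<bar> \<le> e w * b w)"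
    using assms(2) by (auto simp: first_order_def)
  then obtain b where b: "\<And>i. i \<in> I \<Longrightarrow> (b i \<longlongrightarrow> h i) F"
    "\<And>i. i \<in> I \<Longrightarrow> \<forall>\<^sub>F w in F. \<bar>f i w\<bar> \<le> e w * b i w"
    by metis
  have "((\<lambda>w. \<Sum>i\<in>I. (b i w)\<^sup>2) \<longlongrightarrow> (\<Sum>i\<in>I. (h i)\<^sup>2)) F"
    by (intro tendsto_intros b)
  from order_tendstoD(2)[OF this assms(3)]
  have "\<forall>\<^sub>F w in F. (\<Sum>i\<in>I. (b i w)\<^sup>2) < c" .
  moreover have "\<forall>\<^sub>F w in F. \<forall>i\<in>I. \<bar>f i w\<bar> \<le> e w * b i w"
    using b(2) assms(1) by (simp add: eventually_ball_finite)
  ultimately show ?thesis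
  proof eventually_elim
    case (elim w)
    have "(\<Sum>i\<in>I. (f i w)\<^sup>2) \<le> (\<Sum>i\<in>I. (e w * b i w)\<^sup>2)"
      using elim by (intro sum_mono) (meson abs_ge_zero abs_le_square_iff abs_ge_self order_trans)
    also have "\<dots> = (e w)\<^sup>2 * (\<Sum>i\<in>I. (b i w)\<^sup>2)"
      by (simp add: power_mult_distrib sum_distrib_left)
    also have "\<dots> \<le> (e w)\<^sup>2 * c" using elim by (intro mult_left_mono) auto
    finally show ?case .
  qed
qed

text \<open>A point \<open>w\<close> stands for a whole run with all its rounding errors. Uniformity
  in these errors is hidden in the choice of \<open>F\<close>.\<close>

locale gs_limit = indep_columns +
  fixes F :: "'w filter" and e :: "'w \<Rightarrow> real" and q r :: "'w \<Rightarrow> nat \<Rightarrow> nat \<Rightarrow> real"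
  assumes e_lim: "(e \<longlongrightarrow> 0) F" and e_pos: "\<forall>\<^sub>F w in F. 0 < e w"
    and columns: "\<And>j. j < n \<Longrightarrow> \<forall>\<^sub>F w in F. gs_column (e w) m a (q w) (r w) j"
begin

lemma power_lim: "((\<lambda>w. (1 + e w) ^ N) \<longlongrightarrow> 1) F"
  using tendsto_power[OF tendsto_add[OF tendsto_const[of 1] e_lim], of N] by simp

lemma power_error_lim: "((\<lambda>w. (1 + e w) ^ N - 1) \<longlongrightarrow> 0) F"
  using tendsto_diff[OF power_lim[of N] tendsto_const[of 1]] by simp

lemmas power_quotient_lim = tendsto_power_quotient[OF e_lim e_pos]

lemma columnsD:
  assumes "j < n"
  shows "\<forall>\<^sub>F w in F. 0 < r w j j"
    "i < j \<Longrightarrow> \<forall>\<^sub>F w in F. \<bar>r w i j - (\<Sum>l<m. q w l i * a l j)\<bar>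
      \<le> ((1 + e w) ^ m - 1) * (\<Sum>l<m. \<bar>q w l i * a l j\<bar>)"
    "l < m \<Longrightarrow> \<forall>\<^sub>F w in F. \<bar>q w l j * r w j j - (a l j - (\<Sum>i<j. q w l i * r w i j))\<bar>
      \<le> (1 + e w)\<^sup>2 * ((1 + e w) ^ j - 1) * (\<Sum>i<j. \<bar>q w l i * r w i j\<bar>)
        + ((1 + e w)\<^sup>2 - 1) * \<bar>a l j - (\<Sum>i<j. q w l i * r w i j)\<bar>"
    "\<forall>\<^sub>F w in F. \<bar>(r w j j)\<^sup>2 - ((\<Sum>l<m. (a l j)\<^sup>2) - (\<Sum>i<j. (r w i j)\<^sup>2))\<bar>
      \<le> ((1 + e w) ^ 8 - 1) * \<bar>(\<Sum>l<m. (a l j)\<^sup>2) - (\<Sum>i<j. (r w i j)\<^sup>2)\<bar>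
        + (1 + e w) ^ 8 * (((1 + e w) ^ (m + 2) - 1) * (\<Sum>l<m. (a l j)\<^sup>2)
          + ((1 + e w) ^ (j + 2) - 1) * (\<Sum>i<j. (r w i j)\<^sup>2))"
  by (rule eventually_mono[OF columns[OF assms]]; simp add: gs_column_def)+

text \<open>Follows the order of computation within a column: projections from earlier columns of
  \<open>q\<close>, then the diagonal entry from the projections, then the new column of
  \<open>q\<close>.\<close>

lemma q_r_lim:
  "j < n \<Longrightarrow> (\<forall>i\<le>j. ((\<lambda>w. r w i j) \<longlongrightarrow> rx i j) F) \<and> (\<forall>l<m. ((\<lambda>w. q w l j) \<longlongrightarrow> qx l j) F)"
proof (induction j rule: less_induct)
  case (less j)
  have q: "((\<lambda>w. q w l i) \<longlongrightarrow> qx l i) F" if "i < j" "l < m" for i l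
    using less.IH[OF that(1)] less.prems that by auto
  have r: "((\<lambda>w. r w i j) \<longlongrightarrow> rx i j) F" if i: "i < j" for i
  proof (rule tendsto_of_error_bound[OF columnsD(2)[OF less.prems i]])
    have "((\<lambda>w. ((1 + e w) ^ m - 1) * (\<Sum>l<m. \<bar>q w l i * a l j\<bar>))
      \<longlongrightarrow> 0 * (\<Sum>l<m. \<bar>qx l i * a l j\<bar>)) F"
      using q i by (intro tendsto_mult power_error_lim tendsto_sum tendsto_rabs tendsto_const) auto
    then show "((\<lambda>w. ((1 + e w) ^ m - 1) * (\<Sum>l<m. \<bar>q w l i * a l j\<bar>)) \<longlongrightarrow> 0) F" by simp
    have "((\<lambda>w. \<Sum>l<m. q w l i * a l j) \<longlongrightarrow> (\<Sum>l<m. qx l i * a l j)) F"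
      using q i by (intro tendsto_mult tendsto_sum tendsto_const) auto
    then show "((\<lambda>w. \<Sum>l<m. q w l i * a l j) \<longlongrightarrow> rx i j) F" using i by (simp add: rx_def)
  qed
  let ?A2 = "\<Sum>l<m. (a l j)\<^sup>2"
  have S2: "((\<lambda>w. \<Sum>i<j. (r w i j)\<^sup>2) \<longlongrightarrow> (\<Sum>i<j. (rx i j)\<^sup>2)) F"
    using r by (intro tendsto_intros) auto
  have "((\<lambda>w. (r w j j)\<^sup>2) \<longlongrightarrow> (rx j j)\<^sup>2) F"
  proof (rule tendsto_of_error_bound[OF columnsD(4)[OF less.prems]])
    have "((\<lambda>w. ((1 + e w) ^ 8 - 1) * \<bar>?A2 - (\<Sum>i<j. (r w i j)\<^sup>2)\<bar>
        + (1 + e w) ^ 8 * (((1 + e w) ^ (m + 2) - 1) * ?A2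
          + ((1 + e w) ^ (j + 2) - 1) * (\<Sum>i<j. (r w i j)\<^sup>2)))
      \<longlongrightarrow> 0 * \<bar>?A2 - (\<Sum>i<j. (rx i j)\<^sup>2)\<bar> + 1 * (0 * ?A2 + 0 * (\<Sum>i<j. (rx i j)\<^sup>2))) F"
      by (intro tendsto_add tendsto_mult power_error_lim power_lim tendsto_rabs tendsto_diff tendsto_const S2)
    then show "((\<lambda>w. ((1 + e w) ^ 8 - 1) * \<bar>?A2 - (\<Sum>i<j. (r w i j)\<^sup>2)\<bar>
        + (1 + e w) ^ 8 * (((1 + e w) ^ (m + 2) - 1) * ?A2
          + ((1 + e w) ^ (j + 2) - 1) * (\<Sum>i<j. (r w i j)\<^sup>2))) \<longlongrightarrow> 0) F" by simp
    show "((\<lambda>w. ?A2 - (\<Sum>i<j. (r w i j)\<^sup>2)) \<longlongrightarrow> (rx j j)\<^sup>2) F"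
      unfolding rx_diag_eq[OF less.prems] by (intro tendsto_diff tendsto_const S2)
  qed
  \<comment> \<open>The error bound concerns the square only; the signs of the computed and of the
    exact diagonal entry select the root.\<close>
  then have "((\<lambda>w. sqrt ((r w j j)\<^sup>2)) \<longlongrightarrow> sqrt ((rx j j)\<^sup>2)) F" by (rule tendsto_real_sqrt)
  then have "((\<lambda>w. \<bar>r w j j\<bar>) \<longlongrightarrow> rx j j) F" by (simp add: rx_nonneg)
  then have rj: "((\<lambda>w. r w j j) \<longlongrightarrow> rx j j) F"
    by (rule Lim_transform_eventually) (use columnsD(1)[OF less.prems] in \<open>eventually_elim; simp\<close>)
  have qj: "((\<lambda>w. q w l j) \<longlongrightarrow> qx l j) F" if l: "l < m" for l
  proof -
    let ?S = "\<lambda>w. a l j - (\<Sum>i<j. q w l i * r w i j)" and ?T = "\<lambda>w. \<Sum>i<j. \<bar>q w l i * r w i j\<bar>"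
    have S: "(?S \<longlongrightarrow> resid l j) F"
      unfolding resid_eq using q r l by (intro tendsto_intros) auto
    have T: "(?T \<longlongrightarrow> (\<Sum>i<j. \<bar>qx l i * rx i j\<bar>)) F"
      using q r l by (intro tendsto_intros) auto
    have "((\<lambda>w. q w l j * r w j j) \<longlongrightarrow> resid l j) F"
    proof (rule tendsto_of_error_bound[OF columnsD(3)[OF less.prems l] _ S])
      have "((\<lambda>w. (1 + e w)\<^sup>2 * ((1 + e w) ^ j - 1) * ?T w + ((1 + e w)\<^sup>2 - 1) * \<bar>?S w\<bar>)
        \<longlongrightarrow> 1 * 0 * (\<Sum>i<j. \<bar>qx l i * rx i j\<bar>) + 0 * \<bar>resid l j\<bar>) F"
        by (intro tendsto_add tendsto_mult power_error_lim power_lim tendsto_rabs S T)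
      then show "((\<lambda>w. (1 + e w)\<^sup>2 * ((1 + e w) ^ j - 1) * ?T w + ((1 + e w)\<^sup>2 - 1) * \<bar>?S w\<bar>)
        \<longlongrightarrow> 0) F" by simp
    qed
    \<comment> \<open>Full rank enters here: the limit of the divisor is positive.\<close>
    from tendsto_divide[OF this rj] have "((\<lambda>w. q w l j * r w j j / r w j j) \<longlongrightarrow> qx l j) F"
      using rx_pos[OF less.prems] by (simp add: qx_eq)
    then show ?thesis
      by (rule Lim_transform_eventually) (use columnsD(1)[OF less.prems] in \<open>eventually_elim; simp\<close>)
  qed
  show ?case using r rj qj by (auto simp: le_less)
qed

lemma q_lim: "\<lbrakk>j < n; l < m\<rbrakk> \<Longrightarrow> ((\<lambda>w. q w l j) \<longlongrightarrow> qx l j) F"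
  and r_lim: "\<lbrakk>j < n; i \<le> j\<rbrakk> \<Longrightarrow> ((\<lambda>w. r w i j) \<longlongrightarrow> rx i j) F"
  using q_r_lim by blast+

text \<open>In \<open>dx\<close> the factor j counts the roundings in Q s, and the 2 those of the
  subtraction and the division.\<close>

lemma factor_error:
  assumes j: "j < n" and l: "l < m"
  shows "first_order F e (\<lambda>w. (\<Sum>i\<le>j. q w l i * r w i j) - a l j) (dx l j)"
proof (rule first_orderI[OF _ e_pos])
  let ?S = "\<lambda>w. a l j - (\<Sum>i<j. q w l i * r w i j)" and ?T = "\<lambda>w. \<Sum>i<j. \<bar>q w l i * r w i j\<bar>"
  have q: "((\<lambda>w. q w l i) \<longlongrightarrow> qx l i) F" and r: "((\<lambda>w. r w i j) \<longlongrightarrow> rx i j) F" if "i < j" for i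
    using that j l by (auto intro: q_lim r_lim)
  have S: "(?S \<longlongrightarrow> qx l j * rx j j) F"
    unfolding qx_times_rx[OF j] resid_eq using q r by (intro tendsto_intros) auto
  have T: "(?T \<longlongrightarrow> (\<Sum>i<j. \<bar>qx l i * rx i j\<bar>)) F"
    using q r by (intro tendsto_intros) auto
  have "((\<lambda>w. (1 + e w)\<^sup>2 * (((1 + e w) ^ j - 1) / e w) * ?T w + (((1 + e w)\<^sup>2 - 1) / e w) * \<bar>?S w\<bar>)
    \<longlongrightarrow> 1 * real j * (\<Sum>i<j. \<bar>qx l i * rx i j\<bar>) + real 2 * \<bar>qx l j * rx j j\<bar>) F"
    by (intro tendsto_add tendsto_mult power_quotient_lim power_lim tendsto_rabs S T)
  then show "((\<lambda>w. ((1 + e w)\<^sup>2 * ((1 + e w) ^ j - 1) * ?T w + ((1 + e w)\<^sup>2 - 1) * \<bar>?S w\<bar>) / e w)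
    \<longlongrightarrow> dx l j) F"
    by (simp add: dx_def add_divide_distrib)
  show "\<forall>\<^sub>F w in F. \<bar>(\<Sum>i\<le>j. q w l i * r w i j) - a l j\<bar>
    \<le> (1 + e w)\<^sup>2 * ((1 + e w) ^ j - 1) * ?T w + ((1 + e w)\<^sup>2 - 1) * \<bar>?S w\<bar>"
    using columnsD(3)[OF j l]
    by eventually_elim (simp add: lessThan_Suc_atMost[symmetric] algebra_simps)
qed

lemma projection_error:
  assumes "i < j" "j < n"
  shows "first_order F e (\<lambda>w. r w i j - (\<Sum>l<m. q w l i * a l j)) (real m * (\<Sum>l<m. \<bar>qx l i * a l j\<bar>))"
proof (rule first_orderI[OF _ e_pos columnsD(2)[OF assms(2,1)]])
  have "((\<lambda>w. (((1 + e w) ^ m - 1) / e w) * (\<Sum>l<m. \<bar>q w l i * a l j\<bar>))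
    \<longlongrightarrow> real m * (\<Sum>l<m. \<bar>qx l i * a l j\<bar>)) F"
    using assms by (intro tendsto_mult power_quotient_lim tendsto_sum tendsto_rabs tendsto_const q_lim) auto
  then show "((\<lambda>w. ((1 + e w) ^ m - 1) * (\<Sum>l<m. \<bar>q w l i * a l j\<bar>) / e w)
    \<longlongrightarrow> real m * (\<Sum>l<m. \<bar>qx l i * a l j\<bar>)) F" by simp
qed

text \<open>Entry (i, j) of R^T (R - Q^T A) + (QR - A)^T A, with sums cut at \<open>i\<close> by
  triangularity. For p <= i < j every \<open>r w p j\<close> is a computed projection, so both
  residuals are already estimated.\<close>

lemma gram_error_offdiag:
  assumes ij: "i < j" "j < n"
  shows "first_order F e (\<lambda>w. (\<Sum>p\<le>i. r w p i * r w p j) - (\<Sum>l<m. a l i * a l j)) (ex i j)"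
proof -
  have "first_order F e (\<lambda>w. (\<Sum>p\<le>i. r w p i * (r w p j - (\<Sum>l<m. q w l p * a l j)))
      + (\<Sum>l<m. a l j * ((\<Sum>p\<le>i. q w l p * r w p i) - a l i))) (ex i j)"
    unfolding ex_def using ij
    by (intro first_order_add first_order_sum first_order_mult r_lim projection_error factor_error
      tendsto_const) auto
  moreover have "(\<Sum>p\<le>i. r w p i * (r w p j - (\<Sum>l<m. q w l p * a l j)))
      + (\<Sum>l<m. a l j * ((\<Sum>p\<le>i. q w l p * r w p i) - a l i))
    = (\<Sum>p\<le>i. r w p i * r w p j) - (\<Sum>l<m. a l i * a l j)" for w
  proof -
    have "(\<Sum>p\<le>i. r w p i * (\<Sum>l<m. q w l p * a l j)) = (\<Sum>l<m. a l j * (\<Sum>p\<le>i. q w l p * r w p i))"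
      unfolding sum_distrib_left by (subst sum.swap) (simp add: mult_ac)
    then show ?thesis by (simp add: right_diff_distrib sum_subtractf mult.commute)
  qed
  ultimately show ?thesis by simp
qed

text \<open>The diagonal entry of \<open>r\<close> is not computed as a projection. Instead its
  square approximates psi^2 - phi^2, and the error of that is precisely the diagonal Gram
  residual.\<close>

lemma gram_error_diag:
  assumes j: "j < n"
  shows "first_order F e (\<lambda>w. (\<Sum>p\<le>j. r w p j * r w p j) - (\<Sum>l<m. a l j * a l j)) (gx j)"
proof (rule first_orderI[OF _ e_pos])
  let ?A2 = "\<Sum>l<m. (a l j)\<^sup>2" and ?S2 = "\<lambda>w. \<Sum>i<j. (r w i j)\<^sup>2"
  let ?b = "\<lambda>w. ((1 + e w) ^ 8 - 1) * \<bar>?A2 - ?S2 w\<bar>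
      + (1 + e w) ^ 8 * (((1 + e w) ^ (m + 2) - 1) * ?A2 + ((1 + e w) ^ (j + 2) - 1) * ?S2 w)"
  have S2: "(?S2 \<longlongrightarrow> (\<Sum>i<j. (rx i j)\<^sup>2)) F"
    using r_lim[OF j] by (intro tendsto_intros) auto
  have "((\<lambda>w. (((1 + e w) ^ 8 - 1) / e w) * \<bar>?A2 - ?S2 w\<bar>
      + (1 + e w) ^ 8 * ((((1 + e w) ^ (m + 2) - 1) / e w) * ?A2 + (((1 + e w) ^ (j + 2) - 1) / e w) * ?S2 w))
    \<longlongrightarrow> real 8 * \<bar>?A2 - (\<Sum>i<j. (rx i j)\<^sup>2)\<bar>
      + 1 * (real (m + 2) * ?A2 + real (j + 2) * (\<Sum>i<j. (rx i j)\<^sup>2))) F"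
    by (intro tendsto_add tendsto_mult power_quotient_lim power_lim tendsto_rabs tendsto_diff tendsto_const S2)
  then show "((\<lambda>w. ?b w / e w) \<longlongrightarrow> gx j) F"
    unfolding rx_diag_eq[OF j, symmetric] gx_def by (simp add: add_divide_distrib distrib_left add.assoc)
  show "\<forall>\<^sub>F w in F. \<bar>(\<Sum>p\<le>j. r w p j * r w p j) - (\<Sum>l<m. a l j * a l j)\<bar> \<le> ?b w"
    using columnsD(4)[OF j]
    by eventually_elim (simp add: lessThan_Suc_atMost[symmetric] power2_eq_square algebra_simps)
qed

text \<open>By \<open>dx_norm\<close> with M = k, each of the k columns contributes at most k^3 B^2
  to the limiting squared Frobenius norm, hence k^4 B^2 in all; \<open>c1_gt\<close> leaves
  room.\<close>

lemma factor_error_eventually: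
  assumes k: "2 \<le> k" "k \<le> n" "k \<le> m" and B: "\<And>p. p < k \<Longrightarrow> (\<Sum>l<m. (a l p)\<^sup>2) \<le> B\<^sup>2" "0 < B"
  shows "\<forall>\<^sub>F w in F. (\<Sum>l<m. \<Sum>j<k. ((\<Sum>i\<le>j. q w l i * r w i j) - a l j)\<^sup>2) \<le> (c1 m k * B * e w)\<^sup>2"
proof -
  let ?I = "{..<m} \<times> {..<k}"
  have "(\<Sum>x\<in>?I. (dx (fst x) (snd x))\<^sup>2) = (\<Sum>l<m. \<Sum>j<k. (dx l j)\<^sup>2)"
    by (simp add: sum.cartesian_product case_prod_beta)
  also have "\<dots> = (\<Sum>j<k. \<Sum>l<m. (dx l j)\<^sup>2)" by (rule sum.swap)
  also have "\<dots> \<le> (\<Sum>j<k. (real k)\<^sup>2 * real k * B\<^sup>2)"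
  proof (rule sum_mono)
    fix j assume j: "j \<in> {..<k}"
    have "(\<Sum>l<m. (dx l j)\<^sup>2) \<le> (real k)\<^sup>2 * real (Suc j) * B\<^sup>2"
      using dx_norm[of j B k] j k B by auto
    also have "\<dots> \<le> (real k)\<^sup>2 * real k * B\<^sup>2"
      using j by (intro mult_right_mono mult_left_mono) auto
    finally show "(\<Sum>l<m. (dx l j)\<^sup>2) \<le> (real k)\<^sup>2 * real k * B\<^sup>2" .
  qed
  also have "\<dots> = ((real k)\<^sup>2)\<^sup>2 * B\<^sup>2" by (simp add: power2_eq_square)
  also have "\<dots> < (c1 m k)\<^sup>2 * B\<^sup>2"
    using c1_gt[of k] k B by (intro mult_strict_right_mono power_strict_mono) auto
  finally have "\<forall>\<^sub>F w in F. (\<Sum>x\<in>?I. ((\<Sum>i\<le>snd x. q w (fst x) i * r w i (snd x)) - a (fst x) (snd x))\<^sup>2)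
    \<le> (e w)\<^sup>2 * ((c1 m k)\<^sup>2 * B\<^sup>2)"
    using k by (intro first_order_sum_squares[where h = "\<lambda>x. dx (fst x) (snd x)"] e_pos)
      (auto intro!: factor_error)
  then show ?thesis
    by (simp add: sum.cartesian_product case_prod_beta power_mult_distrib mult_ac)
qed

text \<open>The target per entry is c2 / k = 3.5 m k - 1.5 m + 16. Diagonal entries have limiting
  coefficient at most m + 10 + j, the others at most 2 m k; both are smaller because k >= 2 and j <
  k <= m.\<close>

lemma gram_error_eventually:
  assumes k: "2 \<le> k" "k \<le> n" "k \<le> m" and B: "\<And>p. p < k \<Longrightarrow> (\<Sum>l<m. (a l p)\<^sup>2) \<le> B\<^sup>2" "0 < B"
  shows "\<forall>\<^sub>F w in F. \<forall>i<k. \<forall>j<k. i \<le> j \<longrightarrow>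
    \<bar>(\<Sum>p\<le>i. r w p i * r w p j) - (\<Sum>l<m. a l i * a l j)\<bar> \<le> e w * (c2 m k / real k * B\<^sup>2)"
proof -
  have c2: "c2 m k / real k = 3.5 * real m * real k - 1.5 * real m + 16"
    using k by (simp add: c2_def power2_eq_square field_simps)
  have mk: "2 * real m \<le> real m * real k" "real k \<le> real m" "2 \<le> real k"
    using k mult_left_mono[of 2 "real k" "real m"] by (auto simp: mult.commute)
  have "\<forall>\<^sub>F w in F. \<bar>(\<Sum>p\<le>i. r w p i * r w p j) - (\<Sum>l<m. a l i * a l j)\<bar> \<le> e w * (c2 m k / real k * B\<^sup>2)"
    if ij: "i \<le> j" "j < k" for i j
  proof (cases "i = j")
    case True
    have "gx j \<le> real (m + 10 + j) * B\<^sup>2" using ij k B by (intro gx_le) auto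
    moreover have "real j < real k" using ij by simp
    then have "real (m + 10 + j) < c2 m k / real k"
      unfolding c2 mult.assoc of_nat_add of_nat_numeral using mk by linarith
    then have "real (m + 10 + j) * B\<^sup>2 < c2 m k / real k * B\<^sup>2"
      using B by (intro mult_strict_right_mono) auto
    ultimately have "gx j < c2 m k / real k * B\<^sup>2" by linarith
    from first_order_eventually[OF gram_error_diag this e_pos] show ?thesis
      using True ij k by simp
  next
    case False
    \<comment> \<open>This is \<open>ex_le\<close> with M = m.\<close>
    have "ex i j \<le> (real m + real m) * real (Suc i) * B\<^sup>2"
      using ij False k B by (intro ex_le) auto
    also have "\<dots> \<le> (real m + real m) * real k * B\<^sup>2"
      using ij False by (intro mult_left_mono mult_right_mono) auto
    also have "\<dots> < c2 m k / real k * B\<^sup>2"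
    proof (rule mult_strict_right_mono)
      show "(real m + real m) * real k < c2 m k / real k"
        unfolding c2 mult.assoc distrib_right using mk by linarith
    qed (use B in simp)
    finally have "ex i j < c2 m k / real k * B\<^sup>2" .
    from first_order_eventually[OF gram_error_offdiag this e_pos] show ?thesis
      using False ij k by simp
  qed
  then have "\<forall>\<^sub>F w in F. \<forall>x\<in>{..<k} \<times> {..<k}. fst x \<le> snd x \<longrightarrow>
    \<bar>(\<Sum>p\<le>fst x. r w p (fst x) * r w p (snd x)) - (\<Sum>l<m. a l (fst x) * a l (snd x))\<bar>
      \<le> e w * (c2 m k / real k * B\<^sup>2)"
    by (intro eventually_ball_finite) (auto intro: eventually_mono simp: eventually_conj_iff)
  then show ?thesis by eventually_elim auto
qed

end

section \<open>Perturbation bounds for an approximate QR factorization\<close>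

text \<open>Linear independence speaks of the set of columns and so forgets repetitions; a trivial
  kernel follows only once the columns are distinct. A repetition would leave fewer than
  \<open>nc\<close> vectors to choose an independent set from.\<close>

lemma (in vec_space) full_rank_distinct_cols:
  assumes A: "A \<in> carrier_mat n nc" and rank: "rank A = nc"
  shows "distinct (cols A)"
proof (rule ccontr)
  assume nd: "\<not> distinct (cols A)"
  obtain S where S: "maximal S (\<lambda>T. T \<subseteq> set (cols A) \<and> lin_indpt T)"
    using maximal_exists[of "(\<lambda>T. T \<subseteq> set (cols A) \<and> lin_indpt T)" "card (set (cols A))" "{}"]
    by (meson List.finite_set card_mono empty_iff empty_subsetI finite_lin_indpt2 rev_finite_subset)
  have "card S \<le> card (set (cols A))"
    using S by (simp add: card_mono maximal_def)
  also have "\<dots> < nc"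
    using nd card_length[of "cols A"] card_distinct[of "cols A"] A by fastforce
  finally show False using rank_card_indpt[OF A S] rank by simp
qed

lemma (in vec_space) full_rank_injective:
  assumes A: "A \<in> carrier_mat n nc" and rank: "rank A = nc"
    and v: "v \<in> carrier_vec nc" "A *\<^sub>v v = 0\<^sub>v n"
  shows "v = 0\<^sub>v nc"
  using lin_depI[OF A v(1) _ v(2)] full_rank_distinct_cols[OF A rank]
    full_rank_lin_indpt[OF A rank] by blast

text \<open>A lower bound for the smallest singular value, obtained without compactness from the
  left inverse (A^T A)^-1 A^T.\<close>

lemma injective_bounded_below:
  assumes A: "A \<in> carrier_mat m k" and mk: "0 < m" "0 < k"
    and inj: "\<And>v. \<lbrakk>v \<in> carrier_vec k; A *\<^sub>v v = 0\<^sub>v m\<rbrakk> \<Longrightarrow> v = 0\<^sub>v k"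
  shows "\<exists>\<sigma>>0. \<forall>v\<in>carrier_vec k. \<sigma> * norm2 v \<le> norm2 (A *\<^sub>v v)"
proof -
  let ?G = "A\<^sup>T * A"
  have G: "?G \<in> carrier_mat k k" using A by auto
  have "det ?G \<noteq> 0"
  proof
    assume "det ?G = 0"
    then obtain v where v: "v \<in> carrier_vec k" "v \<noteq> 0\<^sub>v k" "?G *\<^sub>v v = 0\<^sub>v k"
      using det_0_iff_vec_prod_zero_field[OF G] by blast
    have "(norm2 (A *\<^sub>v v))\<^sup>2 = 0"
      unfolding norm2_mult_mat_vec_square[OF A v(1)] v(3) using v(1) by simp
    then have "A *\<^sub>v v = 0\<^sub>v m" using norm2_zero_iff[of "A *\<^sub>v v" m] A v by simp
    then show False using inj v by blast
  qed
  then obtain N where N: "N \<in> carrier_mat k k" "N * ?G = 1\<^sub>m k"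
    using det_non_zero_imp_unit[OF G, where b = "()"] by (auto simp: Units_def ring_mat_def)
  let ?P = "N * A\<^sup>T"
  have P: "?P \<in> carrier_mat k m" using A N by auto
  \<comment> \<open>The summand 1 keeps the divisor positive when \<sigma> is taken as the
    reciprocal.\<close>
  have bound: "norm2 v \<le> (spectral_norm ?P + 1) * norm2 (A *\<^sub>v v)" if v: "v \<in> carrier_vec k" for v
  proof -
    have "?P * A = 1\<^sub>m k" using A N by simp
    then have "v = ?P *\<^sub>v (A *\<^sub>v v)"
      using assoc_mult_mat_vec[OF P A v] v by simp
    then have "norm2 v \<le> spectral_norm ?P * norm2 (A *\<^sub>v v)"
      using norm2_mult_mat_vec_le[OF P, of "A *\<^sub>v v"] A v by auto
    also have "\<dots> \<le> (spectral_norm ?P + 1) * norm2 (A *\<^sub>v v)"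
      by (intro mult_right_mono) auto
    finally show ?thesis .
  qed
  have pos: "0 < spectral_norm ?P + 1" using spectral_norm_nonneg[OF P mk(1)] by simp
  then show ?thesis
    using bound by (intro exI[of _ "1 / (spectral_norm ?P + 1)"]) (simp add: field_simps)
qed

text \<open>Identifies the abstract inverse with the value of \<open>mat_inverse\<close>, which is
  the one occurring in \<open>kappa2\<close>.\<close>

lemma invertible_matE:
  assumes "invertible_mat (M :: real mat)" "M \<in> carrier_mat k k"
  obtains B where "B \<in> carrier_mat k k" "M * B = 1\<^sub>m k" "B * M = 1\<^sub>m k" "mat_inverse M = Some B"
proof -
  obtain N where N: "inverts_mat M N" "inverts_mat N M"
    using assms by (auto simp: invertible_mat_def)
  have "dim_row N = k" "dim_col N = k"
    using N assms(2) unfolding inverts_mat_def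
    by (metis carrier_matD index_mult_mat(2,3) index_one_mat(2,3))+
  then have "M * N = 1\<^sub>m k" "N * M = 1\<^sub>m k" "N \<in> carrier_mat k k"
    using N assms(2) by (auto simp: inverts_mat_def)
  then have "M \<in> Units (ring_mat TYPE(real) k ())"
    using assms(2) by (auto simp: Units_def ring_mat_def)
  then obtain B where B: "mat_inverse M = Some B"
    using mat_inverse(1)[OF assms(2), of "()"] by (cases "mat_inverse M") auto
  from that[OF _ _ _ B] mat_inverse(2)[OF assms(2) B] show ?thesis by blast
qed

lemma gram_diff:
  fixes M N :: "real mat"
  assumes "M \<in> carrier_mat m k" "N \<in> carrier_mat m k"
  shows "M\<^sup>T * M - N\<^sup>T * N = (M - N)\<^sup>T * M + N\<^sup>T * (M - N)"
proof (rule eq_matI)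
  fix i j assume "i < dim_row ((M - N)\<^sup>T * M + N\<^sup>T * (M - N))" "j < dim_col ((M - N)\<^sup>T * M + N\<^sup>T * (M - N))"
  then have ij: "i < k" "j < k" using assms by auto
  show "(M\<^sup>T * M - N\<^sup>T * N) $$ (i, j) = ((M - N)\<^sup>T * M + N\<^sup>T * (M - N)) $$ (i, j)"
    using assms ij
    by (simp add: scalar_prod_def algebra_simps sum.distrib[symmetric] sum_subtractf[symmetric])
qed (use assms in auto)

lemma spectral_norm_gram_diff_le:
  assumes M: "M \<in> carrier_mat m k" and N: "N \<in> carrier_mat m k" and mk: "0 < m" "0 < k"
    and d: "spectral_norm (M - N) \<le> d" and b: "spectral_norm N \<le> b"
  shows "spectral_norm (M\<^sup>T * M - N\<^sup>T * N) \<le> 2 * b * d + d\<^sup>2"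
proof -
  have MN: "M - N \<in> carrier_mat m k" using M N by auto
  have d0: "0 \<le> d" "0 \<le> b" using spectral_norm_nonneg[OF MN mk(2)] d spectral_norm_nonneg[OF N mk(2)] b
    by linarith+
  have "M = N + (M - N)" using M N by (intro eq_matI) auto
  then have Mb: "spectral_norm M \<le> b + d"
    using spectral_norm_add_le[OF N MN mk(2)] d b by simp
  have T: "spectral_norm (M - N)\<^sup>T \<le> d" "spectral_norm N\<^sup>T \<le> b"
    using spectral_norm_transpose_le[OF MN mk] spectral_norm_transpose_le[OF N mk] d b by auto
  have "spectral_norm ((M - N)\<^sup>T * M) \<le> spectral_norm (M - N)\<^sup>T * spectral_norm M"
    using M N mk by (intro spectral_norm_mult_le[of _ k m _ k]) auto
  also have "\<dots> \<le> d * (b + d)"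
    using T Mb d0 M mk by (intro mult_mono) (auto intro: spectral_norm_nonneg)
  finally have 1: "spectral_norm ((M - N)\<^sup>T * M) \<le> d * (b + d)" .
  have "spectral_norm (N\<^sup>T * (M - N)) \<le> spectral_norm N\<^sup>T * spectral_norm (M - N)"
    using M N mk by (intro spectral_norm_mult_le[of _ k m _ k]) auto
  also have "\<dots> \<le> b * d"
    using T d d0 MN mk by (intro mult_mono) (auto intro: spectral_norm_nonneg)
  finally have 2: "spectral_norm (N\<^sup>T * (M - N)) \<le> b * d" .
  have "spectral_norm (M\<^sup>T * M - N\<^sup>T * N) \<le> spectral_norm ((M - N)\<^sup>T * M) + spectral_norm (N\<^sup>T * (M - N))"
    unfolding gram_diff[OF M N] using M N mk by (intro spectral_norm_add_le[of _ k k]) auto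
  with 1 2 show ?thesis by (simp add: power2_eq_square algebra_simps)
qed

text \<open>Congruence with \<open>B\<close>, the inverse of \<open>R\<close>, turns R^T R - (QR)^T
  QR into I - Q^T Q. With h and d of sizes c2 ||A||^2 e and c1 ||A|| e, the first-order part is (c2
  + 2 c1) ||A||^2 e; this is the origin of \<open>c4\<close>.\<close>

lemma orthogonality_loss_le:
  assumes A: "A \<in> carrier_mat m k" and Q: "Q \<in> carrier_mat m k" and R: "R \<in> carrier_mat k k"
    and B: "B \<in> carrier_mat k k" "R * B = 1\<^sub>m k" and mk: "0 < m" "0 < k"
    and d: "spectral_norm (Q * R - A) \<le> d" and h: "spectral_norm (R\<^sup>T * R - A\<^sup>T * A) \<le> h"
  shows "spectral_norm (1\<^sub>m k - Q\<^sup>T * Q) \<le> (spectral_norm B)\<^sup>2 * (h + 2 * spectral_norm A * d + d\<^sup>2)"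
proof -
  let ?M = "Q * R"
  define X where "X = R\<^sup>T * R - ?M\<^sup>T * ?M"
  have M: "?M \<in> carrier_mat m k" using Q R by auto
  have X: "X \<in> carrier_mat k k" using Q R by (auto simp: X_def)
  have "X = (R\<^sup>T * R - A\<^sup>T * A) - (?M\<^sup>T * ?M - A\<^sup>T * A)"
    unfolding X_def using A Q R by (intro eq_matI) auto
  then have "spectral_norm X \<le> spectral_norm (R\<^sup>T * R - A\<^sup>T * A) + spectral_norm (?M\<^sup>T * ?M - A\<^sup>T * A)"
    using A Q R mk by (auto intro!: spectral_norm_diff_le)
  also have "\<dots> \<le> h + (2 * spectral_norm A * d + d\<^sup>2)"
    using h spectral_norm_gram_diff_le[OF M A mk d order_refl] by (intro add_mono)
  finally have Xle: "spectral_norm X \<le> h + 2 * spectral_norm A * d + d\<^sup>2" by simp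
  have MB: "?M * B = Q" using Q R B by simp
  have "B\<^sup>T * X * B = B\<^sup>T * (R\<^sup>T * R) * B - B\<^sup>T * (?M\<^sup>T * ?M) * B"
  proof -
    have "B\<^sup>T * X = B\<^sup>T * (R\<^sup>T * R) - B\<^sup>T * (?M\<^sup>T * ?M)"
      unfolding X_def using B Q R by (intro mult_minus_distrib_mat) auto
    moreover have "(B\<^sup>T * (R\<^sup>T * R) - B\<^sup>T * (?M\<^sup>T * ?M)) * B = B\<^sup>T * (R\<^sup>T * R) * B - B\<^sup>T * (?M\<^sup>T * ?M) * B"
      using B Q R by (intro minus_mult_distrib_mat) auto
    ultimately show ?thesis by simp
  qed
  also have "B\<^sup>T * (R\<^sup>T * R) * B = (R * B)\<^sup>T * (R * B)"
    using R B(1) by (simp add: transpose_mult[OF R B(1)] assoc_mult_mat[of _ k k _ k _ k])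
  also have "B\<^sup>T * (?M\<^sup>T * ?M) * B = (?M * B)\<^sup>T * (?M * B)"
    unfolding transpose_mult[OF M B(1)] using M B(1)
    by (simp only: assoc_mult_mat[of "B\<^sup>T" k k "?M\<^sup>T * ?M" k B k] assoc_mult_mat[of "?M\<^sup>T" k m ?M k B k]
      assoc_mult_mat[of "B\<^sup>T" k k "?M\<^sup>T" m "?M * B" k] transpose_carrier_mat mult_carrier_mat[of "?M\<^sup>T" k m ?M k]
      mult_carrier_mat[of ?M m k B k])
  finally have eq: "B\<^sup>T * X * B = 1\<^sub>m k - Q\<^sup>T * Q" unfolding MB B(2) by simp
  have "spectral_norm (B\<^sup>T * X * B) \<le> spectral_norm (B\<^sup>T * X) * spectral_norm B"
    using B X mk by (intro spectral_norm_mult_le[of _ k k _ k]) auto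
  also have "\<dots> \<le> (spectral_norm B\<^sup>T * spectral_norm X) * spectral_norm B"
    using B X mk by (intro mult_right_mono spectral_norm_mult_le[of _ k k _ k] spectral_norm_nonneg[of _ k k]) auto
  also have "\<dots> \<le> (spectral_norm B * (h + 2 * spectral_norm A * d + d\<^sup>2)) * spectral_norm B"
    using B X mk Xle spectral_norm_transpose_le[OF B(1) mk(2,2)]
    by (intro mult_right_mono mult_mono spectral_norm_nonneg[of _ k k]) auto
  finally show ?thesis unfolding eq by (simp add: power2_eq_square mult_ac)
qed

text \<open>Only Gram matrices are compared, and both are k by k; the numbers of rows may differ, as
  they do for \<open>R\<close> and \<open>A\<close>.\<close>

lemma spectral_norm_square_diff_le:
  assumes M: "M \<in> carrier_mat m k" and N: "N \<in> carrier_mat m' k" and mk: "0 < m" "0 < m'" "0 < k"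
  shows "\<bar>(spectral_norm M)\<^sup>2 - (spectral_norm N)\<^sup>2\<bar> \<le> spectral_norm (M\<^sup>T * M - N\<^sup>T * N)"
proof -
  let ?X = "M\<^sup>T * M" and ?Y = "N\<^sup>T * N"
  have XY: "?X \<in> carrier_mat k k" "?Y \<in> carrier_mat k k" using M N by auto
  have D: "?X - ?Y \<in> carrier_mat k k" using XY(2) by (rule minus_carrier_mat)
  have "?X = ?Y + (?X - ?Y)" "?Y = ?X - (?X - ?Y)" using M N by (auto intro!: eq_matI)
  then have "spectral_norm ?X \<le> spectral_norm ?Y + spectral_norm (?X - ?Y)"
    "spectral_norm ?Y \<le> spectral_norm ?X + spectral_norm (?X - ?Y)"
    using spectral_norm_add_le[OF XY(2) D mk(3)] spectral_norm_diff_le[OF XY(1) D mk(3)] by metis+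
  then show ?thesis
    using spectral_norm_transpose_mult_self[OF M mk(1,3)] spectral_norm_transpose_mult_self[OF N mk(2,3)]
    by (simp add: abs_le_iff)
qed

text \<open>||Rx||^2 differs from ||Ax||^2 by the quadratic form of the Gram residual, so it is at
  least (1 - 3/4) \<sigma>^2 ||x||^2; the root of 1/4 gives the 2.\<close>

lemma spectral_norm_inverse_le:
  assumes A: "A \<in> carrier_mat m k" and R: "R \<in> carrier_mat k k" and B: "B \<in> carrier_mat k k" "R * B = 1\<^sub>m k"
    and mk: "0 < m" "0 < k" and s: "0 < \<sigma>" "\<And>v. v \<in> carrier_vec k \<Longrightarrow> \<sigma> * norm2 v \<le> norm2 (A *\<^sub>v v)"
    and h: "spectral_norm (R\<^sup>T * R - A\<^sup>T * A) \<le> 3 / 4 * \<sigma>\<^sup>2"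
  shows "spectral_norm B \<le> 2 / \<sigma>"
proof (rule spectral_norm_le[OF B(1) mk(2)])
  fix y :: "real vec" assume y: "y \<in> carrier_vec k"
  let ?x = "B *\<^sub>v y"
  have x: "?x \<in> carrier_vec k" using B y by auto
  have Rx: "R *\<^sub>v ?x = y" using assoc_mult_mat_vec[OF R B(1) y] B(2) y by simp
  let ?E = "R\<^sup>T * R - A\<^sup>T * A"
  have E: "?E \<in> carrier_mat k k" using R A by auto
  have "(\<sigma> * norm2 ?x)\<^sup>2 \<le> (norm2 (A *\<^sub>v ?x))\<^sup>2"
    using s x by (intro power_mono) auto
  moreover have "(norm2 y)\<^sup>2 - (norm2 (A *\<^sub>v ?x))\<^sup>2 = ?x \<bullet> (?E *\<^sub>v ?x)"
  proof -
    have "?E *\<^sub>v ?x = R\<^sup>T * R *\<^sub>v ?x - A\<^sup>T * A *\<^sub>v ?x"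
      using R A x by (intro minus_mult_distrib_mat_vec) auto
    then have "?x \<bullet> (?E *\<^sub>v ?x) = ?x \<bullet> (R\<^sup>T * R *\<^sub>v ?x) - ?x \<bullet> (A\<^sup>T * A *\<^sub>v ?x)"
      using R A x by (simp add: scalar_prod_minus_distrib[of _ k])
    then show ?thesis
      using norm2_mult_mat_vec_square[OF R x] norm2_mult_mat_vec_square[OF A x] Rx by simp
  qed
  moreover have "\<bar>?x \<bullet> (?E *\<^sub>v ?x)\<bar> \<le> 3 / 4 * \<sigma>\<^sup>2 * (norm2 ?x)\<^sup>2"
  proof -
    have "\<bar>?x \<bullet> (?E *\<^sub>v ?x)\<bar> \<le> norm2 ?x * norm2 (?E *\<^sub>v ?x)"
      using mult_mat_vec_carrier[OF E x] x by (intro abs_scalar_prod_le) (metis carrier_vecD)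
    also have "\<dots> \<le> norm2 ?x * (spectral_norm ?E * norm2 ?x)"
      by (intro mult_left_mono norm2_mult_mat_vec_le[OF E x]) auto
    also have "\<dots> \<le> norm2 ?x * (3 / 4 * \<sigma>\<^sup>2 * norm2 ?x)"
      using h by (intro mult_left_mono mult_right_mono) auto
    finally show ?thesis by (simp add: power2_eq_square mult_ac)
  qed
  ultimately have "(\<sigma> * norm2 ?x)\<^sup>2 \<le> (2 * norm2 y)\<^sup>2"
    by (simp add: power_mult_distrib abs_le_iff)
  then have "\<sigma> * norm2 ?x \<le> 2 * norm2 y" by (rule power2_le_imp_le) simp
  then show "norm2 ?x \<le> 2 / \<sigma> * norm2 y" using s by (simp add: field_simps)
qed

text \<open>One common remainder \<open>g\<close> makes the predicate monotone, so remainders for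
  different ranges of \<open>e\<close> and different \<open>k\<close> can be merged. The relative
  error mu is eliminated as a quotient minus 1.\<close>

definition cgsp_bounds :: "nat \<Rightarrow> nat \<Rightarrow> real mat \<Rightarrow> real mat \<Rightarrow> real mat \<Rightarrow> real \<Rightarrow> real \<Rightarrow> bool" where
  "cgsp_bounds m k A Q R e g \<longleftrightarrow>
    spectral_norm (Q * R - A) \<le> c1 m k * spectral_norm A * e + g \<and>
    spectral_norm (R\<^sup>T * R - A\<^sup>T * A) \<le> c2 m k * (spectral_norm A)\<^sup>2 * e + g \<and>
    \<bar>spectral_norm R / spectral_norm A - 1\<bar> \<le> c3 m k * e + g \<and>
    spectral_norm (1\<^sub>m k - Q\<^sup>T * Q) \<le> c4 m k * (kappa2 R)\<^sup>2 * e + g \<and>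
    spectral_norm Q \<le> sqrt 2 + g"

lemma cgsp_bounds_mono: "\<lbrakk>cgsp_bounds m k A Q R e g; g \<le> g'\<rbrakk> \<Longrightarrow> cgsp_bounds m k A Q R e g'"
  unfolding cgsp_bounds_def by linarith

lemma c1_nonneg: "0 \<le> c1 m k"
  by (simp add: c1_def)

lemma c2_nonneg: "0 \<le> c2 m k"
proof -
  have "real m * real k \<le> real m * (real k)\<^sup>2"
    by (cases k) (auto intro!: mult_left_mono simp: power2_eq_square)
  moreover have "0 \<le> real m * real k" "0 \<le> real k" by simp_all
  ultimately have "0 \<le> 3.5 * (real m * (real k)\<^sup>2) - 1.5 * (real m * real k) + 16 * real k"
    by linarith
  then show ?thesis unfolding c2_def mult.assoc by simp
qed

lemma c4_nonneg: "0 \<le> c4 m k"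
  using c1_nonneg c2_nonneg by (simp add: c4_def)

text \<open>Linearization of the square root at 1, whence \<open>c3\<close> is half of
  \<open>c2\<close>. For \<tau> <= 1 the factor (1 + \<tau>)^2 is at most 4, so the term -\<tau>^2
  in the square of the lower bound outweighs the rest.\<close>

lemma abs_diff_one_le:
  fixes x \<tau> :: real
  assumes "0 \<le> x" "\<bar>x\<^sup>2 - 1\<bar> \<le> \<tau>" "\<tau> \<le> 1"
  shows "\<bar>x - 1\<bar> \<le> \<tau> / 2 + \<tau>\<^sup>2 / 2"
proof -
  have t: "0 \<le> \<tau>" using assms(2) by linarith
  have "(1 + \<tau> / 2)\<^sup>2 = 1 + \<tau> + \<tau>\<^sup>2 / 4" by (simp add: power2_eq_square field_simps)
  moreover have "0 \<le> \<tau>\<^sup>2 / 4" by simp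
  ultimately have "x\<^sup>2 \<le> (1 + \<tau> / 2)\<^sup>2" using assms(2) by linarith
  then have "x \<le> 1 + \<tau> / 2" by (rule power2_le_imp_le) (use t in simp)
  moreover have "1 - \<tau> / 2 - \<tau>\<^sup>2 / 2 \<le> x"
  proof (rule power2_le_imp_le)
    have "(1 + \<tau>)\<^sup>2 \<le> 2\<^sup>2" using t assms by (intro power_mono) auto
    then have "\<tau>\<^sup>2 / 4 * (1 + \<tau>)\<^sup>2 \<le> \<tau>\<^sup>2 / 4 * 4" by (intro mult_left_mono) auto
    moreover have "(1 - \<tau> / 2 - \<tau>\<^sup>2 / 2)\<^sup>2 = 1 - \<tau> - \<tau>\<^sup>2 + \<tau>\<^sup>2 / 4 * (1 + \<tau>)\<^sup>2"
      by (simp add: power2_eq_square field_simps)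
    ultimately have "(1 - \<tau> / 2 - \<tau>\<^sup>2 / 2)\<^sup>2 \<le> 1 - \<tau>" by simp
    also have "\<dots> \<le> x\<^sup>2" using assms(2) by (simp add: abs_le_iff)
    finally show "(1 - \<tau> / 2 - \<tau>\<^sup>2 / 2)\<^sup>2 \<le> x\<^sup>2" .
  qed (rule assms(1))
  moreover have "0 \<le> \<tau>\<^sup>2" by simp
  ultimately show ?thesis by (simp only: abs_le_iff) linarith
qed

text \<open>The three summands of \<open>G\<close> are the remainders of the Gram residual, of mu,
  and of the loss of orthogonality; the last also serves the norm of \<open>Q\<close>.\<close>

lemma cgsp_bounds_small:
  fixes \<alpha> \<sigma> C e :: real and m k :: nat
  defines "G \<equiv> \<alpha>\<^sup>2 * C + (C / 2 + (c2 m k + C)\<^sup>2 / 2)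
    + (2 / \<sigma>)\<^sup>2 * \<alpha>\<^sup>2 * ((c2 m k + C) * c4 m k + C + (c1 m k)\<^sup>2)"
  assumes A: "A \<in> carrier_mat m k" and Q: "Q \<in> carrier_mat m k" and R: "R \<in> carrier_mat k k"
    and mk: "0 < m" "0 < k" and \<alpha>: "\<alpha> = spectral_norm A" "0 < \<alpha>"
    and inv: "invertible_mat R" and kap: "c4 m k * e * (kappa2 R)\<^sup>2 < 1"
    and s: "0 < \<sigma>" "\<And>v. v \<in> carrier_vec k \<Longrightarrow> \<sigma> * norm2 v \<le> norm2 (A *\<^sub>v v)"
    and d: "spectral_norm (Q * R - A) \<le> c1 m k * \<alpha> * e"
    and h: "spectral_norm (R\<^sup>T * R - A\<^sup>T * A) \<le> \<alpha>\<^sup>2 * (c2 m k * e + C * e\<^sup>2)"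
    and e: "0 < e" "e \<le> 1" and C: "0 \<le> C" and small: "(c2 m k + C) * e \<le> 1"
      "\<alpha>\<^sup>2 * ((c2 m k + C) * e) \<le> 3 / 4 * \<sigma>\<^sup>2"
  shows "cgsp_bounds m k A Q R e (G * e\<^sup>2)"
proof -
  note cs = c1_nonneg[of m k] c2_nonneg[of m k] c4_nonneg[of m k]
  obtain B where B: "B \<in> carrier_mat k k" "R * B = 1\<^sub>m k" "mat_inverse R = Some B"
    using invertible_matE[OF inv R] by metis
  define \<beta> \<rho> \<tau> where "\<beta> = spectral_norm B" and "\<rho> = spectral_norm R" and "\<tau> = c2 m k * e + C * e\<^sup>2"
  have kappa: "kappa2 R = \<rho> * \<beta>" by (simp add: kappa2_def B \<beta>_def \<rho>_def)
  have e2: "e\<^sup>2 \<le> e" using e by (simp add: power2_eq_square mult_left_le)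
  have "C * e\<^sup>2 \<le> C * e" using e2 C by (rule mult_left_mono)
  then have \<tau>: "0 \<le> \<tau>" "\<tau> \<le> (c2 m k + C) * e" using cs C e by (auto simp: \<tau>_def distrib_right)
  have "\<alpha>\<^sup>2 * \<tau> \<le> \<alpha>\<^sup>2 * ((c2 m k + C) * e)" using \<tau> by (intro mult_left_mono) auto
  then have "spectral_norm (R\<^sup>T * R - A\<^sup>T * A) \<le> 3 / 4 * \<sigma>\<^sup>2" using h small by (simp add: \<tau>_def)
  then have \<beta>: "\<beta> \<le> 2 / \<sigma>" "0 \<le> \<beta>"
    using spectral_norm_inverse_le[OF A R B(1,2) mk s] spectral_norm_nonneg[OF B(1) mk(2)] by (auto simp: \<beta>_def)
  define G4 where "G4 = (2 / \<sigma>)\<^sup>2 * \<alpha>\<^sup>2 * ((c2 m k + C) * c4 m k + C + (c1 m k)\<^sup>2)"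
  have G: "G = \<alpha>\<^sup>2 * C + (C / 2 + (c2 m k + C)\<^sup>2 / 2) + G4" by (simp add: G_def G4_def)
  have G0: "0 \<le> \<alpha>\<^sup>2 * C" "0 \<le> C / 2 + (c2 m k + C)\<^sup>2 / 2" "0 \<le> G4"
    using cs C by (auto simp: G4_def)
  have Ge: "\<alpha>\<^sup>2 * C * e\<^sup>2 \<le> G * e\<^sup>2" "(C / 2 + (c2 m k + C)\<^sup>2 / 2) * e\<^sup>2 \<le> G * e\<^sup>2" "G4 * e\<^sup>2 \<le> G * e\<^sup>2"
    "0 \<le> G * e\<^sup>2"
    using G0 unfolding G by (auto intro!: mult_right_mono)
  have R2: "\<bar>\<rho>\<^sup>2 - \<alpha>\<^sup>2\<bar> \<le> \<alpha>\<^sup>2 * \<tau>"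
    using spectral_norm_square_diff_le[OF R A mk(2,1,2)] h by (simp add: \<rho>_def \<alpha> \<tau>_def)
  have \<rho>0: "0 \<le> \<rho>" using spectral_norm_nonneg[OF R mk(2)] by (simp add: \<rho>_def)
  have "\<bar>(\<rho> / \<alpha>)\<^sup>2 - 1\<bar> = \<bar>\<rho>\<^sup>2 - \<alpha>\<^sup>2\<bar> / \<alpha>\<^sup>2"
  proof -
    have "(\<rho> / \<alpha>)\<^sup>2 - 1 = (\<rho>\<^sup>2 - \<alpha>\<^sup>2) / \<alpha>\<^sup>2"
      using \<alpha>(2) by (simp add: power_divide diff_divide_distrib)
    then show ?thesis by (simp add: abs_divide)
  qed
  also have "\<dots> \<le> \<tau>" using R2 \<alpha> by (simp add: divide_le_eq mult.commute)
  finally have "\<bar>\<rho> / \<alpha> - 1\<bar> \<le> \<tau> / 2 + \<tau>\<^sup>2 / 2"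
    using \<rho>0 \<alpha> \<tau> small by (intro abs_diff_one_le) auto
  also have "\<tau>\<^sup>2 \<le> ((c2 m k + C) * e)\<^sup>2" using \<tau> by (intro power_mono)
  also have "\<dots> = (c2 m k + C)\<^sup>2 * e\<^sup>2" by (rule power_mult_distrib)
  finally have mu: "\<bar>\<rho> / \<alpha> - 1\<bar> \<le> c3 m k * e + (C / 2 + (c2 m k + C)\<^sup>2 / 2) * e\<^sup>2"
    by (simp add: \<tau>_def c3_def field_simps)
  have "spectral_norm (1\<^sub>m k - Q\<^sup>T * Q)
    \<le> \<beta>\<^sup>2 * (\<alpha>\<^sup>2 * \<tau> + 2 * \<alpha> * (c1 m k * \<alpha> * e) + (c1 m k * \<alpha> * e)\<^sup>2)"
    using orthogonality_loss_le[OF A Q R B(1,2) mk d h] by (simp add: \<beta>_def \<alpha> \<tau>_def)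
  also have "\<dots> = \<beta>\<^sup>2 * \<alpha>\<^sup>2 * (c4 m k * e) + \<beta>\<^sup>2 * (\<alpha>\<^sup>2 * ((C + (c1 m k)\<^sup>2) * e\<^sup>2))"
    by (simp add: \<tau>_def c4_def power2_eq_square algebra_simps)
  \<comment> \<open>Trades ||A||^2 for ||R||^2 at second-order cost, so that the product with
    \<beta>^2 becomes the square of \<open>kappa2 R\<close>.\<close>
  also have "\<beta>\<^sup>2 * \<alpha>\<^sup>2 * (c4 m k * e) \<le> \<beta>\<^sup>2 * (\<rho>\<^sup>2 + \<alpha>\<^sup>2 * ((c2 m k + C) * e)) * (c4 m k * e)"
  proof -
    have "\<alpha>\<^sup>2 \<le> \<rho>\<^sup>2 + \<alpha>\<^sup>2 * \<tau>" using R2 by (simp add: abs_le_iff)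
    also have "\<dots> \<le> \<rho>\<^sup>2 + \<alpha>\<^sup>2 * ((c2 m k + C) * e)" using \<tau> by (intro add_left_mono mult_left_mono) auto
    finally show ?thesis using cs e by (intro mult_right_mono mult_left_mono) auto
  qed
  also have "\<dots> = c4 m k * (kappa2 R)\<^sup>2 * e + \<beta>\<^sup>2 * (\<alpha>\<^sup>2 * ((c2 m k + C) * c4 m k * e\<^sup>2))"
    by (simp add: kappa power2_eq_square algebra_simps)
  finally have "spectral_norm (1\<^sub>m k - Q\<^sup>T * Q)
    \<le> c4 m k * (kappa2 R)\<^sup>2 * e + \<beta>\<^sup>2 * (\<alpha>\<^sup>2 * (((c2 m k + C) * c4 m k + C + (c1 m k)\<^sup>2) * e\<^sup>2))"
    by (simp add: algebra_simps)
  also have "\<beta>\<^sup>2 * (\<alpha>\<^sup>2 * (((c2 m k + C) * c4 m k + C + (c1 m k)\<^sup>2) * e\<^sup>2))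
    \<le> (2 / \<sigma>)\<^sup>2 * (\<alpha>\<^sup>2 * (((c2 m k + C) * c4 m k + C + (c1 m k)\<^sup>2) * e\<^sup>2))"
    using \<beta> cs C by (intro mult_right_mono power_mono) auto
  also have "\<dots> = G4 * e\<^sup>2" by (simp add: G4_def mult_ac)
  finally have orth: "spectral_norm (1\<^sub>m k - Q\<^sup>T * Q) \<le> c4 m k * (kappa2 R)\<^sup>2 * e + G4 * e\<^sup>2" by simp
  have "spectral_norm Q \<le> sqrt 2 + G4 * e\<^sup>2"
  proof (rule power2_le_imp_le)
    have QQ: "Q\<^sup>T * Q \<in> carrier_mat k k" using Q by auto
    have "Q\<^sup>T * Q = 1\<^sub>m k - (1\<^sub>m k - Q\<^sup>T * Q)" using Q by (auto intro!: eq_matI)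
    then have "spectral_norm (Q\<^sup>T * Q) \<le> 1 + spectral_norm (1\<^sub>m k - Q\<^sup>T * Q)"
      using spectral_norm_diff_le[of "1\<^sub>m k" k k "1\<^sub>m k - Q\<^sup>T * Q"] minus_carrier_mat[OF QQ, of "1\<^sub>m k"] mk(2)
      by (metis one_carrier_mat spectral_norm_one)
    then have "(spectral_norm Q)\<^sup>2 \<le> 1 + spectral_norm (1\<^sub>m k - Q\<^sup>T * Q)"
      using spectral_norm_square_le[OF Q mk(2)] by linarith
    also have "\<dots> \<le> 2 + G4 * e\<^sup>2" using orth kap by (simp add: mult_ac)
    \<comment> \<open>Enlarges the remainder so that the right-hand side is a complete
      square.\<close>
    also have "\<dots> \<le> 2 + 2 * sqrt 2 * (G4 * e\<^sup>2) + (G4 * e\<^sup>2)\<^sup>2"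
    proof -
      have "1 \<le> sqrt (2::real)" by simp
      then have "1 \<le> 2 * sqrt (2::real)" by linarith
      then have "1 * (G4 * e\<^sup>2) \<le> 2 * sqrt 2 * (G4 * e\<^sup>2)" using G0 by (intro mult_right_mono) auto
      then show ?thesis using zero_le_power2[of "G4 * e\<^sup>2"] by linarith
    qed
    also have "\<dots> = (sqrt 2 + G4 * e\<^sup>2)\<^sup>2" by (simp add: power2_sum)
    finally show "(spectral_norm Q)\<^sup>2 \<le> (sqrt 2 + G4 * e\<^sup>2)\<^sup>2" .
  qed (use G0 in simp)
  with orth mu d h Ge show ?thesis
    unfolding cgsp_bounds_def \<alpha>(1)[symmetric] \<rho>_def[symmetric]
    by (simp add: algebra_simps)
qed

section \<open>Small machine units\<close>

text \<open>Needed for k = 1, where m + 2 already is the exact first-order coefficient. The crude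
  4^N closes the induction: N e^2, 4^N e^2 and 4^N e^3 are each at most 4^N e^2.\<close>

lemma one_plus_power_le:
  fixes e :: real
  assumes "0 \<le> e" "e \<le> 1"
  shows "(1 + e) ^ N \<le> 1 + real N * e + 4 ^ N * e\<^sup>2"
proof (induction N)
  case (Suc N)
  have "real N \<le> 2 ^ N" by (rule less_imp_le[OF of_nat_less_two_power])
  also have "(2::real) ^ N \<le> 4 ^ N" by (rule power_mono) auto
  finally have N: "real N * e\<^sup>2 \<le> 4 ^ N * e\<^sup>2" by (intro mult_right_mono) auto
  have "e\<^sup>2 * e \<le> e\<^sup>2 * 1" using assms by (intro mult_left_mono) auto
  then have 3: "4 ^ N * (e\<^sup>2 * e) \<le> 4 ^ N * e\<^sup>2" by (intro mult_left_mono) auto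
  have "(1 + e) ^ Suc N \<le> (1 + real N * e + 4 ^ N * e\<^sup>2) * (1 + e)"
    using Suc assms by (simp add: mult.commute mult_left_mono)
  also have "\<dots> = 1 + real (Suc N) * e + real N * e\<^sup>2 + 4 ^ N * e\<^sup>2 + 4 ^ N * (e\<^sup>2 * e)"
    by (simp add: algebra_simps power2_eq_square)
  also have "\<dots> \<le> 1 + real (Suc N) * e + 4 * (4 ^ N * e\<^sup>2)"
  proof -
    have "0 \<le> 4 ^ N * e\<^sup>2" by simp
    with N 3 show ?thesis by linarith
  qed
  also have "\<dots> = 1 + real (Suc N) * e + 4 ^ Suc N * e\<^sup>2" by simp
  finally show ?case .
qed simp

section \<open>Leading columns of a full-rank matrix and their runs\<close>

locale cgsp_input =
  fixes m n :: nat and A :: "real mat"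
  assumes n1: "1 \<le> n" and nm: "n \<le> m" and A: "A \<in> carrier_mat m n" and rank: "vec_space.rank m A = n"
begin

lemma leading_cols_carrier: "leading_cols k A \<in> carrier_mat m k"
  using A by (auto simp: leading_cols_def)

lemma leading_cols_index: "\<lbrakk>l < m; j < k\<rbrakk> \<Longrightarrow> leading_cols k A $$ (l, j) = A $$ (l, j)"
  using A by (simp add: leading_cols_def)

lemma A_independent:
  assumes "\<forall>l<m. (\<Sum>p<n. A $$ (l, p) * x p) = 0"
  shows "\<forall>p<n. x p = 0"
proof -
  have "A *\<^sub>v vec n x = 0\<^sub>v m"
    using A assms by (intro eq_vecI) (auto simp: scalar_prod_def atLeast0LessThan)
  then have "vec n x = 0\<^sub>v n"
    using vec_space.full_rank_injective[OF A rank] by simp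
  then show ?thesis by (metis index_vec index_zero_vec(1))
qed

text \<open>Padding \<open>v\<close> with zeros gives a kernel vector of the full matrix.\<close>

lemma leading_cols_injective:
  assumes k: "k \<le> n" and v: "v \<in> carrier_vec k" "leading_cols k A *\<^sub>v v = 0\<^sub>v m"
  shows "v = 0\<^sub>v k"
proof -
  have "\<forall>p<n. (if p < k then v $ p else 0) = 0"
  proof (rule A_independent, intro allI impI)
    fix l assume l: "l < m"
    have "(\<Sum>p<n. A $$ (l, p) * (if p < k then v $ p else 0)) = (\<Sum>p<k. A $$ (l, p) * v $ p)"
      using k by (intro sum.mono_neutral_cong_right) auto
    also have "\<dots> = (leading_cols k A *\<^sub>v v) $ l"
      using l v(1) leading_cols_carrier[of k] leading_cols_index[of l _ k]
      by (simp add: scalar_prod_def atLeast0LessThan)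
    finally show "(\<Sum>p<n. A $$ (l, p) * (if p < k then v $ p else 0)) = 0" using v l by simp
  qed
  then have "v $ p = 0" if "p < k" for p using k that by (metis less_le_trans)
  then show ?thesis using v(1) by (intro eq_vecI) auto
qed

lemma leading_cols_bounded_below:
  assumes "1 \<le> k" "k \<le> n"
  shows "\<exists>\<sigma>>0. \<forall>v\<in>carrier_vec k. \<sigma> * norm2 v \<le> norm2 (leading_cols k A *\<^sub>v v)"
  using assms nm leading_cols_injective
  by (intro injective_bounded_below[OF leading_cols_carrier]) auto

lemma leading_cols_norm_pos:
  assumes k: "1 \<le> k" "k \<le> n"
  shows "0 < spectral_norm (leading_cols k A)"
proof -
  obtain \<sigma> where s: "0 < \<sigma>" "\<forall>v\<in>carrier_vec k. \<sigma> * norm2 v \<le> norm2 (leading_cols k A *\<^sub>v v)"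
    using leading_cols_bounded_below[OF k] by blast
  have u: "norm2 (unit_vec k 0) = 1" using k by (simp add: norm2_def)
  have "\<sigma> \<le> norm2 (leading_cols k A *\<^sub>v unit_vec k 0)"
    using s(2) u by (metis mult.right_neutral unit_vec_carrier)
  also have "\<dots> \<le> spectral_norm (leading_cols k A)"
    using norm2_mult_mat_vec_le[OF leading_cols_carrier unit_vec_carrier, of k 0] u by simp
  finally show ?thesis using s(1) by linarith
qed

lemma column_square_le:
  assumes "p < k"
  shows "(\<Sum>l<m. (A $$ (l, p))\<^sup>2) \<le> (spectral_norm (leading_cols k A))\<^sup>2"
proof -
  have "(\<Sum>l<m. (A $$ (l, p))\<^sup>2) = (norm2 (col (leading_cols k A) p))\<^sup>2"
    unfolding norm2_square using assms leading_cols_carrier[of k] leading_cols_index[of _ p k]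
    by (simp add: scalar_prod_def power2_eq_square atLeast0LessThan)
  also have "\<dots> \<le> (spectral_norm (leading_cols k A))\<^sup>2"
    by (intro power_mono norm2_col_le[OF leading_cols_carrier assms]) auto
  finally show ?thesis .
qed

lemma run_facts:
  assumes run: "cgsp_run e A R Q" and e: "0 < e" "e < 1" and k: "1 \<le> k" "k \<le> n"
  shows run_R: "R k \<in> carrier_mat k k" and run_Q: "Q k \<in> carrier_mat m k"
    and run_R_lower: "\<And>i j. \<lbrakk>i < k; j < i\<rbrakk> \<Longrightarrow> R k $$ (i, j) = 0"
    and run_column: "\<And>j. j < k \<Longrightarrow>
      gs_column e m (\<lambda>l j. A $$ (l, j)) (\<lambda>l j. Q k $$ (l, j)) (\<lambda>i j. R k $$ (i, j)) j"
    and run_R_eq: "\<And>i j. \<lbrakk>i < k; j < k\<rbrakk> \<Longrightarrow> R k $$ (i, j) = R n $$ (i, j)"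
    and run_Q_eq: "\<And>l j. \<lbrakk>l < m; j < k\<rbrakk> \<Longrightarrow> Q k $$ (l, j) = Q n $$ (l, j)"
  using cgsp_run_columns[OF run A e k] cgsp_run_nested[OF run A e k(1,2) order_refl] by auto

lemma factor_error_index:
  assumes run: "cgsp_run e A R Q" and e: "0 < e" "e < 1" and k: "1 \<le> k" "k \<le> n"
    and lj: "l < m" "j < k"
  shows "(Q k * R k - leading_cols k A) $$ (l, j)
    = (\<Sum>i\<le>j. Q n $$ (l, i) * R n $$ (i, j)) - A $$ (l, j)"
proof -
  note f = run_facts[OF run e k]
  have "(Q k * R k - leading_cols k A) $$ (l, j) = (\<Sum>i<k. Q k $$ (l, i) * R k $$ (i, j)) - A $$ (l, j)"
    using f(1,2) lj leading_cols_carrier[of k] leading_cols_index[of l j k]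
    by (simp add: scalar_prod_def atLeast0LessThan)
  also have "(\<Sum>i<k. Q k $$ (l, i) * R k $$ (i, j)) = (\<Sum>i\<le>j. Q n $$ (l, i) * R n $$ (i, j))"
    using lj f(3,5,6) by (intro sum.mono_neutral_cong_right) auto
  finally show ?thesis .
qed

text \<open>Triangularity cuts the inner product of two columns of \<open>R\<close> at the smaller
  index, and symmetry reduces everything to i <= j.\<close>

lemma gram_error_index:
  assumes run: "cgsp_run e A R Q" and e: "0 < e" "e < 1" and k: "1 \<le> k" "k \<le> n"
    and ij: "i \<le> j" "j < k"
  shows "((R k)\<^sup>T * R k - (leading_cols k A)\<^sup>T * leading_cols k A) $$ (i, j)
      = (\<Sum>p\<le>i. R n $$ (p, i) * R n $$ (p, j)) - (\<Sum>l<m. A $$ (l, i) * A $$ (l, j))" (is "?E $$ _ = ?x")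
    and "((R k)\<^sup>T * R k - (leading_cols k A)\<^sup>T * leading_cols k A) $$ (j, i)
      = (\<Sum>p\<le>i. R n $$ (p, i) * R n $$ (p, j)) - (\<Sum>l<m. A $$ (l, i) * A $$ (l, j))"
proof -
  note f = run_facts[OF run e k]
  have "?E $$ (i, j) = (\<Sum>p<k. R k $$ (p, i) * R k $$ (p, j)) - (\<Sum>l<m. A $$ (l, i) * A $$ (l, j))"
    using f(1,2) ij leading_cols_carrier[of k] leading_cols_index[of _ i k] leading_cols_index[of _ j k]
    by (simp add: scalar_prod_def atLeast0LessThan)
  also have "(\<Sum>p<k. R k $$ (p, i) * R k $$ (p, j)) = (\<Sum>p\<le>i. R n $$ (p, i) * R n $$ (p, j))"
    using ij f(3,5) by (intro sum.mono_neutral_cong_right) auto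
  finally show "?E $$ (i, j) = ?x" .
  moreover have "?E $$ (j, i) = ?E $$ (i, j)"
    using f(1) ij leading_cols_carrier[of k] by (simp add: scalar_prod_def mult.commute)
  ultimately show "?E $$ (j, i) = ?x" by simp
qed

section \<open>The filter of runs with vanishing machine unit\<close>

definition runs :: "(real \<times> (nat \<Rightarrow> real mat) \<times> (nat \<Rightarrow> real mat)) set" where
  "runs = {(e, R, Q). 0 < e \<and> e < 1 \<and> cgsp_run e A R Q}"

text \<open>Limits along this filter are limits for \<open>e\<close> tending to 0, uniform over all runs with machine unit \<open>e\<close>.\<close>

definition small_unit :: "(real \<times> (nat \<Rightarrow> real mat) \<times> (nat \<Rightarrow> real mat)) filter" where
  "small_unit = inf (filtercomap fst (at_right 0)) (principal runs)"

text \<open>One threshold \<open>e0\<close> serves all runs at once: this is the required uniformity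
  in the rounding errors.\<close>

lemma small_unit_eventually:
  "eventually P small_unit \<longleftrightarrow> (\<exists>e0>0. \<forall>w\<in>runs. fst w < e0 \<longrightarrow> P w)"
proof
  assume "eventually P small_unit"
  then obtain S where S: "eventually S (at_right 0)" "\<And>w. S (fst w) \<Longrightarrow> w \<in> runs \<Longrightarrow> P w"
    unfolding small_unit_def eventually_inf_principal eventually_filtercomap by blast
  then obtain e0 where "0 < e0" "\<And>e. \<lbrakk>0 < e; e < e0\<rbrakk> \<Longrightarrow> S e"
    unfolding eventually_at_right_field by blast
  then show "\<exists>e0>0. \<forall>w\<in>runs. fst w < e0 \<longrightarrow> P w"
    using S(2) by (intro exI[of _ e0]) (auto simp: runs_def)
next
  assume "\<exists>e0>0. \<forall>w\<in>runs. fst w < e0 \<longrightarrow> P w"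
  then obtain e0 where e0: "0 < e0" "\<And>w. w \<in> runs \<Longrightarrow> fst w < e0 \<Longrightarrow> P w" by blast
  then have "eventually (\<lambda>e. 0 < e \<and> e < e0) (at_right 0)"
    unfolding eventually_at_right_field by blast
  then show "eventually P small_unit"
    unfolding small_unit_def eventually_inf_principal eventually_filtercomap using e0(2)
    by (intro exI[of _ "\<lambda>e. 0 < e \<and> e < e0"]) auto
qed

sublocale gs_limit m n "\<lambda>l j. A $$ (l, j)" small_unit fst
  "\<lambda>w l j. snd (snd w) n $$ (l, j)" "\<lambda>w i j. fst (snd w) n $$ (i, j)"
proof
  show "\<forall>p<n. x p = 0" if "\<forall>l<m. (\<Sum>p<n. A $$ (l, p) * x p) = 0" for x
    using A_independent that by blast
  show "(fst \<longlongrightarrow> 0) small_unit"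
    unfolding small_unit_def
    by (rule tendsto_mono[OF inf_le1], rule filterlim_mono[OF filterlim_filtercomap _ order_refl])
      (simp add: at_within_def)
  show "\<forall>\<^sub>F w in small_unit. 0 < fst w"
    unfolding small_unit_eventually by (intro exI[of _ 1]) (auto simp: runs_def)
  show "\<forall>\<^sub>F w in small_unit. gs_column (fst w) m (\<lambda>l j. A $$ (l, j))
    (\<lambda>l j. snd (snd w) n $$ (l, j)) (\<lambda>i j. fst (snd w) n $$ (i, j)) j" if "j < n" for j
    unfolding small_unit_eventually using that n1
    by (intro exI[of _ 1]) (auto simp: runs_def intro: run_column)
qed

lemma residuals_small:
  assumes k: "1 \<le> k" "k \<le> n"
  shows "\<forall>\<^sub>F (e, R, Q) in small_unit.
    spectral_norm (Q k * R k - leading_cols k A) \<le> c1 m k * spectral_norm (leading_cols k A) * e \<and>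
    spectral_norm ((R k)\<^sup>T * R k - (leading_cols k A)\<^sup>T * leading_cols k A)
      \<le> (spectral_norm (leading_cols k A))\<^sup>2 * (c2 m k * e + 4 ^ (m + 2) * e\<^sup>2)"
proof -
  let ?\<alpha> = "spectral_norm (leading_cols k A)"
  have \<alpha>: "0 < ?\<alpha>" by (rule leading_cols_norm_pos[OF k])
  have le: "spectral_norm (Q k * R k - leading_cols k A)
      \<le> sqrt (\<Sum>l<m. \<Sum>j<k. ((\<Sum>i\<le>j. Q n $$ (l, i) * R n $$ (i, j)) - A $$ (l, j))\<^sup>2)"
    if w: "(e, R, Q) \<in> runs" for e R Q
  proof -
    have run: "cgsp_run e A R Q" "0 < e" "e < 1" using w by (auto simp: runs_def)
    note f = run_facts[OF run k]
    have c: "Q k * R k - leading_cols k A \<in> carrier_mat m k"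
      using leading_cols_carrier by (rule minus_carrier_mat)
    have "spectral_norm (Q k * R k - leading_cols k A) \<le> frobenius (Q k * R k - leading_cols k A)"
      using k by (intro spectral_norm_le_frobenius[OF c]) auto
    also have "\<dots> = sqrt (\<Sum>l<m. \<Sum>j<k. ((Q k * R k - leading_cols k A) $$ (l, j))\<^sup>2)"
      unfolding frobenius_def carrier_matD[OF c] ..
    also have "\<dots> = sqrt (\<Sum>l<m. \<Sum>j<k. ((\<Sum>i\<le>j. Q n $$ (l, i) * R n $$ (i, j)) - A $$ (l, j))\<^sup>2)"
      using factor_error_index[OF run k] by simp
    finally show ?thesis .
  qed
  have gram: "spectral_norm ((R k)\<^sup>T * R k - (leading_cols k A)\<^sup>T * leading_cols k A) \<le> real k * c"
    if w: "(e, R, Q) \<in> runs" and c: "0 \<le> c" "\<And>i j. \<lbrakk>i \<le> j; j < k\<rbrakk> \<Longrightarrow>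
      \<bar>(\<Sum>p\<le>i. R n $$ (p, i) * R n $$ (p, j)) - (\<Sum>l<m. A $$ (l, i) * A $$ (l, j))\<bar> \<le> c" for e R Q c
  proof -
    have run: "cgsp_run e A R Q" "0 < e" "e < 1" using w by (auto simp: runs_def)
    let ?E = "(R k)\<^sup>T * R k - (leading_cols k A)\<^sup>T * leading_cols k A"
    have E: "?E \<in> carrier_mat k k"
      using leading_cols_carrier[of k] by (intro minus_carrier_mat) auto
    have "\<bar>?E $$ (i, j)\<bar> \<le> c" if "i < k" "j < k" for i j
      using gram_error_index[OF run k] c(2) that by (cases "i \<le> j") (auto simp: not_le)
    then have "frobenius ?E \<le> sqrt (real k * real k) * c"
      using c by (intro frobenius_le_max[OF E])
    then show ?thesis using spectral_norm_le_frobenius[OF E] k by simp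
  qed
  have runs: "\<forall>\<^sub>F w in small_unit. w \<in> runs"
    unfolding small_unit_eventually by (auto intro: exI[of _ 1])
  show ?thesis
  proof (cases "k = 1")
    \<comment> \<open>The constants 1 and m + 2 are attained to first order here, so the limit
      argument has no slack; the binomial expansion supplies the term 4^(m + 2) e^2.\<close>
    case True
    show ?thesis
      using runs
    proof eventually_elim
      case (elim w)
      obtain e R Q where w: "w = (e, R, Q)" by (cases w)
      then have run: "cgsp_run e A R Q" "0 < e" "e < 1" using elim by (auto simp: runs_def)
      let ?S = "\<Sum>l<m. (A $$ (l, 0))\<^sup>2"
      have S: "?S \<le> ?\<alpha>\<^sup>2" "0 \<le> ?S" using column_square_le[of 0 k] k by (auto intro: sum_nonneg)
      have col: "\<bar>(R n $$ (0, 0))\<^sup>2 - ?S\<bar> \<le> ((1 + e) ^ (m + 2) - 1) * ?S"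
        "\<And>l. l < m \<Longrightarrow> \<bar>Q n $$ (l, 0) * R n $$ (0, 0) - A $$ (l, 0)\<bar> \<le> e * \<bar>A $$ (l, 0)\<bar>"
        using run_column[OF run n1 order_refl, of 0] n1 by (auto simp: gs_column_def)
      have "(\<Sum>l<m. (Q n $$ (l, 0) * R n $$ (0, 0) - A $$ (l, 0))\<^sup>2) \<le> (\<Sum>l<m. (e * A $$ (l, 0))\<^sup>2)"
        using col(2) run by (intro sum_mono) (simp add: abs_le_square_iff[symmetric] abs_mult)
      also have "\<dots> = e\<^sup>2 * ?S" by (simp add: power_mult_distrib sum_distrib_left)
      also have "\<dots> \<le> e\<^sup>2 * ?\<alpha>\<^sup>2" using S by (intro mult_left_mono) auto
      finally have "sqrt (\<Sum>l<m. (Q n $$ (l, 0) * R n $$ (0, 0) - A $$ (l, 0))\<^sup>2) \<le> sqrt ((e * ?\<alpha>)\<^sup>2)"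
        by (simp add: power_mult_distrib)
      then have 1: "spectral_norm (Q k * R k - leading_cols k A) \<le> ?\<alpha> * e"
        using le[of e R Q] elim w \<alpha> run True by (simp add: mult.commute)
      have "((1 + e) ^ (m + 2) - 1) * ?S \<le> (real (m + 2) * e + 4 ^ (m + 2) * e\<^sup>2) * ?\<alpha>\<^sup>2"
        using one_plus_power_le[of e "m + 2"] run S by (intro mult_mono) auto
      then have "\<bar>(R n $$ (0, 0))\<^sup>2 - ?S\<bar> \<le> ?\<alpha>\<^sup>2 * (real (m + 2) * e + 4 ^ (m + 2) * e\<^sup>2)"
        using col(1) by (simp add: mult.commute)
      moreover have "0 \<le> ?\<alpha>\<^sup>2 * (real (m + 2) * e + 4 ^ (m + 2) * e\<^sup>2)" using run by simp
      ultimately have "spectral_norm ((R k)\<^sup>T * R k - (leading_cols k A)\<^sup>T * leading_cols k A)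
        \<le> real k * (?\<alpha>\<^sup>2 * (real (m + 2) * e + 4 ^ (m + 2) * e\<^sup>2))"
        using elim w True by (intro gram) (auto simp: power2_eq_square)
      with 1 True show ?case unfolding w by (simp add: c1_def c2_def add.commute)
    qed
  next
    case False
    then have k2: "2 \<le> k" "k \<le> m" using k nm by auto
    have "\<forall>\<^sub>F w in small_unit. (\<Sum>l<m. \<Sum>j<k. ((\<Sum>i\<le>j. snd (snd w) n $$ (l, i) * fst (snd w) n $$ (i, j))
        - A $$ (l, j))\<^sup>2) \<le> (c1 m k * ?\<alpha> * fst w)\<^sup>2"
      using k2 k(2) \<alpha> column_square_le by (intro factor_error_eventually)
    moreover have "\<forall>\<^sub>F w in small_unit. \<forall>i<k. \<forall>j<k. i \<le> j \<longrightarrow>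
      \<bar>(\<Sum>p\<le>i. fst (snd w) n $$ (p, i) * fst (snd w) n $$ (p, j)) - (\<Sum>l<m. A $$ (l, i) * A $$ (l, j))\<bar>
        \<le> fst w * (c2 m k / real k * ?\<alpha>\<^sup>2)"
      using k2 k(2) \<alpha> column_square_le by (intro gram_error_eventually)
    ultimately show ?thesis
      using runs
    proof eventually_elim
      case (elim w)
      obtain e R Q where w: "w = (e, R, Q)" by (cases w)
      then have run: "cgsp_run e A R Q" "0 < e" "e < 1" using elim by (auto simp: runs_def)
      have "sqrt (\<Sum>l<m. \<Sum>j<k. ((\<Sum>i\<le>j. Q n $$ (l, i) * R n $$ (i, j)) - A $$ (l, j))\<^sup>2)
        \<le> sqrt ((c1 m k * ?\<alpha> * e)\<^sup>2)"
        using elim(1) w by (intro real_sqrt_le_mono) simp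
      also have "\<dots> = c1 m k * ?\<alpha> * e" using \<alpha> run c1_nonneg[of m k] by simp
      finally have 1: "spectral_norm (Q k * R k - leading_cols k A) \<le> c1 m k * ?\<alpha> * e"
        using le[of e R Q] elim w by simp
      have "spectral_norm ((R k)\<^sup>T * R k - (leading_cols k A)\<^sup>T * leading_cols k A)
        \<le> real k * (e * (c2 m k / real k * ?\<alpha>\<^sup>2))"
        using elim w run c2_nonneg[of m k] by (intro gram) auto
      also have "\<dots> = ?\<alpha>\<^sup>2 * (c2 m k * e)" using k by simp
      also have "\<dots> \<le> ?\<alpha>\<^sup>2 * (c2 m k * e + 4 ^ (m + 2) * e\<^sup>2)" by (intro mult_left_mono) auto
      finally show ?case using 1 unfolding w by simp
    qed
  qed
qed

lemma bounds_small:
  assumes k: "1 \<le> k" "k \<le> n"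
  shows "\<exists>G e0. 0 < e0 \<and> (\<forall>e R Q. 0 < e \<longrightarrow> e < e0 \<longrightarrow> cgsp_run e A R Q \<longrightarrow>
    invertible_mat (R k) \<longrightarrow> c4 m k * e * (kappa2 (R k))\<^sup>2 < 1 \<longrightarrow>
    cgsp_bounds m k (leading_cols k A) (Q k) (R k) e (G * e\<^sup>2))"
proof -
  let ?\<alpha> = "spectral_norm (leading_cols k A)" and ?C = "4 ^ (m + 2) :: real"
  obtain \<sigma> where s: "0 < \<sigma>" "\<forall>v\<in>carrier_vec k. \<sigma> * norm2 v \<le> norm2 (leading_cols k A *\<^sub>v v)"
    using leading_cols_bounded_below[OF k] by blast
  obtain e1 where e1: "0 < e1" "\<And>e R Q. (e, R, Q) \<in> runs \<Longrightarrow> e < e1 \<Longrightarrow>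
    spectral_norm (Q k * R k - leading_cols k A) \<le> c1 m k * ?\<alpha> * e \<and>
    spectral_norm ((R k)\<^sup>T * R k - (leading_cols k A)\<^sup>T * leading_cols k A) \<le> ?\<alpha>\<^sup>2 * (c2 m k * e + ?C * e\<^sup>2)"
    using residuals_small[OF k] unfolding small_unit_eventually by fastforce
  have \<alpha>: "0 < ?\<alpha>" by (rule leading_cols_norm_pos[OF k])
  define K where "K = c2 m k + ?C"
  have K: "0 < K" using c2_nonneg[of m k] by (simp add: K_def add_nonneg_pos)
  \<comment> \<open>The bound 1 keeps rounding factors positive, \<open>e1\<close> gives the
    residual bounds, and the other two are the smallness conditions of
    \<open>cgsp_bounds_small\<close>.\<close>
  define e0 where "e0 = min (min 1 e1) (min (1 / K) (3 / 4 * \<sigma>\<^sup>2 / (?\<alpha>\<^sup>2 * K)))"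
  have e0: "0 < e0" using e1 K s \<alpha> by (simp add: e0_def)
  have small: "K * e \<le> 1" "?\<alpha>\<^sup>2 * (K * e) \<le> 3 / 4 * \<sigma>\<^sup>2" if "e < e0" for e
  proof -
    have "e \<le> 1 / K" "e \<le> 3 / 4 * \<sigma>\<^sup>2 / (?\<alpha>\<^sup>2 * K)" using that by (simp_all add: e0_def)
    then show "K * e \<le> 1" "?\<alpha>\<^sup>2 * (K * e) \<le> 3 / 4 * \<sigma>\<^sup>2"
      using K \<alpha> by (simp_all add: pos_le_divide_eq mult_ac)
  qed
  show ?thesis
  proof (intro exI conjI allI impI)
    show "0 < e0" by (rule e0)
    fix e R Q
    assume *: "0 < e" "e < e0" "cgsp_run e A R Q" "invertible_mat (R k)" "c4 m k * e * (kappa2 (R k))\<^sup>2 < 1"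
    then have e: "e < 1" "e < e1" by (auto simp: e0_def)
    have "(e, R, Q) \<in> runs" using * e by (simp add: runs_def)
    from e1(2)[OF this e(2)] show "cgsp_bounds m k (leading_cols k A) (Q k) (R k) e
      ((?\<alpha>\<^sup>2 * ?C + (?C / 2 + (c2 m k + ?C)\<^sup>2 / 2)
        + (2 / \<sigma>)\<^sup>2 * ?\<alpha>\<^sup>2 * ((c2 m k + ?C) * c4 m k + ?C + (c1 m k)\<^sup>2)) * e\<^sup>2)"
      using * e s \<alpha> k nm small[OF *(2)] leading_cols_carrier run_R[OF *(3,1) e(1) k] run_Q[OF *(3,1) e(1) k]
      by (intro cgsp_bounds_small) (auto simp: K_def)
  qed
qed

end

section \<open>Machine units bounded away from zero\<close>

lemma c4_ge_one: "1 \<le> k \<Longrightarrow> 1 \<le> c4 m k"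
proof -
  assume k: "1 \<le> k"
  have "0 \<le> 2 * sqrt 2 * real m * real k" "1 \<le> sqrt (real k)" using k by auto
  then have "1 \<le> 2 * sqrt 2 * real m * real k + 2 * sqrt (real k)" by linarith
  then have "1 \<le> c1 m k" unfolding c1_def by simp
  then show ?thesis using c2_nonneg[of m k] by (simp add: c4_def)
qed

text \<open>The first column and the last row of a triangular \<open>R\<close> have one nonzero
  entry each, so the corner entries of B R and R B are single products equal to 1.\<close>

lemma spectral_norm_triangular_inverse:
  assumes R: "R \<in> carrier_mat k k" and B: "B \<in> carrier_mat k k" "R * B = 1\<^sub>m k" "B * R = 1\<^sub>m k"
    and tri: "\<And>i j. \<lbrakk>i < k; j < i\<rbrakk> \<Longrightarrow> R $$ (i, j) = 0" and k: "0 < k"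
  shows "1 \<le> spectral_norm R * spectral_norm B"
    and "1 \<le> \<bar>R $$ (0, 0)\<bar> * spectral_norm B"
    and "1 \<le> \<bar>R $$ (k - 1, k - 1)\<bar> * spectral_norm B"
proof -
  show "1 \<le> spectral_norm R * spectral_norm B"
    using spectral_norm_mult_le[OF R B(1) k k] B(2) spectral_norm_one[OF k] by simp
  have "(\<Sum>p<k. B $$ (0, p) * R $$ (p, 0)) = (B * R) $$ (0, 0)"
    using R B(1) k by (simp add: scalar_prod_def atLeast0LessThan)
  moreover have "(\<Sum>p<k. B $$ (0, p) * R $$ (p, 0)) = (\<Sum>p\<in>{0}. B $$ (0, p) * R $$ (p, 0))"
    using tri k by (intro sum.mono_neutral_right) auto
  ultimately have "1 = \<bar>R $$ (0, 0)\<bar> * \<bar>B $$ (0, 0)\<bar>"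
    using B(3) k by (simp flip: abs_mult add: mult.commute)
  also have "\<dots> \<le> \<bar>R $$ (0, 0)\<bar> * spectral_norm B"
    using abs_index_mat_le_spectral_norm[OF B(1) k k] by (intro mult_left_mono) auto
  finally show "1 \<le> \<bar>R $$ (0, 0)\<bar> * spectral_norm B" .
  let ?l = "k - 1"
  have l: "?l < k" using k by simp
  have "(\<Sum>p<k. R $$ (?l, p) * B $$ (p, ?l)) = (R * B) $$ (?l, ?l)"
    using R B(1) k by (simp add: scalar_prod_def atLeast0LessThan)
  moreover have "(\<Sum>p<k. R $$ (?l, p) * B $$ (p, ?l)) = (\<Sum>p\<in>{?l}. R $$ (?l, p) * B $$ (p, ?l))"
    using tri l by (intro sum.mono_neutral_right) auto
  ultimately have "1 = \<bar>R $$ (?l, ?l)\<bar> * \<bar>B $$ (?l, ?l)\<bar>"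
    using B(2) l by (simp flip: abs_mult)
  also have "\<dots> \<le> \<bar>R $$ (?l, ?l)\<bar> * spectral_norm B"
    using abs_index_mat_le_spectral_norm[OF B(1) l l] by (intro mult_left_mono) auto
  finally show "1 \<le> \<bar>R $$ (?l, ?l)\<bar> * spectral_norm B" .
qed

text \<open>Meant for \<open>e\<close> away from 0: the first-order terms are dropped as
  nonnegative, and the sum of five triangle-inequality bounds becomes the remainder.\<close>

lemma cgsp_bounds_crude:
  assumes A: "A \<in> carrier_mat m k" and Q: "Q \<in> carrier_mat m k" and R: "R \<in> carrier_mat k k"
    and mk: "0 < m" "0 < k" and \<alpha>: "0 < spectral_norm A" and e: "0 < e"
    and q: "spectral_norm Q \<le> \<theta>" and r: "spectral_norm R \<le> \<rho>"
  shows "cgsp_bounds m k A Q R e ((\<theta> * \<rho> + spectral_norm A) + (\<rho>\<^sup>2 + (spectral_norm A)\<^sup>2)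
    + (\<rho> / spectral_norm A + 1) + (1 + \<theta>\<^sup>2) + \<theta>)"
proof -
  let ?\<alpha> = "spectral_norm A"
  have nn: "0 \<le> spectral_norm Q" "0 \<le> spectral_norm R"
    using spectral_norm_nonneg[OF Q mk(2)] spectral_norm_nonneg[OF R mk(2)] by auto
  have "spectral_norm (Q * R - A) \<le> spectral_norm (Q * R) + ?\<alpha>"
    using Q R A mk by (intro spectral_norm_diff_le[of _ m k]) auto
  also have "\<dots> \<le> spectral_norm Q * spectral_norm R + ?\<alpha>"
    using spectral_norm_mult_le[OF Q R mk(2,2)] by simp
  also have "\<dots> \<le> \<theta> * \<rho> + ?\<alpha>" using nn q r by (intro add_right_mono mult_mono) auto
  finally have 1: "spectral_norm (Q * R - A) \<le> \<theta> * \<rho> + ?\<alpha>" .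
  have gram: "spectral_norm (R\<^sup>T * R) = (spectral_norm R)\<^sup>2" "spectral_norm (A\<^sup>T * A) = ?\<alpha>\<^sup>2"
    "spectral_norm (Q\<^sup>T * Q) = (spectral_norm Q)\<^sup>2"
    using spectral_norm_transpose_mult_self R A Q mk by blast+
  have "spectral_norm (R\<^sup>T * R - A\<^sup>T * A) \<le> spectral_norm (R\<^sup>T * R) + spectral_norm (A\<^sup>T * A)"
    using R A mk by (intro spectral_norm_diff_le[of _ k k]) auto
  also have "\<dots> \<le> \<rho>\<^sup>2 + ?\<alpha>\<^sup>2" unfolding gram using nn r by (intro add_right_mono power_mono)
  finally have 2: "spectral_norm (R\<^sup>T * R - A\<^sup>T * A) \<le> \<rho>\<^sup>2 + ?\<alpha>\<^sup>2" .
  have "spectral_norm R / ?\<alpha> \<le> \<rho> / ?\<alpha>" "0 \<le> spectral_norm R / ?\<alpha>"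
    using nn r \<alpha> by (auto intro: divide_right_mono)
  then have 3: "\<bar>spectral_norm R / ?\<alpha> - 1\<bar> \<le> \<rho> / ?\<alpha> + 1" by (simp only: abs_le_iff) linarith
  have "spectral_norm (1\<^sub>m k - Q\<^sup>T * Q) \<le> spectral_norm (1\<^sub>m k) + spectral_norm (Q\<^sup>T * Q)"
    using Q mk by (intro spectral_norm_diff_le[of _ k k]) auto
  also have "\<dots> \<le> 1 + \<theta>\<^sup>2"
    unfolding gram spectral_norm_one[OF mk(2)] using nn q by (intro add_left_mono power_mono)
  finally have 4: "spectral_norm (1\<^sub>m k - Q\<^sup>T * Q) \<le> 1 + \<theta>\<^sup>2" .
  have pos: "0 \<le> c1 m k * ?\<alpha> * e" "0 \<le> c2 m k * ?\<alpha>\<^sup>2 * e" "0 \<le> c3 m k * e" "0 \<le> c4 m k * (kappa2 R)\<^sup>2 * e"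
    "0 \<le> \<theta> * \<rho> + ?\<alpha>" "0 \<le> \<rho>\<^sup>2 + ?\<alpha>\<^sup>2" "0 \<le> \<rho> / ?\<alpha> + 1" "0 \<le> 1 + \<theta>\<^sup>2" "0 \<le> \<theta>" "0 \<le> sqrt (2::real)"
    using c1_nonneg[of m k] c2_nonneg[of m k] c4_nonneg[of m k] e \<alpha> q r nn by (auto simp: c3_def)
  show ?thesis unfolding cgsp_bounds_def using 1 2 3 4 q pos by (intro conjI; linarith)
qed

context cgsp_input
begin

definition runs_from :: "real \<Rightarrow> (real \<times> (nat \<Rightarrow> real mat) \<times> (nat \<Rightarrow> real mat)) set" where
  "runs_from e0 = {(e, R, Q). e0 \<le> e \<and> cgsp_run e A R Q \<and>
    (\<forall>k\<in>{1..n}. invertible_mat (R k) \<and> c4 m k * e * (kappa2 (R k))\<^sup>2 < 1)}"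

text \<open>The hypothesis for k = 1 limits the machine unit itself, since a condition number is at
  least 1 and c4 m 1 = (m + 2) + 2 = m + 4.\<close>

lemma runs_from_unit:
  assumes "(e, R, Q) \<in> runs_from e0" "0 < e0"
  shows "0 < e" "e < 1 / (real m + 4)" "e < 1 / 4"
proof -
  show e: "0 < e" using assms by (simp add: runs_from_def)
  have m: "0 < m" using n1 nm by simp
  have "cgsp_init e (col A 0) (R 1) (Q 1)" using assms by (simp add: runs_from_def cgsp_run_def)
  then have R: "R 1 \<in> carrier_mat 1 1" by (auto simp: cgsp_init_def)
  have inv: "invertible_mat (R 1)" "c4 m 1 * e * (kappa2 (R 1))\<^sup>2 < 1"
    using assms n1 by (auto simp: runs_from_def)
  obtain B where B: "B \<in> carrier_mat 1 1" "R 1 * B = 1\<^sub>m 1" "mat_inverse (R 1) = Some B"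
    using invertible_matE[OF inv(1) R] by metis
  have "1 \<le> kappa2 (R 1)"
    using spectral_norm_mult_le[OF R B(1)] spectral_norm_one[of 1] B by (simp add: kappa2_def)
  then have "1 \<le> (kappa2 (R 1))\<^sup>2" by simp
  then have "c4 m 1 * e * 1 \<le> c4 m 1 * e * (kappa2 (R 1))\<^sup>2"
    using c4_nonneg[of m 1] e by (intro mult_left_mono) auto
  then have "c4 m 1 * e < 1" using inv(2) by linarith
  then have "(real m + 4) * e < 1" by (simp add: c4_def c1_def c2_def add.commute)
  then show em: "e < 1 / (real m + 4)" by (simp add: less_divide_eq mult.commute)
  have "1 / (real m + 4) \<le> 1 / 4" by (simp add: divide_le_eq)
  with em show "e < 1 / 4" by linarith
qed

text \<open>The condition number is bounded on these runs. As \<open>r = R 0 0\<close> is bounded from both sides and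
  \<open>r \<le> \<parallel>R\<parallel>\<close>, \<open>1 / r \<le> \<parallel>inv R\<parallel>\<close>, both \<open>\<parallel>R\<parallel>\<close> and \<open>\<parallel>inv R\<parallel>\<close> are bounded.\<close>

lemma R_bounded:
  assumes e0: "0 < e0"
  shows "\<exists>\<rho>>0. \<forall>(e, R, Q)\<in>runs_from e0. \<forall>k\<in>{1..n}.
    spectral_norm (R k) \<le> \<rho> \<and> 1 \<le> \<rho> * R n $$ (k - 1, k - 1)"
proof -
  define S where "S = (\<Sum>l<m. (A $$ (l, 0))\<^sup>2)"
  have "S = (rx 0 0)\<^sup>2" using rx_column[of 0] n1 by (simp add: S_def)
  then have S: "0 < S" using rx_pos[of 0] n1 by simp
  \<comment> \<open>As \<open>c4\<close> is at least 1, the square of the condition number is at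
    most 1 / e0, and any \<kappa> >= 1 is at most 1 + \<kappa>^2. In \<open>lo\<close> and
    \<open>hi\<close>, 3/4 and 2 bound 1 - e and 1 + e because e < 1/4.\<close>
  define K where "K = 1 + 1 / e0"
  define lo where "lo = sqrt ((3 / 4) ^ (m + 2) * S)"
  define hi where "hi = sqrt (2 ^ (m + 2) * S)"
  have lohi: "0 < lo" "0 < hi" using S by (auto simp: lo_def hi_def)
  have K: "0 < K" using e0 by (simp add: K_def add_pos_pos)
  have main: "spectral_norm (R k) \<le> K * hi \<and> 1 \<le> K / lo * R n $$ (k - 1, k - 1)"
    if w: "(e, R, Q) \<in> runs_from e0" and k: "1 \<le> k" "k \<le> n" for e R Q k
  proof -
    note e = runs_from_unit[OF w e0]
    have run: "cgsp_run e A R Q" "0 < e" "e < 1" using w e by (auto simp: runs_from_def)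
    note f = run_facts[OF run k]
    have k0: "0 < k" using k by simp
    have inv: "invertible_mat (R k)" "c4 m k * e * (kappa2 (R k))\<^sup>2 < 1"
      using w k by (auto simp: runs_from_def)
    obtain B where B: "B \<in> carrier_mat k k" "R k * B = 1\<^sub>m k" "B * R k = 1\<^sub>m k" "mat_inverse (R k) = Some B"
      using invertible_matE[OF inv(1) f(1)] by metis
    let ?\<kappa> = "spectral_norm (R k) * spectral_norm B"
    have kap: "kappa2 (R k) = ?\<kappa>" by (simp add: kappa2_def B)
    note t = spectral_norm_triangular_inverse[OF f(1) B(1-3) f(3) k0]
    have "1 * e0 * ?\<kappa>\<^sup>2 \<le> c4 m k * e * ?\<kappa>\<^sup>2"
      using c4_ge_one[OF k(1), of m] w e0 by (intro mult_right_mono mult_mono) (auto simp: runs_from_def)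
    then have "?\<kappa>\<^sup>2 \<le> 1 / e0" using inv(2) e0 unfolding kap by (simp add: pos_le_divide_eq mult.commute)
    moreover have "?\<kappa> \<le> 1 + ?\<kappa>\<^sup>2"
      using self_le_power[OF t(1), of 2] zero_le_power2[of ?\<kappa>] by linarith
    ultimately have \<kappa>: "?\<kappa> \<le> K" by (simp add: K_def)
    have col: "gs_column e m (\<lambda>l j. A $$ (l, j)) (\<lambda>l j. Q n $$ (l, j)) (\<lambda>i j. R n $$ (i, j)) j" if "j < n" for j
      using run_column[OF run n1 order_refl that] .
    define r where "r = R n $$ (0, 0)"
    have r: "0 < r" "(1 - e) ^ (m + 2) * S \<le> r\<^sup>2" "\<bar>r\<^sup>2 - S\<bar> \<le> ((1 + e) ^ (m + 2) - 1) * S"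
      using col[of 0] n1 by (auto simp: gs_column_def r_def S_def)
    have "(3 / 4) ^ (m + 2) \<le> (1 - e) ^ (m + 2)" using e by (intro power_mono) auto
    then have "(3 / 4) ^ (m + 2) * S \<le> r\<^sup>2" using r(2) S by (meson less_imp_le mult_right_mono order_trans)
    then have rlo: "lo \<le> r" using r(1) by (simp add: lo_def real_le_lsqrt real_sqrt_le_iff real_le_rsqrt flip: real_sqrt_abs2)
    have "(1 + e) ^ (m + 2) \<le> 2 ^ (m + 2)" using e by (intro power_mono) auto
    then have "(1 + e) ^ (m + 2) * S \<le> 2 ^ (m + 2) * S" using S by (intro mult_right_mono) auto
    then have "r\<^sup>2 \<le> 2 ^ (m + 2) * S" using r(3) by (simp add: abs_le_iff algebra_simps)
    then have rhi: "r \<le> hi" unfolding hi_def by (rule real_le_rsqrt)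
    have r00: "R k $$ (0, 0) = r" using f(5)[of 0 0] k by (simp add: r_def)
    have B0: "0 \<le> spectral_norm B" "0 \<le> spectral_norm (R k)"
      using spectral_norm_nonneg[OF B(1) k0] spectral_norm_nonneg[OF f(1) k0] by auto
    have "spectral_norm (R k) * 1 \<le> spectral_norm (R k) * (r * spectral_norm B)"
      using t(2) r B0 unfolding r00 by (intro mult_left_mono) auto
    also have "\<dots> = ?\<kappa> * r" by simp
    also have "\<dots> \<le> K * hi" using \<kappa> rhi r(1) K by (intro mult_mono) auto
    finally have 1: "spectral_norm (R k) \<le> K * hi" by simp
    have "r \<le> spectral_norm (R k)"
      using abs_index_mat_le_spectral_norm[OF f(1) k0 k0] r unfolding r00 by simp
    with rlo have "lo * spectral_norm B \<le> ?\<kappa>" using B0 by (intro mult_right_mono) auto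
    then have "spectral_norm B \<le> K / lo" using \<kappa> lohi by (simp add: pos_le_divide_eq mult.commute)
    moreover have d: "R k $$ (k - 1, k - 1) = R n $$ (k - 1, k - 1)" "0 < R n $$ (k - 1, k - 1)"
      using f(5)[of "k - 1" "k - 1"] col[of "k - 1"] k by (auto simp: gs_column_def)
    ultimately have "R n $$ (k - 1, k - 1) * spectral_norm B \<le> R n $$ (k - 1, k - 1) * (K / lo)"
      by (intro mult_left_mono) auto
    then show ?thesis using 1 t(3) d by (simp add: mult.commute)
  qed
  show ?thesis
  proof (intro exI[of _ "max (K * hi) (K / lo)"] conjI)
    show "0 < max (K * hi) (K / lo)" using K lohi by (simp add: less_max_iff_disj)
    show "\<forall>(e, R, Q)\<in>runs_from e0. \<forall>k\<in>{1..n}. spectral_norm (R k) \<le> max (K * hi) (K / lo) \<and>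
      1 \<le> max (K * hi) (K / lo) * R n $$ (k - 1, k - 1)"
    proof (clarify)
      fix e R Q k assume w: "(e, R, Q) \<in> runs_from e0" and k: "k \<in> {1..n}"
      note m = main[OF w, of k]
      have "0 < R n $$ (k - 1, k - 1)"
        using run_column[of e R Q n "k - 1"] runs_from_unit[OF w e0] w k n1
        by (auto simp: gs_column_def runs_from_def)
      then have "K / lo * R n $$ (k - 1, k - 1) \<le> max (K * hi) (K / lo) * R n $$ (k - 1, k - 1)"
        by (intro mult_right_mono) auto
      then show "spectral_norm (R k) \<le> max (K * hi) (K / lo) \<and>
        1 \<le> max (K * hi) (K / lo) * R n $$ (k - 1, k - 1)"
        using m k by auto
    qed
  qed
qed

text \<open>Earlier columns bound q_lj r_jj through the rounding estimate of
  \<open>gs_column\<close>, and \<open>R_bounded\<close> keeps r_jj away from 0.\<close>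

lemma Q_bounded:
  assumes e0: "0 < e0" and j: "j \<le> n"
  shows "\<exists>D\<ge>0. \<forall>(e, R, Q)\<in>runs_from e0. \<forall>l<m. \<forall>i<j. \<bar>Q n $$ (l, i)\<bar> \<le> D"
  using j
proof (induction j)
  case (Suc j)
  then obtain D where D: "0 \<le> D" "\<And>e R Q l i. \<lbrakk>(e, R, Q) \<in> runs_from e0; l < m; i < j\<rbrakk> \<Longrightarrow> \<bar>Q n $$ (l, i)\<bar> \<le> D"
    by (fastforce simp: case_prod_beta)
  obtain \<rho> where \<rho>: "0 < \<rho>" "\<And>e R Q k. \<lbrakk>(e, R, Q) \<in> runs_from e0; 1 \<le> k; k \<le> n\<rbrakk> \<Longrightarrow>
    spectral_norm (R k) \<le> \<rho> \<and> 1 \<le> \<rho> * R n $$ (k - 1, k - 1)"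
    using R_bounded[OF e0] by (fastforce simp: case_prod_beta)
  define T where "T = real j * (D * \<rho>)"
  define \<alpha> where "\<alpha> = spectral_norm A"
  \<comment> \<open>The exact residual is at most \<alpha> + T. Its rounding error uses (1 + e)^2 <=
    4 and (1 + e)^j <= 2^j, whence 4 * 2^j and 4 - 1 = 3; the outer \<rho> bounds 1 / r_jj.\<close>
  define D' where "D' = \<rho> * ((\<alpha> + T) + (4 * 2 ^ j * T + 3 * (\<alpha> + T)))"
  have T0: "0 \<le> T" using D \<rho> by (simp add: T_def)
  have \<alpha>0: "0 \<le> \<alpha>" using spectral_norm_nonneg[OF A] n1 by (simp add: \<alpha>_def)
  have "\<bar>Q n $$ (l, j)\<bar> \<le> D'" if w: "(e, R, Q) \<in> runs_from e0" and l: "l < m" for e R Q l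
  proof -
    note e = runs_from_unit[OF w e0]
    have run: "cgsp_run e A R Q" "0 < e" "e < 1" using w e by (auto simp: runs_from_def)
    have R: "R n \<in> carrier_mat n n" by (rule run_R[OF run n1 order_refl])
    let ?S = "\<Sum>i<j. Q n $$ (l, i) * R n $$ (i, j)" and ?T = "\<Sum>i<j. \<bar>Q n $$ (l, i) * R n $$ (i, j)\<bar>"
    let ?v = "A $$ (l, j) - ?S" and ?x = "Q n $$ (l, j) * R n $$ (j, j)"
    have col: "\<bar>?x - ?v\<bar> \<le> (1 + e)\<^sup>2 * ((1 + e) ^ j - 1) * ?T + ((1 + e)\<^sup>2 - 1) * \<bar>?v\<bar>" and rj: "0 < R n $$ (j, j)"
      using run_column[OF run n1 order_refl, of j] Suc.prems l by (auto simp: gs_column_def)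
    have "?T \<le> (\<Sum>i<j. D * \<rho>)"
    proof (rule sum_mono)
      fix i assume i: "i \<in> {..<j}"
      have "\<bar>R n $$ (i, j)\<bar> \<le> spectral_norm (R n)"
        using i Suc.prems by (intro abs_index_mat_le_spectral_norm[OF R]) auto
      also have "\<dots> \<le> \<rho>" using \<rho>(2)[OF w n1 order_refl] by simp
      finally show "\<bar>Q n $$ (l, i) * R n $$ (i, j)\<bar> \<le> D * \<rho>"
        unfolding abs_mult using D w l i by (intro mult_mono) auto
    qed
    then have T: "?T \<le> T" by (simp add: T_def)
    moreover have "\<bar>?S\<bar> \<le> ?T" by (rule sum_abs)
    moreover have "\<bar>A $$ (l, j)\<bar> \<le> \<alpha>"
      unfolding \<alpha>_def using l Suc.prems by (intro abs_index_mat_le_spectral_norm[OF A]) auto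
    ultimately have v: "\<bar>?v\<bar> \<le> \<alpha> + T" by linarith
    have p: "(1 + e)\<^sup>2 \<le> 2\<^sup>2" "(1 + e) ^ j \<le> 2 ^ j" using e by (intro power_mono; simp)+
    have "(1 + e)\<^sup>2 * ((1 + e) ^ j - 1) * ?T \<le> 4 * 2 ^ j * T"
      using p T e by (intro mult_mono mult_nonneg_nonneg sum_nonneg) auto
    moreover have "((1 + e)\<^sup>2 - 1) * \<bar>?v\<bar> \<le> 3 * (\<alpha> + T)" using p v by (intro mult_mono) auto
    ultimately have x: "\<bar>?x\<bar> \<le> (\<alpha> + T) + (4 * 2 ^ j * T + 3 * (\<alpha> + T))" using col v by linarith
    have "1 \<le> \<rho> * R n $$ (j, j)" using \<rho>(2)[OF w, of "Suc j"] Suc.prems by simp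
    then have "\<bar>Q n $$ (l, j)\<bar> * 1 \<le> \<bar>Q n $$ (l, j)\<bar> * (\<rho> * R n $$ (j, j))"
      by (intro mult_left_mono) auto
    also have "\<dots> = \<rho> * \<bar>?x\<bar>" using rj by (simp add: abs_mult)
    also have "\<dots> \<le> D'" unfolding D'_def using x \<rho>(1) by (intro mult_left_mono) auto
    finally show ?thesis by simp
  qed
  with D show ?case
    by (intro exI[of _ "max D D'"]) (auto simp: less_Suc_eq le_max_iff_disj case_prod_beta)
qed (auto intro: exI[of _ 0])

lemma bounds_large:
  assumes e0: "0 < e0" and k: "1 \<le> k" "k \<le> n"
  shows "\<exists>D. \<forall>(e, R, Q)\<in>runs_from e0. cgsp_bounds m k (leading_cols k A) (Q k) (R k) e D"
proof -
  obtain \<rho> where \<rho>: "\<And>e R Q. (e, R, Q) \<in> runs_from e0 \<Longrightarrow> spectral_norm (R k) \<le> \<rho>"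
    using R_bounded[OF e0] k by (fastforce simp: case_prod_beta)
  obtain D where D: "0 \<le> D" "\<And>e R Q l i. \<lbrakk>(e, R, Q) \<in> runs_from e0; l < m; i < n\<rbrakk> \<Longrightarrow> \<bar>Q n $$ (l, i)\<bar> \<le> D"
    using Q_bounded[OF e0 order_refl] by (fastforce simp: case_prod_beta)
  let ?\<theta> = "sqrt (real m * real k) * D" and ?\<alpha> = "spectral_norm (leading_cols k A)"
  have "cgsp_bounds m k (leading_cols k A) (Q k) (R k) e ((?\<theta> * \<rho> + ?\<alpha>) + (\<rho>\<^sup>2 + ?\<alpha>\<^sup>2)
    + (\<rho> / ?\<alpha> + 1) + (1 + ?\<theta>\<^sup>2) + ?\<theta>)" if w: "(e, R, Q) \<in> runs_from e0" for e R Q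
  proof (rule cgsp_bounds_crude[OF leading_cols_carrier])
    note e = runs_from_unit[OF w e0]
    have run: "cgsp_run e A R Q" "0 < e" "e < 1" using w e by (auto simp: runs_from_def)
    note f = run_facts[OF run k]
    show "Q k \<in> carrier_mat m k" "R k \<in> carrier_mat k k" by (fact f)+
    show "0 < m" "0 < k" using k nm by auto
    show "0 < e" by (rule run)
    show "0 < ?\<alpha>" by (rule leading_cols_norm_pos[OF k])
    show "spectral_norm (R k) \<le> \<rho>" by (rule \<rho>[OF w])
    have "frobenius (Q k) \<le> ?\<theta>"
      using f(6) D w k by (intro frobenius_le_max[OF f(2)]) auto
    then show "spectral_norm (Q k) \<le> ?\<theta>"
      using spectral_norm_le_frobenius[OF f(2)] k by simp
  qed
  then show ?thesis by blast
qed

section \<open>Joining small and large machine units\<close>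

lemma bounds_leading_cols:
  assumes k: "1 \<le> k" "k \<le> n"
  shows "\<exists>C. \<forall>e R Q. 0 < e \<longrightarrow> cgsp_run e A R Q \<longrightarrow>
    (\<forall>k\<in>{1..n}. invertible_mat (R k) \<and> c4 m k * e * (kappa2 (R k))\<^sup>2 < 1) \<longrightarrow>
    cgsp_bounds m k (leading_cols k A) (Q k) (R k) e (C * e\<^sup>2)"
proof -
  obtain G e0 where e0: "0 < e0" and G: "\<And>e R Q. \<lbrakk>0 < e; e < e0; cgsp_run e A R Q;
    invertible_mat (R k); c4 m k * e * (kappa2 (R k))\<^sup>2 < 1\<rbrakk> \<Longrightarrow>
    cgsp_bounds m k (leading_cols k A) (Q k) (R k) e (G * e\<^sup>2)"
    using bounds_small[OF k] by blast
  obtain D where D: "\<And>e R Q. (e, R, Q) \<in> runs_from e0 \<Longrightarrow>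
    cgsp_bounds m k (leading_cols k A) (Q k) (R k) e D"
    using bounds_large[OF e0 k] by blast
  define C where "C = max G (\<bar>D\<bar> / e0\<^sup>2)"
  show ?thesis
  proof (intro exI[of _ C] allI impI)
    fix e R Q
    assume *: "0 < e" "cgsp_run e A R Q"
      "\<forall>k\<in>{1..n}. invertible_mat (R k) \<and> c4 m k * e * (kappa2 (R k))\<^sup>2 < 1"
    show "cgsp_bounds m k (leading_cols k A) (Q k) (R k) e (C * e\<^sup>2)"
    proof (cases "e < e0")
      case True
      then have "cgsp_bounds m k (leading_cols k A) (Q k) (R k) e (G * e\<^sup>2)"
        using * k by (intro G) auto
      then show ?thesis
        by (rule cgsp_bounds_mono) (simp add: C_def mult_right_mono)
    next
      case False
      then have "cgsp_bounds m k (leading_cols k A) (Q k) (R k) e D"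
        using * by (intro D) (simp add: runs_from_def)
      moreover have "D \<le> C * e\<^sup>2"
      proof -
        have "e0\<^sup>2 \<le> e\<^sup>2" using False e0 by (intro power_mono) auto
        then have "\<bar>D\<bar> / e0\<^sup>2 * e0\<^sup>2 \<le> C * e\<^sup>2"
          using e0 by (intro mult_mono) (auto simp: C_def le_max_iff_disj)
        then show ?thesis using e0 by simp
      qed
      ultimately show ?thesis by (rule cgsp_bounds_mono)
    qed
  qed
qed

lemma uniform_bounds:
  "\<exists>C. \<forall>k\<in>{1..n}. \<forall>e R Q. 0 < e \<longrightarrow> cgsp_run e A R Q \<longrightarrow>
    (\<forall>k\<in>{1..n}. invertible_mat (R k) \<and> c4 m k * e * (kappa2 (R k))\<^sup>2 < 1) \<longrightarrow>
    cgsp_bounds m k (leading_cols k A) (Q k) (R k) e (C * e\<^sup>2)"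
proof -
  have "\<forall>k\<in>{1..n}. \<exists>C. \<forall>e R Q. 0 < e \<longrightarrow> cgsp_run e A R Q \<longrightarrow>
    (\<forall>k\<in>{1..n}. invertible_mat (R k) \<and> c4 m k * e * (kappa2 (R k))\<^sup>2 < 1) \<longrightarrow>
    cgsp_bounds m k (leading_cols k A) (Q k) (R k) e (C * e\<^sup>2)"
    using bounds_leading_cols by simp
  then obtain C where C: "\<forall>k\<in>{1..n}. \<forall>e R Q. 0 < e \<longrightarrow> cgsp_run e A R Q \<longrightarrow>
    (\<forall>k\<in>{1..n}. invertible_mat (R k) \<and> c4 m k * e * (kappa2 (R k))\<^sup>2 < 1) \<longrightarrow>
    cgsp_bounds m k (leading_cols k A) (Q k) (R k) e (C k * e\<^sup>2)"
    by (rule bchoice[THEN exE]) blast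
  \<comment> \<open>The constants may be negative, so a sum of absolute values is used to dominate
    each of them.\<close>
  have "C k * e\<^sup>2 \<le> (\<Sum>k=1..n. \<bar>C k\<bar>) * e\<^sup>2" if "k \<in> {1..n}" for k and e :: real
  proof (rule mult_right_mono)
    have "\<bar>C k\<bar> \<le> (\<Sum>k=1..n. \<bar>C k\<bar>)" using that by (intro member_le_sum) auto
    then show "C k \<le> (\<Sum>k=1..n. \<bar>C k\<bar>)" by linarith
  qed simp
  then show ?thesis
    using C by (intro exI[of _ "\<Sum>k=1..n. \<bar>C k\<bar>"] ballI allI impI)
      (rule cgsp_bounds_mono, blast+)
qed

end

theorem theorem1:
  fixes m n :: nat and A :: "real mat"
  assumes "1 \<le> n" and "n \<le> m"
    and "A \<in> carrier_mat m n"
    and "vec_space.rank m A = n"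
  shows "\<exists>g :: real \<Rightarrow> real. g \<in> O[at_right 0](\<lambda>e. e\<^sup>2) \<and>
    (\<forall>e R Q. 0 < e \<longrightarrow> cgsp_run e A R Q \<longrightarrow>
      (\<forall>k\<in>{1..n}. invertible_mat (R k) \<and> c4 m k * e * (kappa2 (R k))\<^sup>2 < 1) \<longrightarrow>
      (\<forall>k\<in>{1..n}. \<exists>\<Delta>A E \<mu>.
         Q k * R k - leading_cols k A = \<Delta>A \<and>
         spectral_norm \<Delta>A \<le> c1 m k * spectral_norm (leading_cols k A) * e + g e \<and>
         (R k)\<^sup>T * R k - (leading_cols k A)\<^sup>T * leading_cols k A = E \<and>
         spectral_norm E \<le> c2 m k * (spectral_norm (leading_cols k A))\<^sup>2 * e + g e \<and>
         spectral_norm (R k) = spectral_norm (leading_cols k A) * (1 + \<mu>) \<and>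
         \<bar>\<mu>\<bar> \<le> c3 m k * e + g e \<and>
         spectral_norm (1\<^sub>m k - (Q k)\<^sup>T * Q k) \<le> c4 m k * (kappa2 (R k))\<^sup>2 * e + g e \<and>
         spectral_norm (Q k) \<le> sqrt 2 + g e))"
proof -
  interpret cgsp_input m n A using assms by unfold_locales
  obtain C where C: "\<forall>k\<in>{1..n}. \<forall>e R Q. 0 < e \<longrightarrow> cgsp_run e A R Q \<longrightarrow>
    (\<forall>k\<in>{1..n}. invertible_mat (R k) \<and> c4 m k * e * (kappa2 (R k))\<^sup>2 < 1) \<longrightarrow>
    cgsp_bounds m k (leading_cols k A) (Q k) (R k) e (C * e\<^sup>2)"
    using uniform_bounds by blast
  show ?thesis
  proof (intro exI[of _ "\<lambda>e. C * e\<^sup>2"] conjI allI impI ballI)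
    show "(\<lambda>e. C * e\<^sup>2) \<in> O[at_right 0](\<lambda>e. e\<^sup>2)" by simp
    fix e R Q k
    assume e: "0 < e" and run: "cgsp_run e A R Q" and k: "k \<in> {1..n}"
      and hyp: "\<forall>k\<in>{1..n}. invertible_mat (R k) \<and> c4 m k * e * (kappa2 (R k))\<^sup>2 < 1"
    let ?A = "leading_cols k A"
    have b: "cgsp_bounds m k ?A (Q k) (R k) e (C * e\<^sup>2)" using C e run k hyp by blast
    have "spectral_norm ?A \<noteq> 0" using leading_cols_norm_pos[of k] k by simp
    \<comment> \<open>The witness for mu is ||R|| / ||A|| - 1, legitimate because full rank makes
      ||A|| nonzero.\<close>
    then have "spectral_norm (R k) = spectral_norm ?A * (1 + (spectral_norm (R k) / spectral_norm ?A - 1))"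
      by simp
    with b show "\<exists>\<Delta>A E \<mu>. Q k * R k - ?A = \<Delta>A \<and>
      spectral_norm \<Delta>A \<le> c1 m k * spectral_norm ?A * e + C * e\<^sup>2 \<and>
      (R k)\<^sup>T * R k - ?A\<^sup>T * ?A = E \<and>
      spectral_norm E \<le> c2 m k * (spectral_norm ?A)\<^sup>2 * e + C * e\<^sup>2 \<and>
      spectral_norm (R k) = spectral_norm ?A * (1 + \<mu>) \<and>
      \<bar>\<mu>\<bar> \<le> c3 m k * e + C * e\<^sup>2 \<and>
      spectral_norm (1\<^sub>m k - (Q k)\<^sup>T * Q k) \<le> c4 m k * (kappa2 (R k))\<^sup>2 * e + C * e\<^sup>2 \<and>
      spectral_norm (Q k) \<le> sqrt 2 + C * e\<^sup>2"
      unfolding cgsp_bounds_def by blast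
  qed
qed

end
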